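(* Let $\Sigma$ be the fan in $\mathbb R^n$ consisting of all faces of $\mathbb R_{\ge0}^n$, so that $N_\Sigma=(\mathbb R\cup\{\infty\})^n$, and let $U$ be an open subset of $(\mathbb R\cup\{\infty\})^n$. If $T$ is a positive Lagerberg current in $D^{p,p}(U)$, then there is a decomposition $$T=\sum_{\sigma\in\Sigma}T_\sigma$$ with uniquely determined Lagerberg currents $T_\sigma\in D^{p,p}(U)$, having real Radon measures as co-coefficients, such that for every $\sigma\in\Sigma$ and all $I,J\subset\{1,\dots,n\}$ with $|I|=|J|=n-p$ the set $U\setminus(E^{I\cup J}\cup N(\sigma))$ is a null set with respect to the Radon measure $T_\sigma^{IJ}$.
   Context: **Space.** $N=\mathbb Z^n$, $\mathbb R_\infty=\mathbb R\cup\{\infty\}$. The cones of $\Sigma$ are $\sigma_L=\{u\in\mathbb R_{\ge0}^n: u_i=0\ \forall i\notin L\}$, $L\subset\{1,\dots,n\}$; $N_\Sigma=\mathbb R_\infty^n$ (product topology) is stratified by $N(\sigma_L)=\{u\in\mathbb R_\infty^n: u_i=\infty\iff i\in L\}$, a real vector space with coordinates $u_i$, $i\notin L$. For $\sigma_{L'}\prec\sigma_L$ (i.e. $L'\subset L$), $\pi_{\sigma_L,\sigma_{L'}}\colon N(\sigma_{L'})\to N(\sigma_L)$ forgets the coordinates in $L\setminus L'$. For $K\subset\{1,\dots,n\}$, $E^K=\{u\in\mathbb R_\infty^n: u_i=\infty\text{ for some }i\in K\}$. **Lagerberg forms.** For $W$ open in a real vector space with linear coordinates $u_i$, $A^{p,q}(W)=A^p(W)\otimes_{C^\infty(W)}A^q(W)$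 (real smooth forms), elements $\sum f_{IJ}d'u_I\wedge d''u_J$; all $d'u_i,d''u_j$ anticommute; $J$ is the $C^\infty$-linear algebra involution exchanging $d'u_i$ and $d''u_i$. For $U\subset N_\Sigma$ open, $A^{p,q}(U)$ is the set of families $\omega=(\omega_\sigma)_\sigma$, $\omega_\sigma\in A^{p,q}(U\cap N(\sigma))$, such that each $x\in U\cap N(\sigma)$ has a neighborhood $V'$ in $U$ with $\omega_\tau=\pi_{\sigma,\tau}^*\omega_\sigma$ on $V'\cap N(\tau)\cap\pi_{\sigma,\tau}^{-1}(V'\cap N(\sigma))$ for all $\tau\prec\sigma$; $A_c^{p,q}(U)$ are those with compact support. $\omega\in A^{p,p}(U)$ is positive if pointwise it lies in the convex cone spanned by $(-1)^{p(p-1)/2}\alpha\wedge J(\alpha)$, $\alpha$ of type $(p,0)$. **Currents.** For $K\subset U$ compact and a finite open covering $(V_i)_i$ of $K$ in $U$, $A_K^{p,q}(U,(V_i)_i)$ is the space of $\omega\in A_c^{p,q}(U)$ supported in $K$ with $\omega_\tau=\pi_{\sigma,\tau}^*\omega_\sigma$ on $V_i\cap N(\tau)\cap\pi_{\sigma,\tau}^{-1}(V_i\cap N(\sigma))$ for all $i$ and all $\tau\prec\sigma$ with $V_i\cap N(\sigma)\neq\emptyset$, with the norms $\|\omega\|_m=\sum_{|\alpha|\le m}\sum_{I,J}\sup_K|\partial^\alpha f_{IJ}|$, $m\in\mathbb N$. $A_c^{p,q}(U)$ has the direct limit topology over all $(K,(V_i)_i)$ in locally convex topological vector spaces; $D^{p,q}(U)$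 is the space of continuous linear functionals $A_c^{n-p,n-q}(U)\to\mathbb R$. $T\in D^{p,p}(U)$ is positive if $T(J\omega)=(-1)^{n-p}T(\omega)$ for all $\omega$ (symmetry) and $T(\alpha)\ge0$ for all positive $\alpha\in A_c^{n-p,n-p}(U)$. **Co-coefficients.** For $T\in D^{p,p}(U)$, $q=n-p$, $|I|=|J|=q$, the co-coefficient $T^{IJ}\in D^{n,n}(U\setminus E^{I\cup J})$ is $T^{IJ}(f)=T((-1)^{q(q-1)/2}f\,d'u_I\wedge d''u_J)$ for $f\in A_c^{0,0}(U\setminus E^{I\cup J})$. It is a real Radon measure if it extends to a continuous linear functional on compactly supported continuous real functions; a null set for a real Radon measure is one of measure zero for its total variation measure. (Positive Lagerberg currents have real Radon measures as co-coefficients.) *)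

theory Defs
  imports "HOL-Analysis.Analysis"
begin

text \<open>The index set \<open>{1,\<dots>,n}\<close> is a finite linearly ordered type \<open>'n\<close>; a cone \<open>\<sigma>\<^sub>L\<close> of the fan
  is given by its index set \<open>L :: 'n set\<close>. The points of \<open>N\<^sub>\<Sigma>\<close> are the vectors of extended
  reals without a coordinate \<open>-\<infinity>\<close>, with the topology induced from \<^typ>\<open>ereal ^ 'n\<close>.\<close>

type_synonym 'n point = "(ereal, 'n) vec"

definition NSigma :: "'n::finite point set" where
  "NSigma = {u. \<forall>i. u $ i \<noteq> -\<infinity>}"

definition stratum :: "'n set \<Rightarrow> 'n::finite point set" where
  "stratum L = {u \<in> NSigma. \<forall>i. u $ i = \<infinity> \<longleftrightarrow> i \<in> L}"

text \<open>For \<open>L' \<subseteq> L\<close> the restriction of \<open>proj L\<close> to \<open>stratum L'\<close> is the projection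
  \<open>N(\<sigma>\<^bsub>L'\<^esub>) \<rightarrow> N(\<sigma>\<^bsub>L\<^esub>)\<close>: forgetting a coordinate means setting it to \<open>\<infinity>\<close>.\<close>

definition proj :: "'n set \<Rightarrow> 'n point \<Rightarrow> 'n::finite point" where
  "proj L u = (\<chi> i. if i \<in> L then \<infinity> else u $ i)"

definition E_infty :: "'n set \<Rightarrow> 'n::finite point set" where
  "E_infty K = {u \<in> NSigma. \<exists>i\<in>K. u $ i = \<infinity>}"

lemma proj_stratum: "u \<in> stratum L' \<Longrightarrow> L' \<subseteq> L \<Longrightarrow> proj L u \<in> stratum L"
  by (auto simp: stratum_def proj_def NSigma_def)

lemma open_NSigma: "open (NSigma :: 'n::finite point set)"
proof -
  have eq: "(NSigma :: 'n point set) = (\<Inter>i\<in>UNIV. (\<lambda>u. u $ i) -` {- \<infinity><..})"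
    by (auto simp: NSigma_def)
  show ?thesis
    unfolding eq by (intro open_INT ballI open_vimage_vec_nth) auto
qed

text \<open>The vector \<open>a\<close> stands for \<open>\<Sum> a $ (I,J) d'u\<^sub>I \<and> d''u\<^sub>J\<close>, where \<open>d'u\<^sub>I\<close> is the product of the \<open>d'u\<^sub>i\<close>,
  \<open>i \<in> I\<close>, in increasing order, and \<open>d''u\<^sub>J\<close> likewise.\<close>

type_synonym 'n ext = "real ^ ('n set \<times> 'n set)"

definition du :: "'n set \<Rightarrow> 'n set \<Rightarrow> 'n::finite ext" where
  "du I J = axis (I, J) 1"

text \<open>\<open>shuffle_sign I K\<close> is the sign in \<open>d'u\<^sub>I \<and> d'u\<^sub>K = \<plusminus> d'u\<^bsub>I \<union> K\<^esub>\<close> for disjoint \<open>I\<close>, \<open>K\<close>.\<close>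

definition shuffle_sign :: "'n set \<Rightarrow> 'n::{finite,linorder} set \<Rightarrow> real" where
  "shuffle_sign I K = (-1) ^ card {(i, k). i \<in> I \<and> k \<in> K \<and> k < i}"

text \<open>The factor \<open>(-1) ^ (card J * card (P - I))\<close> comes from moving \<open>d'u\<^bsub>P - I\<^esub>\<close> past \<open>d''u\<^sub>J\<close>.\<close>

definition wedge :: "'n ext \<Rightarrow> 'n ext \<Rightarrow> 'n::{finite,linorder} ext" (infixl \<open>\<and>\<^sub>e\<close> 70) where
  "a \<and>\<^sub>e b = (\<chi> PQ. let (P, Q) = PQ in \<Sum>I\<in>Pow P. \<Sum>J\<in>Pow Q.
      (-1) ^ (card J * card (P - I)) * shuffle_sign I (P - I) * shuffle_sign J (Q - J)
      * a $ (I, J) * b $ (P - I, Q - J))"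

text \<open>\<open>J(d'u\<^sub>I \<and> d''u\<^sub>J) = d''u\<^sub>I \<and> d'u\<^sub>J = (-1)\<^bsup>|I||J|\<^esup> d'u\<^sub>J \<and> d''u\<^sub>I\<close>.\<close>

definition Jinv :: "'n ext \<Rightarrow> 'n::finite ext" where
  "Jinv a = (\<chi> IJ. let (I, J) = IJ in (-1) ^ (card I * card J) * a $ (J, I))"

text \<open>Elements of type \<open>(p,q)\<close> over the coordinates \<open>u\<^sub>i\<close>, \<open>i \<in> M\<close>. On \<open>stratum L\<close> one has \<open>M = - L\<close>.\<close>

definition ext_type :: "'n set \<Rightarrow> nat \<Rightarrow> nat \<Rightarrow> 'n::finite ext set" where
  "ext_type M p q =
    {a. \<forall>I J. a $ (I, J) \<noteq> 0 \<longrightarrow> card I = p \<and> card J = q \<and> I \<subseteq> M \<and> J \<subseteq> M}"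

lemma du_nth: "du I J $ (P, Q) = (if P = I \<and> Q = J then 1 else 0)"
  by (auto simp: du_def axis_def)

lemma Jinv_nth: "Jinv a $ (I, J) = (-1) ^ (card I * card J) * a $ (J, I)"
  by (simp add: Jinv_def)

lemma Jinv_Jinv: "Jinv (Jinv a) = a"
proof -
  have "Jinv (Jinv a) $ (I, J) = a $ (I, J)" for I J
    by (simp add: Jinv_nth mult.commute[of "card J" "card I"] power_mult_distrib[symmetric])
  then show ?thesis
    by (simp add: vec_eq_iff split_paired_all)
qed

lemma Jinv_du_single: "Jinv (du {i} {}) = du {} {i}" "Jinv (du {} {i}) = du {i} {}"
  by (auto simp: vec_eq_iff Jinv_nth du_nth)

lemma shuffle_sign_empty [simp]: "shuffle_sign I {} = 1" "shuffle_sign {} I = 1"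
  by (simp_all add: shuffle_sign_def)

lemma wedge_nth:
  "(a \<and>\<^sub>e b) $ (P, Q) = (\<Sum>I\<in>Pow P. \<Sum>J\<in>Pow Q.
      (-1) ^ (card J * card (P - I)) * shuffle_sign I (P - I) * shuffle_sign J (Q - J)
      * a $ (I, J) * b $ (P - I, Q - J))"
  by (simp add: wedge_def)

lemma sum_if: "(\<Sum>x\<in>A. if c then f x else 0) = (if c then sum f A else (0::real))"
  by simp

lemma wedge_du:
  assumes "I \<inter> K = {}" "J \<inter> L = {}"
  shows "du I J \<and>\<^sub>e du K L =
    ((-1) ^ (card J * card K) * shuffle_sign I K * shuffle_sign J L) *\<^sub>R du (I \<union> K) (J \<union> L)"
proof -
  define c where "c = (-1) ^ (card J * card K) * shuffle_sign I K * shuffle_sign J L"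
  have "(du I J \<and>\<^sub>e du K L) $ (P, Q) = (c *\<^sub>R du (I \<union> K) (J \<union> L)) $ (P, Q)" for P Q
  proof -
    have *: "I' \<subseteq> P' \<Longrightarrow> I' = I0 \<and> P' - I' = K0 \<longleftrightarrow> I' = I0 \<and> P' = I0 \<union> K0"
      if "I0 \<inter> K0 = {}" for I' P' I0 K0 :: "'n set"
      using that by blast
    have "(du I J \<and>\<^sub>e du K L) $ (P, Q) = (\<Sum>I'\<in>Pow P. \<Sum>J'\<in>Pow Q.
        if I' = I then if P = I \<union> K then if J' = J then if Q = J \<union> L then c else 0 else 0 else 0 else 0)"
      unfolding wedge_nth
    proof (intro sum.cong refl, goal_cases)
      case (1 I' J')
      have "du I J $ (I', J') * du K L $ (P - I', Q - J') =
          (if (I' = I \<and> P - I' = K) \<and> (J' = J \<and> Q - J' = L) then 1 else 0)"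
      proof -
        have "(if a \<and> b then 1 else 0) * (if c \<and> d then 1 else 0) =
            (if (a \<and> c) \<and> (b \<and> d) then 1 else (0::real))" for a b c d
          by simp
        then show ?thesis
          by (simp only: du_nth)
      qed
      also have "\<dots> = (if (I' = I \<and> P = I \<union> K) \<and> (J' = J \<and> Q = J \<union> L) then 1 else 0)"
        using 1 by (simp only: *[OF assms(1), of I' P] *[OF assms(2), of J' Q] Pow_iff)
      finally have e: "du I J $ (I', J') * du K L $ (P - I', Q - J') = \<dots>" .
      show ?case
      proof (cases "(I' = I \<and> P = I \<union> K) \<and> (J' = J \<and> Q = J \<union> L)")
        case True
        then have "P - I' = K" "Q - J' = L"
          using assms by blast+
        with True e show ?thesis
          by (simp add: c_def mult.assoc)
      next
        case False
        then have "du I J $ (I', J') * du K L $ (P - I', Q - J') = 0"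
          using e by (simp only: if_False)
        then show ?thesis
          using False by (simp add: mult.assoc) blast
      qed
    qed
    also have "\<dots> = (if P = I \<union> K then if Q = J \<union> L then c else 0 else 0)"
      by (simp add: sum_if)
    finally show ?thesis
      by (simp add: du_nth)
  qed
  then show ?thesis
    by (simp add: vec_eq_iff split_paired_all c_def)
qed

lemma wedge_du_eq_0:
  assumes "I \<inter> K \<noteq> {} \<or> J \<inter> L \<noteq> {}"
  shows "du I J \<and>\<^sub>e du K L = 0"
proof -
  have "du I J $ (I', J') * du K L $ (P - I', Q - J') = 0" for I' J' P Q
  proof -
    have "\<not> (I' = I \<and> J' = J \<and> P - I' = K \<and> Q - J' = L)"
      using assms by blast
    then show ?thesis
      by (simp add: du_nth)
  qed
  then have "(du I J \<and>\<^sub>e du K L) $ (P, Q) = 0" for P Q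
    unfolding wedge_nth mult.assoc by (simp only: mult_zero_right sum.neutral_const)
  then show ?thesis
    by (simp add: vec_eq_iff split_paired_all)
qed

lemma wedge_Jinv_nth:
  assumes "\<alpha> \<in> ext_type M p 0"
  shows "(\<alpha> \<and>\<^sub>e Jinv \<alpha>) $ (I, J) = \<alpha> $ (I, {}) * \<alpha> $ (J, {})"
proof -
  have z: "\<alpha> $ (P, Q) = 0" if "Q \<noteq> {}" for P Q
  proof -
    have "card Q \<noteq> 0"
      using that by simp
    then show ?thesis
      using assms by (auto simp: ext_type_def)
  qed
  have "(\<alpha> \<and>\<^sub>e Jinv \<alpha>) $ (I, J) = (\<Sum>I'\<in>Pow I. \<Sum>J'\<in>Pow J.
      if I' = I then if J' = {} then \<alpha> $ (I, {}) * \<alpha> $ (J, {}) else 0 else 0)"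
    unfolding wedge_nth
  proof (intro sum.cong refl, goal_cases)
    case (1 I' J')
    consider "J' \<noteq> {}" | "I - I' \<noteq> {}" | "J' = {}" "I' = I"
      using 1 by blast
    then show ?case
    proof cases
      case 1
      then show ?thesis
        by (simp add: z)
    next
      case 2
      moreover have "I' \<noteq> I"
        using 2 by blast
      ultimately show ?thesis
        by (simp add: z Jinv_nth)
    next
      case 3
      then show ?thesis
        by (simp add: Jinv_nth)
    qed
  qed
  also have "\<dots> = \<alpha> $ (I, {}) * \<alpha> $ (J, {})"
    by (simp add: sum_if)
  finally show ?thesis .
qed

text \<open>Since \<open>\<infinity> + t = \<infinity>\<close>, \<open>shift i t\<close> preserves every stratum and is the identity on the strata
  with \<open>u\<^sub>i = \<infinity>\<close>. So on \<open>stratum L\<close> the operator \<open>pdiff i\<close> is the partial derivative with respect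
  to \<open>u\<^sub>i\<close> for \<open>i \<notin> L\<close>, and zero for \<open>i \<in> L\<close>.\<close>

definition shift :: "'n \<Rightarrow> real \<Rightarrow> 'n point \<Rightarrow> 'n::finite point" where
  "shift i t u = (\<chi> j. if j = i then u $ j + ereal t else u $ j)"

definition pdiff :: "'n \<Rightarrow> ('n point \<Rightarrow> real) \<Rightarrow> 'n::finite point \<Rightarrow> real" where
  "pdiff i f u = deriv (\<lambda>t. f (shift i t u)) 0"

definition smooth_on_stratum :: "'n::finite point set \<Rightarrow> ('n point \<Rightarrow> real) \<Rightarrow> bool" where
  "smooth_on_stratum W f \<longleftrightarrow> (\<forall>is. continuous_on W (foldr pdiff is f) \<and>
     (\<forall>i. \<forall>u\<in>W. (\<lambda>t. foldr pdiff is f (shift i t u)) differentiable (at 0)))"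

definition mdiff :: "('n \<Rightarrow> nat) \<Rightarrow> ('n point \<Rightarrow> real) \<Rightarrow> 'n::{finite,linorder} point \<Rightarrow> real" where
  "mdiff \<alpha> f = foldr (\<lambda>i. pdiff i ^^ \<alpha> i) (sorted_list_of_set UNIV) f"

text \<open>The strata partition \<open>U\<close>, so a family \<open>(\<omega>\<^sub>\<sigma>)\<^sub>\<sigma>\<close> of forms on the sets \<open>U \<inter> N(\<sigma>)\<close> is encoded as one
  function \<open>\<omega>\<close> on \<open>U\<close>, with \<open>\<omega>\<^sub>\<sigma>\<close> its restriction to \<open>U \<inter> N(\<sigma>)\<close>. Forms are extended by zero outside
  \<open>U\<close>, which makes equality of forms equality of functions, and makes a compactly supported form
  on an open subset of \<open>U\<close> also a form on \<open>U\<close>. In the coordinates used here the pull-back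
  \<open>\<pi>\<^sup>*\<close> is composition with \<^const>\<open>proj\<close>: the coefficients with indices in \<open>L\<close> vanish on \<open>stratum L\<close>.\<close>

type_synonym 'n form = "'n point \<Rightarrow> 'n ext"

text \<open>\<open>\<omega>\<^sub>\<tau> = \<pi>\<^sup>*\<omega>\<^sub>\<sigma>\<close> on \<open>V \<inter> N(\<tau>) \<inter> \<pi>\<^sup>-\<^sup>1(V \<inter> N(\<sigma>))\<close> for all faces \<open>\<tau>\<close> of \<open>\<sigma> = \<sigma>\<^sub>L\<close>.\<close>

definition pullback_on :: "'n::finite point set \<Rightarrow> 'n set \<Rightarrow> 'n form \<Rightarrow> bool" where
  "pullback_on V L \<omega> \<longleftrightarrow>
    (\<forall>L'\<subseteq>L. \<forall>u\<in>V \<inter> stratum L'. proj L u \<in> V \<inter> stratum L \<longrightarrow> \<omega> u = \<omega> (proj L u))"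

definition forms :: "nat \<Rightarrow> nat \<Rightarrow> 'n::{finite,linorder} point set \<Rightarrow> 'n form set" where
  "forms p q U = {\<omega>.
     (\<forall>u. u \<notin> U \<longrightarrow> \<omega> u = 0) \<and>
     (\<forall>L. \<forall>u\<in>U \<inter> stratum L. \<omega> u \<in> ext_type (- L) p q) \<and>
     (\<forall>L I J. smooth_on_stratum (U \<inter> stratum L) (\<lambda>u. \<omega> u $ (I, J))) \<and>
     (\<forall>L. \<forall>x\<in>U \<inter> stratum L. \<exists>V. openin (top_of_set U) V \<and> x \<in> V \<and> pullback_on V L \<omega>)}"

definition supported_in :: "'a set \<Rightarrow> ('a \<Rightarrow> 'b::zero) \<Rightarrow> bool" where
  "supported_in K f \<longleftrightarrow> (\<forall>u. u \<notin> K \<longrightarrow> f u = 0)"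

definition forms_c :: "nat \<Rightarrow> nat \<Rightarrow> 'n::{finite,linorder} point set \<Rightarrow> 'n form set" where
  "forms_c p q U = {\<omega> \<in> forms p q U. \<exists>K. compact K \<and> K \<subseteq> U \<and> supported_in K \<omega>}"

definition positive_form :: "nat \<Rightarrow> 'n::{finite,linorder} point set \<Rightarrow> 'n form \<Rightarrow> bool" where
  "positive_form p U \<omega> \<longleftrightarrow> \<omega> \<in> forms p p U \<and>
     (\<forall>L. \<forall>u\<in>U \<inter> stratum L. \<omega> u \<in> convex_cone hull
        {(-1) ^ (p * (p - 1) div 2) *\<^sub>R (\<alpha> \<and>\<^sub>e Jinv \<alpha>) | \<alpha>. \<alpha> \<in> ext_type (- L) p 0})"

definition absolutely_convex :: "('a \<Rightarrow> 'b::real_vector) set \<Rightarrow> bool" where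
  "absolutely_convex B \<longleftrightarrow> B \<noteq> {} \<and>
     (\<forall>f\<in>B. \<forall>g\<in>B. \<forall>s t. \<bar>s\<bar> + \<bar>t\<bar> \<le> 1 \<longrightarrow> (\<lambda>u. s *\<^sub>R f u + t *\<^sub>R g u) \<in> B)"

text \<open>\<open>E\<close> is the union of subspaces \<open>S\<close>, each topologized by a sequence \<open>\<nu>\<close> of norms, the pairs \<open>(S,\<nu>)\<close>
  forming the set \<open>F\<close>. The finest locally convex topology on \<open>E\<close> with continuous inclusions
  \<open>S \<rightarrow> E\<close> has as a base of neighborhoods of zero the absolutely convex subsets of \<open>E\<close> meeting
  every \<open>S\<close> in a neighborhood of zero.\<close>

definition direct_limit_nhd ::
  "('a \<Rightarrow> 'b::real_vector) set \<Rightarrow> (('a \<Rightarrow> 'b) set \<times> (nat \<Rightarrow> ('a \<Rightarrow> 'b) \<Rightarrow> real)) set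
    \<Rightarrow> ('a \<Rightarrow> 'b) set \<Rightarrow> bool" where
  "direct_limit_nhd E F B \<longleftrightarrow> B \<subseteq> E \<and> absolutely_convex B \<and>
     (\<forall>(S, \<nu>)\<in>F. \<exists>m. \<exists>\<epsilon>>0. {f \<in> S. \<forall>j\<le>m. \<nu> j f < \<epsilon>} \<subseteq> B)"

definition direct_limit_topology ::
  "('a \<Rightarrow> 'b::real_vector) set \<Rightarrow> (('a \<Rightarrow> 'b) set \<times> (nat \<Rightarrow> ('a \<Rightarrow> 'b) \<Rightarrow> real)) set
    \<Rightarrow> ('a \<Rightarrow> 'b) topology" where
  "direct_limit_topology E F = topology (\<lambda>W. W \<subseteq> E \<and>
     (\<forall>f\<in>W. \<exists>B. direct_limit_nhd E F B \<and> (\<forall>g\<in>B. (\<lambda>u. f u + g u) \<in> W)))"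

lemma absolutely_convex_zero:
  assumes "absolutely_convex B"
  shows "(\<lambda>u. 0) \<in> B"
proof -
  obtain f where "f \<in> B"
    using assms unfolding absolutely_convex_def by blast
  then have "(\<lambda>u. 0 *\<^sub>R f u + 0 *\<^sub>R f u) \<in> B"
    using assms unfolding absolutely_convex_def by (metis abs_zero add_0 zero_le_one)
  then show ?thesis
    by simp
qed

lemma absolutely_convex_Int:
  assumes "absolutely_convex B" "absolutely_convex C"
  shows "absolutely_convex (B \<inter> C)"
proof -
  have "B \<inter> C \<noteq> {}"
    using assms[THEN absolutely_convex_zero] by blast
  then show ?thesis
    using assms unfolding absolutely_convex_def by simp
qed

lemma direct_limit_nhd_Int:
  assumes "direct_limit_nhd E F B" "direct_limit_nhd E F C"
  shows "direct_limit_nhd E F (B \<inter> C)"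
  unfolding direct_limit_nhd_def
proof (intro conjI)
  show "B \<inter> C \<subseteq> E"
    using assms unfolding direct_limit_nhd_def by blast
  show "absolutely_convex (B \<inter> C)"
    using assms unfolding direct_limit_nhd_def by (simp add: absolutely_convex_Int)
  have "\<exists>m. \<exists>\<epsilon>>0. {f \<in> S. \<forall>j\<le>m. \<nu> j f < \<epsilon>} \<subseteq> B \<inter> C" if S: "(S, \<nu>) \<in> F" for S \<nu>
  proof -
    obtain m \<epsilon> where B: "\<epsilon> > 0" "{f \<in> S. \<forall>j\<le>m. \<nu> j f < \<epsilon>} \<subseteq> B"
      using assms(1) S unfolding direct_limit_nhd_def by blast
    obtain m' \<epsilon>' where C: "\<epsilon>' > 0" "{f \<in> S. \<forall>j\<le>m'. \<nu> j f < \<epsilon>'} \<subseteq> C"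
      using assms(2) S unfolding direct_limit_nhd_def by blast
    have "{f \<in> S. \<forall>j\<le>max m m'. \<nu> j f < min \<epsilon> \<epsilon>'} \<subseteq> B \<inter> C"
    proof
      fix f
      assume f: "f \<in> {f \<in> S. \<forall>j\<le>max m m'. \<nu> j f < min \<epsilon> \<epsilon>'}"
      have "f \<in> {f \<in> S. \<forall>j\<le>m. \<nu> j f < \<epsilon>}" "f \<in> {f \<in> S. \<forall>j\<le>m'. \<nu> j f < \<epsilon>'}"
        using f by simp_all
      then show "f \<in> B \<inter> C"
        using B(2) C(2) by blast
    qed
    moreover have "min \<epsilon> \<epsilon>' > 0"
      using B(1) C(1) by simp
    ultimately show ?thesis
      by blast
  qed
  then show "\<forall>(S, \<nu>)\<in>F. \<exists>m. \<exists>\<epsilon>>0. {f \<in> S. \<forall>j\<le>m. \<nu> j f < \<epsilon>} \<subseteq> B \<inter> C"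
    by blast
qed

lemma openin_direct_limit_topology:
  "openin (direct_limit_topology E F) W \<longleftrightarrow> W \<subseteq> E \<and>
     (\<forall>f\<in>W. \<exists>B. direct_limit_nhd E F B \<and> (\<forall>g\<in>B. (\<lambda>u. f u + g u) \<in> W))"
proof -
  define N where "N f W \<longleftrightarrow> (\<exists>B. direct_limit_nhd E F B \<and> (\<forall>g\<in>B. (\<lambda>u. f u + g u) \<in> W))"
    for f W
  have Int: "N f (V \<inter> W)" if VW: "N f V" "N f W" for f V W
  proof -
    obtain B where B: "direct_limit_nhd E F B" "\<forall>g\<in>B. (\<lambda>u. f u + g u) \<in> V"
      using VW(1) unfolding N_def by blast
    obtain C where C: "direct_limit_nhd E F C" "\<forall>g\<in>C. (\<lambda>u. f u + g u) \<in> W"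
      using VW(2) unfolding N_def by blast
    have "direct_limit_nhd E F (B \<inter> C) \<and> (\<forall>g\<in>B \<inter> C. (\<lambda>u. f u + g u) \<in> V \<inter> W)"
      using direct_limit_nhd_Int[OF B(1) C(1)] B(2) C(2) by simp
    then show ?thesis
      unfolding N_def by (rule exI)
  qed
  have mono: "N f W" if "N f V" "V \<subseteq> W" for f V W
    using that(1) subsetD[OF that(2)] unfolding N_def by blast
  have "istopology (\<lambda>W. W \<subseteq> E \<and> (\<forall>f\<in>W. N f W))"
    unfolding istopology_def
  proof (intro conjI allI impI)
    fix V W
    assume V: "V \<subseteq> E \<and> (\<forall>f\<in>V. N f V)" and W: "W \<subseteq> E \<and> (\<forall>f\<in>W. N f W)"
    show "V \<inter> W \<subseteq> E"
      using V by auto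
    show "\<forall>f\<in>V \<inter> W. N f (V \<inter> W)"
      using V W Int by simp
  next
    fix \<W>
    assume W: "\<forall>W\<in>\<W>. W \<subseteq> E \<and> (\<forall>f\<in>W. N f W)"
    show "\<Union>\<W> \<subseteq> E"
      using W by auto
    show "\<forall>f\<in>\<Union>\<W>. N f (\<Union>\<W>)"
      using W mono by (metis Union_iff Union_upper)
  qed
  then show ?thesis
    unfolding direct_limit_topology_def N_def by (rule topology_inverse'[THEN fun_cong])
qed

definition linear_on :: "('a \<Rightarrow> 'b::real_vector) set \<Rightarrow> (('a \<Rightarrow> 'b) \<Rightarrow> real) \<Rightarrow> bool" where
  "linear_on E T \<longleftrightarrow> (\<forall>f\<in>E. \<forall>g\<in>E. T (\<lambda>u. f u + g u) = T f + T g) \<and>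
     (\<forall>c. \<forall>f\<in>E. T (\<lambda>u. c *\<^sub>R f u) = c * T f)"

definition sup_on :: "'a set \<Rightarrow> ('a \<Rightarrow> real) \<Rightarrow> real" where
  "sup_on K f = (if K = {} then 0 else SUP u\<in>K. \<bar>f u\<bar>)"

text \<open>A finite covering enters only through the set \<open>\<V>\<close> of its members.\<close>

definition finite_open_cover ::
  "'n::finite point set \<Rightarrow> 'n point set \<Rightarrow> 'n point set set \<Rightarrow> bool" where
  "finite_open_cover U K \<V> \<longleftrightarrow> finite \<V> \<and> (\<forall>V\<in>\<V>. openin (top_of_set U) V) \<and> K \<subseteq> \<Union>\<V>"

definition forms_K :: "nat \<Rightarrow> nat \<Rightarrow> 'n::{finite,linorder} point set
    \<Rightarrow> 'n point set \<Rightarrow> 'n point set set \<Rightarrow> 'n form set" where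
  "forms_K p q U K \<V> = {\<omega> \<in> forms_c p q U. supported_in K \<omega> \<and>
     (\<forall>V\<in>\<V>. \<forall>L. V \<inter> stratum L \<noteq> {} \<longrightarrow> pullback_on V L \<omega>)}"

text \<open>The sum over all \<open>I, J\<close> only has contributions from the \<open>I, J\<close> belonging to the type of \<open>\<omega>\<close>.\<close>

definition form_norm :: "'n::{finite,linorder} point set \<Rightarrow> nat \<Rightarrow> 'n form \<Rightarrow> real" where
  "form_norm K m \<omega> = (\<Sum>\<alpha> | (\<Sum>i\<in>UNIV. \<alpha> i) \<le> m. \<Sum>I\<in>UNIV. \<Sum>J\<in>UNIV.
     sup_on K (mdiff \<alpha> (\<lambda>u. \<omega> u $ (I, J))))"

definition forms_topology ::
  "nat \<Rightarrow> nat \<Rightarrow> 'n::{finite,linorder} point set \<Rightarrow> 'n form topology" where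
  "forms_topology p q U = direct_limit_topology (forms_c p q U)
     {(forms_K p q U K \<V>, form_norm K) | K \<V>. compact K \<and> K \<subseteq> U \<and> finite_open_cover U K \<V>}"

text \<open>Functionals are set to zero outside their domain, so that equality of currents is equality of
  functions.\<close>

definition currents ::
  "nat \<Rightarrow> nat \<Rightarrow> 'n::{finite,linorder} point set \<Rightarrow> ('n form \<Rightarrow> real) set" where
  "currents p q U = (let a = CARD('n) - p; b = CARD('n) - q in {T.
     (\<forall>\<omega>. \<omega> \<notin> forms_c a b U \<longrightarrow> T \<omega> = 0) \<and> linear_on (forms_c a b U) T \<and>
     continuous_map (forms_topology a b U) euclideanreal T})"

definition positive_current ::
  "nat \<Rightarrow> 'n::{finite,linorder} point set \<Rightarrow> ('n form \<Rightarrow> real) \<Rightarrow> bool" where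
  "positive_current p U T \<longleftrightarrow> (let q = CARD('n) - p in
     (\<forall>\<omega>\<in>forms_c q q U. T (\<lambda>u. Jinv (\<omega> u)) = (-1) ^ q * T \<omega>) \<and>
     (\<forall>\<alpha>\<in>forms_c q q U. positive_form q U \<alpha> \<longrightarrow> 0 \<le> T \<alpha>))"

text \<open>A function \<open>f\<close> is identified with the form \<open>\<lambda>u. f u *\<^sub>R du {} {}\<close> of type \<open>(0,0)\<close>.\<close>

definition cocoeff :: "'n::{finite,linorder} point set \<Rightarrow> ('n form \<Rightarrow> real) \<Rightarrow> 'n set \<Rightarrow> 'n set
    \<Rightarrow> 'n form \<Rightarrow> real" where
  "cocoeff U T I J f = (if f \<in> forms_c 0 0 (U - E_infty (I \<union> J))
     then T (\<lambda>u. ((-1) ^ (card I * (card I - 1) div 2) * f u $ ({}, {})) *\<^sub>R du I J) else 0)"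

definition Cc :: "'a::topological_space set \<Rightarrow> ('a \<Rightarrow> real) set" where
  "Cc X = {f. continuous_on X f \<and> (\<exists>K. compact K \<and> K \<subseteq> X \<and> supported_in K f)}"

definition Cc_topology :: "'a::topological_space set \<Rightarrow> ('a \<Rightarrow> real) topology" where
  "Cc_topology X = direct_limit_topology (Cc X)
     {({f \<in> Cc X. supported_in K f}, \<lambda>_. sup_on K) | K. compact K \<and> K \<subseteq> X}"

definition real_radon_measure :: "'a::topological_space set \<Rightarrow> (('a \<Rightarrow> real) \<Rightarrow> real) \<Rightarrow> bool" where
  "real_radon_measure X \<mu> \<longleftrightarrow>
     linear_on (Cc X) \<mu> \<and> continuous_map (Cc_topology X) euclideanreal \<mu>"

text \<open>The total variation measure, given on open sets by the supremum over test functions with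
  values in \<open>[-1,1]\<close> and extended to all sets by outer regularity.\<close>

definition total_variation ::
  "'a::topological_space set \<Rightarrow> (('a \<Rightarrow> real) \<Rightarrow> real) \<Rightarrow> 'a set \<Rightarrow> ennreal" where
  "total_variation X \<mu> A = (INF V\<in>{V. openin (top_of_set X) V \<and> A \<subseteq> V}.
     SUP f\<in>{f \<in> Cc V. \<forall>u. \<bar>f u\<bar> \<le> 1}. ennreal \<bar>\<mu> f\<bar>)"

definition radon_null_set ::
  "'a::topological_space set \<Rightarrow> (('a \<Rightarrow> real) \<Rightarrow> real) \<Rightarrow> 'a set \<Rightarrow> bool" where
  "radon_null_set X \<mu> A \<longleftrightarrow> A \<subseteq> X \<and> total_variation X \<mu> A = 0"

definition radon_extension :: "'n::{finite,linorder} point set \<Rightarrow> ('n form \<Rightarrow> real)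
    \<Rightarrow> (('n point \<Rightarrow> real) \<Rightarrow> real) \<Rightarrow> bool" where
  "radon_extension X S \<mu> \<longleftrightarrow> real_radon_measure X \<mu> \<and>
     (\<forall>f\<in>forms_c 0 0 X. \<mu> (\<lambda>u. f u $ ({}, {})) = S f)"

definition has_radon_cocoeffs ::
  "nat \<Rightarrow> 'n::{finite,linorder} point set \<Rightarrow> ('n form \<Rightarrow> real) \<Rightarrow> bool" where
  "has_radon_cocoeffs p U T \<longleftrightarrow> (\<forall>I J. card I = CARD('n) - p \<longrightarrow> card J = CARD('n) - p \<longrightarrow>
     (\<exists>\<mu>. radon_extension (U - E_infty (I \<union> J)) (cocoeff U T I J) \<mu>))"

end

theory Submission
  imports Defs
begin

text \<open>A Lagerberg form is, near a point \<open>x\<close> of \<open>N(\<sigma>\<^sub>L)\<close>, the pull-back of a form on \<open>N(\<sigma>\<^sub>L)\<close>, where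
  \<open>d'u\<^sub>i\<close> and \<open>d''u\<^sub>i\<close> vanish for \<open>i \<in> L\<close>. Hence its coefficient at \<open>d'u\<^sub>I \<and> d''u\<^sub>J\<close> vanishes near
  \<open>E\<^bsup>I \<union> J\<^esup>\<close>, and a compactly supported form is the same as a family of compactly supported smooth
  functions \<open>f\<^bsub>IJ\<^esub>\<close> on the sets \<open>X\<^bsub>IJ\<^esub> = U - E\<^bsup>I \<union> J\<^esup>\<close> (\<open>forms_c_iff\<close>). A current is thus the same as
  the family of its co-coefficients (\<open>assemble_cocoeff_fun\<close>, \<open>assemble_current\<close>), and these can be
  decomposed one by one.

  Testing \<open>T\<close> on the positive forms \<open>f \<cdot> (d'u\<^sub>I \<plusminus> d'u\<^sub>J) \<and> (d''u\<^sub>I \<plusminus> d''u\<^sub>J)\<close>, up to sign, shows that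
  \<open>\<bar>T\<^bsup>IJ\<^esup>(f)\<bar> \<le> (T\<^bsup>II\<^esup>(h) + T\<^bsup>JJ\<^esup>(h)) / 2\<close> whenever \<open>\<bar>f\<bar> \<le> h\<close> (\<open>positive_current_dominated\<close>).
  Such a functional, dominated by a positive one, can be restricted to a stratum by a limit, without
  representing it by a measure. For \<open>k \<rightarrow> \<infinity>\<close> the smooth functions \<open>cutoff k L\<close>
  converge to the indicator functions of the strata, while for each \<open>k\<close> their sum over \<open>L\<close> is \<open>1\<close>. Each is a
  difference of two functions that decrease in \<open>k\<close>; a positive functional converges along
  a decreasing sequence, and a dominated functional inherits this (\<open>convergent_decreasing\<close>). The limits
  of \<open>T\<^bsup>IJ\<^esup>(cutoff k L \<cdot> f)\<close> are the co-coefficients of \<open>T\<^sub>L\<close>, and \<open>\<Sum> T\<^sub>L = T\<close> holds because it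
  holds before passing to the limit.

  The restricted functionals are again dominated. Since smooth functions are dense in the continuous ones by the
  theorem of Stone and Weierstrass, they extend to Radon measures
  (\<open>real_radon_measure_extension\<close>), and these are concentrated on the stratum (\<open>null_set_restrict\<close>).

  Conversely, if a Radon measure \<open>\<mu>\<close> is concentrated on the stratum of \<open>L\<close>, then
  \<open>\<mu>(cutoff k L' \<cdot> f)\<close> tends to \<open>\<mu>(f)\<close> for \<open>L' = L\<close> and to \<open>0\<close> otherwise. So in every decomposition
  the co-coefficients of \<open>T\<^sub>L\<close> are the limits above (\<open>cocoeff_fun_eq_limit\<close>), which is
  uniqueness.\<close>

section \<open>Finite powers of a topological space\<close>

instance vec :: (t0_space, finite) t0_space
proof
  fix x y :: "('a, 'b) vec"
  assume "x \<noteq> y"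
  then obtain i where "x $ i \<noteq> y $ i"
    by (auto simp: vec_eq_iff)
  then obtain A where "open A" "\<not> (x $ i \<in> A \<longleftrightarrow> y $ i \<in> A)"
    using t0_space_class.t0_space[OF \<open>x $ i \<noteq> y $ i\<close>] by blast
  then show "\<exists>A. open A \<and> \<not> (x \<in> A \<longleftrightarrow> y \<in> A)"
    by (intro exI[of _ "(\<lambda>u. u $ i) -` A"]) (simp add: open_vimage_vec_nth)
qed

instance vec :: (t1_space, finite) t1_space
proof
  fix x y :: "('a, 'b) vec"
  assume "x \<noteq> y"
  then obtain i where "x $ i \<noteq> y $ i"
    by (auto simp: vec_eq_iff)
  then obtain A where "open A" "x $ i \<in> A" "y $ i \<notin> A"
    using t1_space_class.t1_space[OF \<open>x $ i \<noteq> y $ i\<close>] by blast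
  then show "\<exists>A. open A \<and> x \<in> A \<and> y \<notin> A"
    by (intro exI[of _ "(\<lambda>u. u $ i) -` A"]) (simp add: open_vimage_vec_nth)
qed

instance vec :: (t2_space, finite) t2_space
proof
  fix x y :: "('a, 'b) vec"
  assume "x \<noteq> y"
  then obtain i where "x $ i \<noteq> y $ i"
    by (auto simp: vec_eq_iff)
  then obtain A B where AB: "open A" "open B" "x $ i \<in> A" "y $ i \<in> B" "A \<inter> B = {}"
    using hausdorff[OF \<open>x $ i \<noteq> y $ i\<close>] by blast
  have "open ((\<lambda>u. u $ i) -` A)" "open ((\<lambda>u. u $ i) -` B)"
    using AB by (simp_all add: open_vimage_vec_nth)
  then show "\<exists>A B. open A \<and> open B \<and> x \<in> A \<and> y \<in> B \<and> A \<inter> B = {}"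
    using AB by (intro exI[of _ "(\<lambda>u. u $ i) -` A"] exI[of _ "(\<lambda>u. u $ i) -` B"]) auto
qed

lemma open_vec_box:
  fixes A :: "'n::finite \<Rightarrow> 'a::topological_space set"
  assumes "\<And>i. open (A i)"
  shows "open {u :: 'a ^ 'n. \<forall>i. u $ i \<in> A i}"
proof -
  have "{u :: 'a ^ 'n. \<forall>i. u $ i \<in> A i} = (\<Inter>i\<in>UNIV. (\<lambda>u. u $ i) -` A i)"
    by auto
  then show ?thesis
    using assms by (auto intro!: open_INT open_vimage_vec_nth)
qed

text \<open>The countably many boxes built from a countable base, restricted to those contained in some member
  of the cover, already cover \<open>X\<close>. This makes \<open>\<sigma>\<close>-compactness arguments available for open subsets
  of \<^const>\<open>NSigma\<close>.\<close>

lemma vec_Lindelof: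
  fixes X :: "('a::second_countable_topology ^ 'n::finite) set"
  assumes "\<And>x. x \<in> X \<Longrightarrow> open (W x) \<and> x \<in> W x"
  shows "\<exists>D\<subseteq>X. countable D \<and> X \<subseteq> (\<Union>x\<in>D. W x)"
proof -
  obtain B :: "'a set set" where B: "countable B" "topological_basis B"
    using ex_countable_basis by auto
  define box where "box b = {u :: 'a ^ 'n. \<forall>i. u $ i \<in> b i}" for b
  define C where "C = {b \<in> PiE UNIV (\<lambda>_. B). \<exists>x\<in>X. box b \<subseteq> W x}"
  have "countable (PiE (UNIV :: 'n set) (\<lambda>_. B))"
    using B(1) by (intro countable_PiE) auto
  then have C: "countable C"
    unfolding C_def by (rule countable_subset[rotated]) auto
  have "\<forall>b\<in>C. \<exists>x. x \<in> X \<and> box b \<subseteq> W x"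
    unfolding C_def by auto
  from bchoice[OF this] obtain c where c: "\<And>b. b \<in> C \<Longrightarrow> c b \<in> X \<and> box b \<subseteq> W (c b)"
    by blast
  have "x \<in> (\<Union>x\<in>c ` C. W x)" if x: "x \<in> X" for x
  proof -
    obtain A where A: "\<And>i. open (A i) \<and> x $ i \<in> A i" "\<And>y. (\<And>i. y $ i \<in> A i) \<Longrightarrow> y \<in> W x"
      using assms[OF x] unfolding open_vec_def by metis
    have "\<exists>b\<in>B. x $ i \<in> b \<and> b \<subseteq> A i" for i
      using topological_basisE[OF B(2), of "A i" "x $ i"] A(1) by metis
    then obtain b where b: "\<And>i. b i \<in> B \<and> x $ i \<in> b i \<and> b i \<subseteq> A i"
      by metis
    have "x \<in> box b" "box b \<subseteq> W x"
      using b A(2) unfolding box_def by blast+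
    moreover from this have "b \<in> C"
      using b x unfolding C_def by auto
    ultimately show ?thesis
      using c by blast
  qed
  then show ?thesis
    using c C by (intro exI[of _ "c ` C"]) (auto intro: countable_image)
qed

text \<open>Tychonoff's theorem, carried over from functions to vectors.\<close>

lemma compact_vec_box:
  fixes C :: "'n::finite \<Rightarrow> 'a::topological_space set"
  assumes "\<And>i. compact (C i)"
  shows "compact {u :: 'a ^ 'n. \<forall>i. u $ i \<in> C i}"
proof -
  have "compactin (product_topology (\<lambda>_. euclidean) UNIV) (PiE UNIV C)"
    using assms by (subst compactin_PiE) auto
  then have "compact (PiE UNIV C)"
    by (simp add: euclidean_product_topology)
  moreover have "continuous_on (PiE UNIV C) (\<lambda>f. \<chi> i. f i)"
    unfolding continuous_on_def
    by (intro ballI tendsto_vec_lambda)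
      (metis continuous_on_def continuous_on_product_coordinates continuous_on_subset subset_UNIV)
  ultimately have "compact ((\<lambda>f. \<chi> i. f i) ` (PiE UNIV C))"
    by (rule compact_continuous_image[rotated])
  moreover have "(\<lambda>f. \<chi> i. f i) ` (PiE UNIV C) = {u. \<forall>i. u $ i \<in> C i}"
  proof (intro subset_antisym subsetI)
    fix u assume "u \<in> {u. \<forall>i. u $ i \<in> C i}"
    then have "(\<lambda>i. u $ i) \<in> PiE UNIV C" "u = (\<chi> i. u $ i)"
      by auto
    then show "u \<in> (\<lambda>f. \<chi> i. f i) ` (PiE UNIV C)"
      by blast
  qed auto
  ultimately show ?thesis
    by simp
qed

section \<open>A smooth step function\<close>

primrec times_differentiable :: "nat \<Rightarrow> (real \<Rightarrow> real) \<Rightarrow> bool" where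
  "times_differentiable 0 f = True"
| "times_differentiable (Suc n) f =
     (\<exists>f'. (\<forall>x. (f has_real_derivative f' x) (at x)) \<and> times_differentiable n f')"

lemma times_differentiable_SucD: "times_differentiable (Suc n) f \<Longrightarrow> times_differentiable n f"
  by (induction n arbitrary: f) auto

lemma times_differentiable_SucI:
  "(\<And>x. (f has_real_derivative f' x) (at x)) \<Longrightarrow> times_differentiable n f' \<Longrightarrow>
    times_differentiable (Suc n) f"
  by auto

lemma times_differentiable_const: "times_differentiable n (\<lambda>x. c)"
proof (induction n arbitrary: c)
  case (Suc n)
  show ?case
    by (rule times_differentiable_SucI[of _ "\<lambda>x. 0"]) (auto intro: Suc)
qed simp

lemma times_differentiable_add:
  "times_differentiable n f \<Longrightarrow> times_differentiable n g \<Longrightarrow> times_differentiable n (\<lambda>x. f x + g x)"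
proof (induction n arbitrary: f g)
  case (Suc n)
  then obtain f' g' where *: "\<And>x. (f has_real_derivative f' x) (at x)" "times_differentiable n f'"
    "\<And>x. (g has_real_derivative g' x) (at x)" "times_differentiable n g'"
    by auto
  show ?case
    by (rule times_differentiable_SucI[of _ "\<lambda>x. f' x + g' x"])
      (auto intro: Suc.IH * derivative_intros)
qed simp

lemma times_differentiable_mult:
  "times_differentiable n f \<Longrightarrow> times_differentiable n g \<Longrightarrow> times_differentiable n (\<lambda>x. f x * g x)"
proof (induction n arbitrary: f g)
  case (Suc n)
  then obtain f' g' where *: "\<And>x. (f has_real_derivative f' x) (at x)" "times_differentiable n f'"
    "\<And>x. (g has_real_derivative g' x) (at x)" "times_differentiable n g'"
    by auto
  note Suc.prems[THEN times_differentiable_SucD]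
  then show ?case
    by (intro times_differentiable_SucI[of _ "\<lambda>x. f' x * g x + g' x * f x"])
      (auto intro!: Suc.IH times_differentiable_add * DERIV_mult)
qed simp

lemma times_differentiable_inverse:
  "times_differentiable n f \<Longrightarrow> (\<And>x. f x \<noteq> 0) \<Longrightarrow> times_differentiable n (\<lambda>x. inverse (f x))"
proof (induction n)
  case (Suc n)
  then obtain f' where *: "\<And>x. (f has_real_derivative f' x) (at x)" "times_differentiable n f'"
    by auto
  have "times_differentiable n (\<lambda>x. inverse (f x))"
    using Suc by (intro Suc.IH times_differentiable_SucD[of n f])
  then have "times_differentiable n (\<lambda>x. (-1) * (inverse (f x) * (f' x * inverse (f x))))"
    using * by (intro times_differentiable_mult times_differentiable_const)
  moreover have "((\<lambda>x. inverse (f x)) has_real_derivative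
      (-1) * (inverse (f x) * (f' x * inverse (f x)))) (at x)" for x
    using DERIV_inverse'[OF *(1) Suc.prems(2)] by (simp add: mult.assoc)
  ultimately show ?case
    by (intro times_differentiable_SucI)
qed simp

lemma times_differentiable_affine:
  "times_differentiable n f \<Longrightarrow> times_differentiable n (\<lambda>x. f (a * x + b))"
proof (induction n arbitrary: f)
  case (Suc n)
  then obtain f' where *: "\<And>x. (f has_real_derivative f' x) (at x)" "times_differentiable n f'"
    by auto
  have "((\<lambda>x. f (a * x + b)) has_real_derivative a * f' (a * x + b)) (at x)" for x
  proof -
    have "((\<lambda>x. a * x + b) has_real_derivative a) (at x)"
      by (auto intro!: derivative_eq_intros)
    from DERIV_chain2[where f = f, OF *(1) this] show ?thesis
      by (simp add: mult.commute)
  qed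
  then show ?case
    by (rule times_differentiable_SucI)
      (intro times_differentiable_mult times_differentiable_const Suc.IH *)
qed simp

text \<open>For \<open>k = 0\<close> this is the classical smooth function that vanishes to infinite order at \<open>0\<close>; the
  further members are there because the family is closed under derivatives up to linear combinations.\<close>

definition flat_exp :: "nat \<Rightarrow> real \<Rightarrow> real" where
  "flat_exp k x = (if x \<le> 0 then 0 else exp (- 1 / x) / x ^ k)"

lemma tendsto_flat_exp: "(flat_exp k \<longlongrightarrow> 0) (at 0)"
proof -
  have "filterlim (\<lambda>x::real. inverse x) at_top (at_right 0)"
    by (rule filterlim_inverse_at_top_right)
  from filterlim_compose[OF tendsto_power_div_exp_0[of k] this]
  have "((\<lambda>x::real. inverse x ^ k / exp (inverse x)) \<longlongrightarrow> 0) (at_right 0)" .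
  moreover have "\<forall>\<^sub>F x in at_right 0. inverse x ^ k / exp (inverse x) = flat_exp k x"
    by (rule eventually_mono[OF eventually_at_right_less])
       (auto simp: flat_exp_def exp_minus field_simps)
  ultimately have "(flat_exp k \<longlongrightarrow> 0) (at_right 0)"
    by (blast intro: Lim_transform_eventually)
  moreover have "(flat_exp k \<longlongrightarrow> 0) (at_left 0)"
    by (rule Lim_transform_eventually[OF tendsto_const])
       (auto simp: flat_exp_def eventually_at_filter)
  ultimately show ?thesis
    by (simp add: filterlim_split_at)
qed

text \<open>At \<open>0\<close> the difference quotient of \<open>flat_exp k\<close> is \<open>flat_exp (k + 1)\<close>, which tends to \<open>0\<close>.\<close>

lemma flat_exp_deriv:
  "(flat_exp k has_real_derivative flat_exp (k + 2) x + - real k * flat_exp (k + 1) x) (at x)"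
proof -
  consider "x < 0" | "x = 0" | "x > 0" by linarith
  then show ?thesis
  proof cases
    case 1
    have "\<forall>\<^sub>F y in nhds x. flat_exp k y = 0"
      using 1 by (intro eventually_nhds[THEN iffD2] exI[of _ "{..<0}"]) (auto simp: flat_exp_def)
    then have "(flat_exp k has_real_derivative 0) (at x)"
      by (subst DERIV_cong_ev[OF refl _ refl]) auto
    then show ?thesis
      using 1 by (simp add: flat_exp_def)
  next
    case 2
    have "(\<lambda>y. (flat_exp k y - flat_exp k 0) / (y - 0)) = flat_exp (k + 1)"
      by (auto simp: flat_exp_def fun_eq_iff)
    then have "(flat_exp k has_real_derivative 0) (at 0)"
      using tendsto_flat_exp[of "k + 1"] by (simp add: has_field_derivative_iff)
    then show ?thesis
      using 2 by (simp add: flat_exp_def)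
  next
    case 3
    have "((\<lambda>y. - 1 / y) has_real_derivative 1 / x ^ 2) (at x)"
      using 3 by (auto intro!: derivative_eq_intros simp: power2_eq_square)
    then have E: "((\<lambda>y. exp (- 1 / y)) has_real_derivative exp (- 1 / x) * (1 / x ^ 2)) (at x)"
      by (rule DERIV_fun_exp)
    have "((\<lambda>y. exp (- 1 / y) / y ^ k) has_real_derivative
        (exp (- 1 / x) * (1 / x ^ 2) * x ^ k - exp (- 1 / x) * (real k * x ^ (k - 1)))
          / (x ^ k * x ^ k)) (at x)"
      using 3 E DERIV_pow[of k x UNIV] by (intro DERIV_divide) simp_all
    also have "(exp (- 1 / x) * (1 / x ^ 2) * x ^ k - exp (- 1 / x) * (real k * x ^ (k - 1)))
          / (x ^ k * x ^ k) =
        exp (- 1 / x) / x ^ (k + 2) + - real k * (exp (- 1 / x) / x ^ (k + 1))"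
    proof (cases k)
      case 0
      then show ?thesis by (simp add: power2_eq_square)
    next
      case (Suc m)
      have "(e * (1 / x ^ 2) * (x * a) - e * (r * a)) / ((x * a) * (x * a)) =
          e / (x * (x * (x * a))) + - r * (e / (x * (x * a)))" if "a \<noteq> 0" for e r a :: real
        using that 3 by (simp add: diff_divide_distrib power2_eq_square mult_ac)
      from this[of "x ^ m" "exp (- 1 / x)" "real (Suc m)"] show ?thesis
        using 3 unfolding Suc by (simp only: power_Suc add_2_eq_Suc' add_Suc_right add_0_right
            power_not_zero diff_Suc_Suc diff_zero One_nat_def less_imp_neq[symmetric] not_False_eq_True)
    qed
    finally have "((\<lambda>y. exp (- 1 / y) / y ^ k) has_real_derivative
        exp (- 1 / x) / x ^ (k + 2) + - real k * (exp (- 1 / x) / x ^ (k + 1))) (at x)" .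
    moreover have "\<forall>\<^sub>F y in nhds x. flat_exp k y = exp (- 1 / y) / y ^ k"
      using 3 by (intro eventually_nhds[THEN iffD2] exI[of _ "{0<..}"]) (auto simp: flat_exp_def)
    ultimately have "(flat_exp k has_real_derivative
        exp (- 1 / x) / x ^ (k + 2) + - real k * (exp (- 1 / x) / x ^ (k + 1))) (at x)"
      by (subst DERIV_cong_ev[OF refl _ refl]) auto
    then show ?thesis
      using 3 by (simp add: flat_exp_def)
  qed
qed

lemma times_differentiable_flat_exp: "times_differentiable n (flat_exp k)"
proof (induction n arbitrary: k)
  case (Suc n)
  show ?case
    by (rule times_differentiable_SucI[OF flat_exp_deriv])
       (intro times_differentiable_add times_differentiable_mult times_differentiable_const Suc)
qed simp

text \<open>The denominator is positive since \<open>x\<close> and \<open>1 - x\<close> cannot both be nonpositive. The second argument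
  has the form \<open>a * x + b\<close> of \<open>times_differentiable_affine\<close>.\<close>

definition step :: "real \<Rightarrow> real" where
  "step x = flat_exp 0 x * inverse (flat_exp 0 x + flat_exp 0 ((-1) * x + 1))"

lemma step_eq_0: "x \<le> 0 \<Longrightarrow> step x = 0"
  by (simp add: step_def flat_exp_def)

lemma step_eq_1: "x \<ge> 1 \<Longrightarrow> step x = 1"
  by (simp add: step_def flat_exp_def)

lemma flat_exp_nonneg: "0 \<le> flat_exp k x"
  by (simp add: flat_exp_def)

lemma step_bounds: "0 \<le> step x" "step x \<le> 1"
  using flat_exp_nonneg[of 0 x] flat_exp_nonneg[of 0 "(-1) * x + 1"]
  by (simp_all add: step_def divide_simps flip: divide_inverse)

lemma times_differentiable_step: "times_differentiable n step"
proof -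
  have "0 < flat_exp 0 x + flat_exp 0 ((-1) * x + 1)" for x
    by (cases "x \<le> 0") (auto simp: flat_exp_def add_pos_nonneg)
  then have "flat_exp 0 x + flat_exp 0 ((-1) * x + 1) \<noteq> 0" for x
    by (metis less_irrefl)
  then show ?thesis
    unfolding step_def
    by (intro times_differentiable_mult times_differentiable_inverse times_differentiable_add
      times_differentiable_affine times_differentiable_flat_exp)
qed

definition smooth_real :: "(real \<Rightarrow> real) \<Rightarrow> bool" where
  "smooth_real f \<longleftrightarrow> (\<forall>n. times_differentiable n f)"

lemma smooth_real_deriv:
  assumes "smooth_real f"
  shows "(f has_real_derivative deriv f x) (at x)" "smooth_real (deriv f)"
proof -
  have "\<exists>f'. (\<forall>x. (f has_real_derivative f' x) (at x)) \<and> times_differentiable n f'" for n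
    using assms unfolding smooth_real_def by (metis times_differentiable.simps(2))
  then have "(\<forall>x. (f has_real_derivative deriv f x) (at x)) \<and> times_differentiable n (deriv f)" for n
    by (metis DERIV_imp_deriv ext)
  then show "(f has_real_derivative deriv f x) (at x)" "smooth_real (deriv f)"
    by (auto simp: smooth_real_def)
qed

lemma smooth_real_step: "smooth_real (\<lambda>x. step (a * x + b))"
  by (simp add: smooth_real_def times_differentiable_affine times_differentiable_step)

lemma smooth_real_mult: "smooth_real f \<Longrightarrow> smooth_real g \<Longrightarrow> smooth_real (\<lambda>x. f x * g x)"
  by (simp add: smooth_real_def times_differentiable_mult)

section \<open>Smooth functions on the strata\<close>

lemma shift_nth: "shift i t u $ j = (if j = i then u $ j + ereal t else u $ j)"
  by (simp add: shift_def)

lemma proj_nth: "proj L u $ i = (if i \<in> L then \<infinity> else u $ i)"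
  by (simp add: proj_def)

lemma shift_0 [simp]: "shift i 0 u = u"
  by (simp add: vec_eq_iff shift_nth flip: zero_ereal_def)

lemma stratum_nth: "u \<in> stratum L \<Longrightarrow> i \<in> L \<Longrightarrow> u $ i = \<infinity>"
  "u \<in> stratum L \<Longrightarrow> i \<notin> L \<Longrightarrow> u $ i \<noteq> \<infinity>" "u \<in> stratum L \<Longrightarrow> u $ i \<noteq> -\<infinity>"
  by (auto simp: stratum_def NSigma_def)

lemma shift_in_stratum: "u \<in> stratum L \<Longrightarrow> shift i t u \<in> stratum L"
  by (auto simp: stratum_def NSigma_def shift_nth)

lemma stratum_cover: "u \<in> NSigma \<Longrightarrow> u \<in> stratum {i. u $ i = \<infinity>}"
  by (simp add: stratum_def)

lemma tendsto_shift: "((\<lambda>t. shift i t u) \<longlongrightarrow> u) (nhds 0)"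
proof -
  have "((\<lambda>t. u $ j + ereal t) \<longlongrightarrow> u $ j) (nhds 0)" for j
  proof (cases "u $ j")
    case (real r)
    have "((\<lambda>t. ereal (r + t)) \<longlongrightarrow> ereal (r + 0)) (nhds 0)"
      by (intro tendsto_intros filterlim_ident)
    then show ?thesis
      using real by simp
  qed auto
  then have "((\<lambda>t. \<chi> j. shift i t u $ j) \<longlongrightarrow> (\<chi> j. u $ j)) (nhds 0)"
    by (intro tendsto_vec_lambda) (case_tac "j = i", simp_all add: shift_nth)
  then show ?thesis
    by simp
qed

text \<open>Derivatives along the shifts depend only on the values in such a set, so these are the sets on
  which partial derivatives can be computed locally.\<close>

definition shift_open :: "'n::finite point set \<Rightarrow> bool" where
  "shift_open W \<longleftrightarrow> (\<forall>u\<in>W. \<forall>i. \<forall>\<^sub>F t in nhds 0. shift i t u \<in> W)"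

lemma shift_open_stratum: "shift_open (stratum L)"
  by (simp add: shift_open_def shift_in_stratum)

lemma shift_open_Int_stratum:
  assumes "open G"
  shows "shift_open (G \<inter> stratum L)"
  unfolding shift_open_def
proof (intro ballI allI)
  fix u i assume "u \<in> G \<inter> stratum L"
  then show "\<forall>\<^sub>F t in nhds 0. shift i t u \<in> G \<inter> stratum L"
    using topological_tendstoD[OF tendsto_shift[of i u] assms]
    by (auto elim!: eventually_mono simp: shift_in_stratum)
qed

text \<open>The derivatives are existentially quantified, rather than given by \<^const>\<open>pdiff\<close>, so that the
  closure under sums and products follows by induction without computing \<^const>\<open>pdiff\<close> of a
  sum or product.\<close>

primrec Ck :: "nat \<Rightarrow> 'n::finite point set \<Rightarrow> ('n point \<Rightarrow> real) \<Rightarrow> bool" where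
  "Ck 0 W f = continuous_on W f"
| "Ck (Suc n) W f = (continuous_on W f \<and> (\<forall>i. \<exists>g. Ck n W g \<and>
     (\<forall>u\<in>W. ((\<lambda>t. f (shift i t u)) has_real_derivative g u) (at 0))))"

lemma Ck_imp_continuous: "Ck n W f \<Longrightarrow> continuous_on W f"
  by (cases n) auto

lemma Ck_SucD: "Ck (Suc n) W f \<Longrightarrow> Ck n W f"
proof (induction n arbitrary: f)
  case (Suc n)
  have "\<exists>g. Ck n W g \<and> (\<forall>u\<in>W. ((\<lambda>t. f (shift i t u)) has_real_derivative g u) (at 0))" for i
  proof -
    obtain g where "Ck (Suc n) W g" "\<forall>u\<in>W. ((\<lambda>t. f (shift i t u)) has_real_derivative g u) (at 0)"
      using Suc.prems by (simp del: Ck.simps add: Ck.simps(2)[of "Suc n"]) blast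
    then show ?thesis
      using Suc.IH by blast
  qed
  then show ?case
    using Suc.prems by simp
qed auto

lemma Ck_SucI:
  assumes "continuous_on W f"
    and "\<And>i. \<exists>g. Ck n W g \<and> (\<forall>u\<in>W. ((\<lambda>t. f (shift i t u)) has_real_derivative g u) (at 0))"
  shows "Ck (Suc n) W f"
  using assms by simp

lemma Ck_const: "Ck n W (\<lambda>u. c)"
proof (induction n arbitrary: c)
  case (Suc n)
  show ?case
    using Suc[of 0] by (intro Ck_SucI continuous_intros exI[of _ "\<lambda>u. 0"]) auto
qed simp

lemma Ck_add: "Ck n W f \<Longrightarrow> Ck n W g \<Longrightarrow> Ck n W (\<lambda>u. f u + g u)"
proof (induction n arbitrary: f g)
  case 0
  then show ?case
    by (auto intro: continuous_on_add)
next
  case (Suc n)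
  show ?case
  proof (rule Ck_SucI)
    show "continuous_on W (\<lambda>u. f u + g u)"
      using Suc.prems by (auto intro: continuous_on_add)
    fix i
    obtain f' g' where *: "Ck n W f'" "Ck n W g'"
      "\<forall>u\<in>W. ((\<lambda>t. f (shift i t u)) has_real_derivative f' u) (at 0)"
      "\<forall>u\<in>W. ((\<lambda>t. g (shift i t u)) has_real_derivative g' u) (at 0)"
      using Suc.prems by (simp, blast)
    then show "\<exists>h. Ck n W h \<and>
        (\<forall>u\<in>W. ((\<lambda>t. f (shift i t u) + g (shift i t u)) has_real_derivative h u) (at 0))"
      by (intro exI[of _ "\<lambda>u. f' u + g' u"]) (auto intro: Suc.IH DERIV_add)
  qed
qed

lemma Ck_mult: "Ck n W f \<Longrightarrow> Ck n W g \<Longrightarrow> Ck n W (\<lambda>u. f u * g u)"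
proof (induction n arbitrary: f g)
  case 0
  then show ?case
    by (auto intro: continuous_on_mult)
next
  case (Suc n)
  show ?case
  proof (rule Ck_SucI)
    show "continuous_on W (\<lambda>u. f u * g u)"
      using Suc.prems by (auto intro: continuous_on_mult)
    fix i
    obtain f' g' where *: "Ck n W f'" "Ck n W g'"
      "\<forall>u\<in>W. ((\<lambda>t. f (shift i t u)) has_real_derivative f' u) (at 0)"
      "\<forall>u\<in>W. ((\<lambda>t. g (shift i t u)) has_real_derivative g' u) (at 0)"
      using Suc.prems by (simp, blast)
    have "((\<lambda>t. f (shift i t u) * g (shift i t u)) has_real_derivative f' u * g u + g' u * f u) (at 0)"
      if "u \<in> W" for u
      using DERIV_mult[of "\<lambda>t. f (shift i t u)" "f' u" 0 UNIV "\<lambda>t. g (shift i t u)" "g' u"] * that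
      by simp
    moreover have "Ck n W (\<lambda>u. f' u * g u + g' u * f u)"
      using * Suc.prems[THEN Ck_SucD] by (intro Ck_add Suc.IH)
    ultimately show "\<exists>h. Ck n W h \<and>
        (\<forall>u\<in>W. ((\<lambda>t. f (shift i t u) * g (shift i t u)) has_real_derivative h u) (at 0))"
      by blast
  qed
qed

lemma Ck_cong:
  assumes W: "shift_open W"
  shows "Ck n W f \<Longrightarrow> (\<And>u. u \<in> W \<Longrightarrow> f u = g u) \<Longrightarrow> Ck n W g"
proof (induction n arbitrary: f g)
  case 0
  then show ?case
    using continuous_on_cong[of W W f g] by simp
next
  case (Suc n)
  show ?case
  proof (rule Ck_SucI)
    show "continuous_on W g"
      using Suc.prems continuous_on_cong[of W W f g] by simp
    fix i
    obtain f' where f': "Ck n W f'"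
      "\<And>u. u \<in> W \<Longrightarrow> ((\<lambda>t. f (shift i t u)) has_real_derivative f' u) (at 0)"
      using Suc.prems(1) by (simp, blast)
    have "((\<lambda>t. g (shift i t u)) has_real_derivative f' u) (at 0)" if u: "u \<in> W" for u
    proof -
      have "\<forall>\<^sub>F t in nhds 0. shift i t u \<in> W"
        using W u by (simp add: shift_open_def)
      then have "\<forall>\<^sub>F t in nhds 0. f (shift i t u) = g (shift i t u)"
        by eventually_elim (rule Suc.prems(2))
      then show ?thesis
        using f'(2)[OF u] by (subst (asm) DERIV_cong_ev[OF refl _ refl])
    qed
    then show "\<exists>h. Ck n W h \<and> (\<forall>u\<in>W. ((\<lambda>t. g (shift i t u)) has_real_derivative h u) (at 0))"
      using f' by blast
  qed
qed

text \<open>A derivative \<open>g\<close> in the definition of \<^const>\<open>Ck\<close> agrees with \<^const>\<open>pdiff\<close> on \<open>W\<close>, and by \<open>Ck_cong\<close>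
  agreement on \<open>W\<close> suffices for the derivatives of higher order.\<close>

lemma smooth_on_stratum_iff_Ck:
  assumes W: "shift_open W"
  shows "smooth_on_stratum W f \<longleftrightarrow> (\<forall>n. Ck n W f)"
proof
  assume *: "smooth_on_stratum W f"
  have "Ck n W (foldr pdiff is f)" for n "is"
  proof (induction n arbitrary: "is")
    case 0
    then show ?case
      using * by (simp add: smooth_on_stratum_def)
  next
    case (Suc n)
    have "\<exists>g. Ck n W g \<and>
        (\<forall>u\<in>W. ((\<lambda>t. foldr pdiff is f (shift i t u)) has_real_derivative g u) (at 0))" for i
    proof (intro exI[of _ "foldr pdiff (i # is) f"] conjI ballI)
      fix u assume "u \<in> W"
      then have "(\<lambda>t. foldr pdiff is f (shift i t u)) differentiable (at 0)"
        using * by (auto simp: smooth_on_stratum_def)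
      then show "((\<lambda>t. foldr pdiff is f (shift i t u)) has_real_derivative
          foldr pdiff (i # is) f u) (at 0)"
        by (simp add: pdiff_def DERIV_deriv_iff_real_differentiable)
    qed (rule Suc)
    then show ?case
      using * by (simp add: smooth_on_stratum_def)
  qed
  from this[of _ "[]"] show "\<forall>n. Ck n W f"
    by simp
next
  assume *: "\<forall>n. Ck n W f"
  have pdiff: "Ck n W (pdiff i g)" if "Ck (Suc n) W g" for i n g
  proof -
    obtain h where h: "Ck n W h" "\<forall>u\<in>W. ((\<lambda>t. g (shift i t u)) has_real_derivative h u) (at 0)"
      using \<open>Ck (Suc n) W g\<close> unfolding Ck.simps by blast
    have "h u = pdiff i g u" if "u \<in> W" for u
      using h(2) that unfolding pdiff_def by (metis DERIV_imp_deriv)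
    then show ?thesis
      by (intro Ck_cong[OF W h(1)])
  qed
  have "Ck n W (foldr pdiff is f)" for n "is"
    by (induction "is" arbitrary: n) (use * in \<open>auto simp del: Ck.simps intro: pdiff\<close>)
  from this[of "Suc 0"] show "smooth_on_stratum W f"
    unfolding smooth_on_stratum_def by (simp add: real_differentiable_def) blast
qed

text \<open>The value \<open>0\<close> at \<open>-\<infinity>\<close> lets products of such functions have compact support in
  \<^const>\<open>NSigma\<close>.\<close>

definition extend :: "(real \<Rightarrow> real) \<Rightarrow> real \<Rightarrow> ereal \<Rightarrow> real" where
  "extend g c y = (if y = \<infinity> then c else if y = -\<infinity> then 0 else g (real_of_ereal y))"

lemma extend_simps [simp]: "extend g c \<infinity> = c" "extend g c (-\<infinity>) = 0" "extend g c (ereal r) = g r"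
  by (simp_all add: extend_def)

text \<open>On a stratum the coordinate \<open>u $ i\<close> is either constantly \<open>\<infinity>\<close>, and then fixed by all shifts, or
  finite. In both cases the derivative is again of the form \<^const>\<open>extend\<close>, with value \<open>0\<close> at \<open>\<infinity>\<close>.\<close>

lemma Ck_extend: "smooth_real g \<Longrightarrow> Ck n (stratum L) (\<lambda>u. extend g c (u $ i))"
proof (induction n arbitrary: g c)
  have cont: "continuous_on (stratum L) (\<lambda>u. extend g c (u $ i))" if g: "smooth_real g" for g c
  proof (cases "i \<in> L")
    case True
    then have "extend g c (u $ i) = c" if "u \<in> stratum L" for u
      using that by (simp add: stratum_nth)
    then show ?thesis
      by (subst continuous_on_cong[OF refl, of _ _ "\<lambda>_. c"]) auto
  next
    case False
    then have fin: "u $ i \<in> UNIV - {\<infinity>, -\<infinity>}" if "u \<in> stratum L" for u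
      using that by (auto simp: stratum_def NSigma_def)
    have "isCont g x" for x
      using smooth_real_deriv(1)[OF g] DERIV_isCont by blast
    then have cg: "continuous_on UNIV g"
      by (simp add: continuous_at_imp_continuous_on)
    have "continuous_on (UNIV - {\<infinity>, -\<infinity>}) (\<lambda>y. g (real_of_ereal y))"
      by (rule continuous_on_compose2[OF cg continuous_on_real]) simp
    then have "continuous_on (stratum L) (\<lambda>u. g (real_of_ereal (u $ i)))"
      by (rule continuous_on_compose2) (use fin in \<open>auto intro!: continuous_intros\<close>)
    moreover have "extend g c (u $ i) = g (real_of_ereal (u $ i))" if "u \<in> stratum L" for u
      using fin[OF that] by (auto simp: extend_def)
    ultimately show ?thesis
      by (subst continuous_on_cong[OF refl, of _ _ "\<lambda>u. g (real_of_ereal (u $ i))"]) auto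
  qed
  {
    case 0
    then show ?case
      using cont by simp
  next
    case (Suc n)
    have "\<exists>h. Ck n (stratum L) h \<and> (\<forall>u\<in>stratum L.
        ((\<lambda>t. extend g c (shift j t u $ i)) has_real_derivative h u) (at 0))" for j
    proof (cases "j = i")
      case True
      have "((\<lambda>t. extend g c (shift j t u $ i)) has_real_derivative extend (deriv g) 0 (u $ i)) (at 0)"
        if "u \<in> stratum L" for u
      proof (cases "u $ i")
        case (real r)
        have "((\<lambda>t. g (t + r)) has_real_derivative deriv g r) (at 0)"
          using smooth_real_deriv(1)[OF Suc.prems, of r] by (simp add: DERIV_shift[symmetric])
        then show ?thesis
          using real True by (simp add: shift_nth add.commute)
      qed (use True that in \<open>simp_all add: shift_nth stratum_nth\<close>)
      then show ?thesis
        using Suc.IH[OF smooth_real_deriv(2)[OF Suc.prems], of 0] by blast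
    next
      case False
      then show ?thesis
        by (intro exI[of _ "\<lambda>u. 0"]) (auto simp: shift_nth Ck_const)
    qed
    then show ?case
      using cont Suc.prems by (intro Ck_SucI)
  }
qed

section \<open>Smooth functions on \<open>N\<^sub>\<Sigma>\<close>\<close>

text \<open>These are the smooth functions on \<^const>\<open>NSigma\<close>, that is, the forms of type \<open>(0,0)\<close>. As \<open>proj L\<close> is
  continuous and fixes the points of the stratum, the condition on neighborhoods can be stated with
  the filter of neighborhoods of \<open>x\<close>; it then passes to sums and products at once.\<close>

definition tame :: "('n::finite point \<Rightarrow> real) \<Rightarrow> bool" where
  "tame f \<longleftrightarrow> (\<forall>L n. Ck n (stratum L) f) \<and>
     (\<forall>L. \<forall>x\<in>stratum L. \<forall>\<^sub>F u in nhds x. f u = f (proj L u))"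

lemma tame_imp_smooth: "tame f \<Longrightarrow> smooth_on_stratum (stratum L) f"
  by (simp add: smooth_on_stratum_iff_Ck shift_open_stratum tame_def)

lemma tame_const: "tame (\<lambda>u. c)"
  by (simp add: tame_def Ck_const)

lemma tame_add:
  assumes "tame f" "tame g"
  shows "tame (\<lambda>u. f u + g u)"
proof -
  have "\<forall>\<^sub>F u in nhds x. f u + g u = f (proj L u) + g (proj L u)" if "x \<in> stratum L" for x L
  proof -
    have "\<forall>\<^sub>F u in nhds x. f u = f (proj L u)" "\<forall>\<^sub>F u in nhds x. g u = g (proj L u)"
      using assms that by (auto simp: tame_def)
    then show ?thesis
      by eventually_elim simp
  qed
  then show ?thesis
    using assms by (simp add: tame_def Ck_add)
qed

lemma tame_mult:
  assumes "tame f" "tame g"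
  shows "tame (\<lambda>u. f u * g u)"
proof -
  have "\<forall>\<^sub>F u in nhds x. f u * g u = f (proj L u) * g (proj L u)" if "x \<in> stratum L" for x L
  proof -
    have "\<forall>\<^sub>F u in nhds x. f u = f (proj L u)" "\<forall>\<^sub>F u in nhds x. g u = g (proj L u)"
      using assms that by (auto simp: tame_def)
    then show ?thesis
      by eventually_elim simp
  qed
  then show ?thesis
    using assms by (simp add: tame_def Ck_mult)
qed

lemma tame_diff: "tame f \<Longrightarrow> tame g \<Longrightarrow> tame (\<lambda>u. f u - g u)"
  using tame_add[of f "\<lambda>u. (-1) * g u"] tame_mult[OF tame_const[of "-1"], of g] by simp

lemma tame_prod: "(\<And>i. i \<in> I \<Longrightarrow> tame (f i)) \<Longrightarrow> tame (\<lambda>u. \<Prod>i\<in>I. f i u)"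
  by (induction I rule: infinite_finite_induct) (auto intro: tame_const tame_mult)

text \<open>If \<open>u $ i = \<infinity>\<close> on the stratum, the function is constant near it because \<open>g\<close> is eventually
  constant; otherwise the projection does not change \<open>u $ i\<close>.\<close>

lemma tame_extend:
  assumes "smooth_real g" "\<And>t. t \<ge> b \<Longrightarrow> g t = c"
  shows "tame (\<lambda>u. extend g c (u $ i))"
proof -
  have "\<forall>\<^sub>F u in nhds x. extend g c (u $ i) = extend g c (proj L u $ i)" if x: "x \<in> stratum L" for x L
  proof (cases "i \<in> L")
    case True
    have "open ((\<lambda>u. u $ i) -` {ereal b<..})"
      by (intro open_vimage_vec_nth) auto
    moreover have "x \<in> (\<lambda>u. u $ i) -` {ereal b<..}"
      using x True by (simp add: stratum_nth)
    moreover have "extend g c (u $ i) = c" if "u \<in> (\<lambda>u. u $ i) -` {ereal b<..}" for u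
      using that assms(2) by (cases "u $ i") auto
    ultimately show ?thesis
      using True by (auto simp: eventually_nhds proj_nth intro!: exI[of _ "(\<lambda>u. u $ i) -` {ereal b<..}"])
  qed (simp add: proj_nth)
  then show ?thesis
    using assms(1) by (simp add: tame_def Ck_extend)
qed

lemma tendsto_proj: "(proj L \<longlongrightarrow> proj L x) (nhds x)"
proof -
  have "((\<lambda>u. \<chi> i. proj L u $ i) \<longlongrightarrow> (\<chi> i. proj L x $ i)) (nhds x)"
    by (intro tendsto_vec_lambda) (auto simp: proj_nth intro!: tendsto_vec_nth filterlim_ident)
  then show ?thesis
    by simp
qed

lemma proj_eq_self: "u \<in> stratum L \<Longrightarrow> proj L u = u"
  by (simp add: vec_eq_iff proj_nth stratum_nth)

lemma eventually_stratum:
  assumes "x \<in> stratum L"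
  shows "\<forall>\<^sub>F u in nhds x. (\<exists>L'\<subseteq>L. u \<in> stratum L') \<and> proj L u \<in> stratum L"
proof -
  define G where "G = {u :: 'a point. \<forall>i. u $ i \<in> (if i \<in> L then -{-\<infinity>} else -{-\<infinity>, \<infinity>})}"
  have "open (- {-\<infinity>, \<infinity>} :: ereal set)"
    by (intro open_Compl finite_imp_closed) auto
  then have "open G"
    unfolding G_def by (intro open_vec_box) (auto intro!: open_Compl finite_imp_closed)
  moreover have "x \<in> G"
    using assms by (auto simp: G_def stratum_def NSigma_def)
  moreover have "(\<exists>L'\<subseteq>L. u \<in> stratum L') \<and> proj L u \<in> stratum L" if "u \<in> G" for u
  proof -
    have *: "u $ i \<noteq> -\<infinity>" "i \<notin> L \<Longrightarrow> u $ i \<noteq> \<infinity>" for i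
      using that by (auto simp: G_def split: if_splits)
    then have "u \<in> stratum {i. u $ i = \<infinity>}" "{i. u $ i = \<infinity>} \<subseteq> L"
      by (auto simp: stratum_def NSigma_def)
    then show ?thesis
      using proj_stratum by blast
  qed
  ultimately show ?thesis
    by (auto simp: eventually_nhds)
qed

text \<open>Near a point of a stratum the function is its own restriction to the stratum composed with the
  projection, so it is continuous across strata although smoothness is only required within them.\<close>

lemma tame_isCont:
  assumes "tame f" "x \<in> NSigma"
  shows "isCont f x"
proof -
  obtain L where L: "x \<in> stratum L"
    using stratum_cover[OF assms(2)] by blast
  have "continuous_on (stratum L) f"
    using assms(1) by (auto simp: tame_def intro: Ck_imp_continuous)
  moreover have "(proj L \<longlongrightarrow> x) (nhds x)"
    using tendsto_proj[of L x] proj_eq_self[OF L] by simp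
  moreover have "\<forall>\<^sub>F u in nhds x. proj L u \<in> stratum L"
    using eventually_stratum[OF L] by eventually_elim simp
  ultimately have "((\<lambda>u. f (proj L u)) \<longlongrightarrow> f x) (nhds x)"
    using L continuous_on_tendsto_compose by blast
  moreover have "\<forall>\<^sub>F u in nhds x. f (proj L u) = f u"
    using assms(1) L by (auto simp: tame_def eq_commute)
  ultimately have "(f \<longlongrightarrow> f x) (nhds x)"
    by (rule Lim_transform_eventually)
  then show ?thesis
    unfolding isCont_def using tendsto_mono[OF at_le[of UNIV UNIV x], of f "f x"]
    by (metis at_within_def inf_le1 tendsto_mono)
qed

lemma tame_continuous_on: "tame f \<Longrightarrow> S \<subseteq> NSigma \<Longrightarrow> continuous_on S f"
  by (intro continuous_at_imp_continuous_on ballI tame_isCont) auto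

lemma open_tame_greater:
  assumes "tame f"
  shows "open {u \<in> NSigma. c < f u}"
proof -
  have "open (f -` {c<..} \<inter> NSigma)"
    using tame_continuous_on[OF assms subset_refl] by (simp add: continuous_on_open_vimage open_NSigma)
  moreover have "f -` {c<..} \<inter> NSigma = {u \<in> NSigma. c < f u}"
    by auto
  ultimately show ?thesis
    by simp
qed

section \<open>Test functions\<close>

definition test_functions :: "'n::finite point set \<Rightarrow> ('n point \<Rightarrow> real) set" where
  "test_functions X = {f. tame f \<and> (\<exists>K. compact K \<and> K \<subseteq> X \<and> supported_in K f)}"

lemma test_functions_mono: "X \<subseteq> Y \<Longrightarrow> test_functions X \<subseteq> test_functions Y"
  by (auto simp: test_functions_def)

lemma test_functions_tame: "f \<in> test_functions X \<Longrightarrow> tame f"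
  by (simp add: test_functions_def)

lemma test_functions_0: "(\<lambda>u. 0) \<in> test_functions X"
  by (auto simp: test_functions_def tame_const supported_in_def intro!: exI[of _ "{}"])

lemma test_functions_add:
  assumes "f \<in> test_functions X" "g \<in> test_functions X"
  shows "(\<lambda>u. f u + g u) \<in> test_functions X"
proof -
  obtain K K' where "compact K" "K \<subseteq> X" "supported_in K f" "compact K'" "K' \<subseteq> X" "supported_in K' g"
    using assms by (auto simp: test_functions_def)
  then have "compact (K \<union> K')" "K \<union> K' \<subseteq> X" "supported_in (K \<union> K') (\<lambda>u. f u + g u)"
    by (auto simp: supported_in_def)
  moreover have "tame (\<lambda>u. f u + g u)"
    using assms by (simp add: test_functions_tame tame_add)
  ultimately show ?thesis
    unfolding test_functions_def by blast
qed

lemma test_functions_mult: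
  assumes "tame \<psi>" "f \<in> test_functions X"
  shows "(\<lambda>u. \<psi> u * f u) \<in> test_functions X"
  using assms by (auto simp: test_functions_def supported_in_def intro!: tame_mult)

lemma test_functions_scale: "f \<in> test_functions X \<Longrightarrow> (\<lambda>u. c * f u) \<in> test_functions X"
  by (rule test_functions_mult[OF tame_const])

lemma test_functions_diff:
  "f \<in> test_functions X \<Longrightarrow> g \<in> test_functions X \<Longrightarrow> (\<lambda>u. f u - g u) \<in> test_functions X"
  using test_functions_add[OF _ test_functions_scale[of g X "-1"], of f] by simp

lemma test_functions_sum:
  "(\<And>i. i \<in> I \<Longrightarrow> f i \<in> test_functions X) \<Longrightarrow> (\<lambda>u. \<Sum>i\<in>I. f i u) \<in> test_functions X"
  by (induction I rule: infinite_finite_induct) (auto intro: test_functions_0 test_functions_add)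

text \<open>A bump function of one coordinate at an arbitrary point: at a finite point a product of two steps,
  at \<open>\<infinity>\<close> a single step. The lemma yields the data \<open>g\<close>, \<open>c\<close>, \<open>b\<close> needed in \<open>tame_extend\<close>.\<close>

lemma ereal_bump:
  assumes A: "open A" "x \<in> A" "x \<noteq> -\<infinity>"
  shows "\<exists>g c b C. smooth_real g \<and> (\<forall>t\<ge>b. g t = c) \<and> (\<forall>y. 0 \<le> extend g c y) \<and> extend g c x = 1 \<and>
    compact C \<and> C \<subseteq> A \<and> (\<forall>y. y \<notin> C \<longrightarrow> extend g c y = 0)"
proof (cases x)
  case (real r)
  have "open (ereal -` A)"
    using A by (simp add: open_ereal_vimage)
  moreover have "r \<in> ereal -` A"
    using A real by simp
  ultimately obtain e where e: "e > 0" "cball r e \<subseteq> ereal -` A"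
    using open_contains_cball_eq by blast
  define g where "g t = step (1 / e * t + (1 - r / e)) * step (- 1 / e * t + (1 + r / e))" for t
  have eq: "1 / e * t + (1 - r / e) = (t - (r - e)) / e" "- 1 / e * t + (1 + r / e) = (r + e - t) / e" for t
    using e by (simp_all add: field_simps)
  have g0: "g t = 0" if "t \<le> r - e \<or> t \<ge> r + e" for t
    using that e unfolding g_def eq by (auto simp: step_eq_0 divide_le_0_iff)
  have "smooth_real g"
    unfolding g_def by (intro smooth_real_mult smooth_real_step)
  moreover have "0 \<le> extend g 0 y" for y
    by (cases y) (auto simp: g_def step_bounds)
  moreover have "extend g 0 x = 1"
    using e unfolding real extend_simps g_def eq by (simp add: step_eq_1)
  moreover have "compact {ereal (r - e)..ereal (r + e)}"
    by (simp add: compact_eq_closed)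
  moreover have "{ereal (r - e)..ereal (r + e)} \<subseteq> A"
  proof
    fix y assume y: "y \<in> {ereal (r - e)..ereal (r + e)}"
    then obtain t where "y = ereal t"
      by (cases y) auto
    then show "y \<in> A"
      using y e(2) by (auto simp: cball_def dist_real_def abs_le_iff subset_iff)
  qed
  moreover have "extend g 0 y = 0" if "y \<notin> {ereal (r - e)..ereal (r + e)}" for y
    using that g0 by (cases y) auto
  ultimately show ?thesis
    using g0 by (intro exI[of _ g] exI[of _ 0] exI[of _ "r + e"] exI[of _ "{ereal (r - e)..ereal (r + e)}"]) auto
next
  case PInf
  then obtain b where b: "{ereal b<..} \<subseteq> A"
    using A open_PInfty by metis
  define g where "g t = step (1 * t + - (b + 1))" for t
  have "smooth_real g"
    unfolding g_def by (rule smooth_real_step)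
  moreover have "g t = 1" if "t \<ge> b + 2" for t
    using that by (simp add: g_def step_eq_1)
  moreover have "0 \<le> extend g 1 y" for y
    by (cases y) (auto simp: g_def step_bounds)
  moreover have "extend g 1 x = 1"
    using PInf by simp
  moreover have "compact {ereal (b + 1)..\<infinity>}"
    by (simp add: compact_eq_closed)
  moreover have "{ereal (b + 1)..\<infinity>} \<subseteq> A"
  proof
    fix y assume "y \<in> {ereal (b + 1)..\<infinity>}"
    then have "ereal b < y"
      by (cases y) auto
    then show "y \<in> A"
      using b by auto
  qed
  moreover have "extend g 1 y = 0" if "y \<notin> {ereal (b + 1)..\<infinity>}" for y
    using that by (cases y) (auto simp: g_def step_eq_0)
  ultimately show ?thesis
    by (intro exI[of _ g] exI[of _ 1] exI[of _ "b + 2"] exI[of _ "{ereal (b + 1)..\<infinity>}"]) auto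
qed (use assms in simp)

lemma test_function_at:
  assumes X: "open X" "X \<subseteq> NSigma" "x \<in> X"
  shows "\<exists>h\<in>test_functions X. (\<forall>u. 0 \<le> h u) \<and> h x = 1"
proof -
  obtain A where A: "\<And>i. open (A i) \<and> x $ i \<in> A i" "\<And>y. (\<And>i. y $ i \<in> A i) \<Longrightarrow> y \<in> X"
    using X(1,3) unfolding open_vec_def by metis
  have "x $ i \<noteq> -\<infinity>" for i
    using X(2,3) by (auto simp: NSigma_def)
  then have "\<forall>i. \<exists>g c b C. smooth_real g \<and> (\<forall>t\<ge>b. g t = c) \<and> (\<forall>y. 0 \<le> extend g c y) \<and>
      extend g c (x $ i) = 1 \<and> compact C \<and> C \<subseteq> A i \<and> (\<forall>y. y \<notin> C \<longrightarrow> extend g c y = 0)"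
    using ereal_bump A(1) by metis
  then obtain g c b C where *: "\<And>i. smooth_real (g i) \<and> (\<forall>t\<ge>b i. g i t = c i) \<and>
      (\<forall>y. 0 \<le> extend (g i) (c i) y) \<and> extend (g i) (c i) (x $ i) = 1 \<and> compact (C i) \<and>
      C i \<subseteq> A i \<and> (\<forall>y. y \<notin> C i \<longrightarrow> extend (g i) (c i) y = 0)"
    by metis
  define h where "h u = (\<Prod>i\<in>UNIV. extend (g i) (c i) (u $ i))" for u
  define K where "K = {u :: 'a point. \<forall>i. u $ i \<in> C i}"
  have "tame h"
    unfolding h_def
  proof (rule tame_prod)
    show "tame (\<lambda>u. extend (g i) (c i) (u $ i))" for i
      using * by (intro tame_extend[where b = "b i"]) auto
  qed
  moreover have "compact K"
    unfolding K_def using * by (intro compact_vec_box) blast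
  moreover have "K \<subseteq> X"
    unfolding K_def using A(2) * by blast
  moreover have "supported_in K h"
    unfolding supported_in_def
  proof (intro allI impI)
    fix u assume "u \<notin> K"
    then obtain i where "u $ i \<notin> C i"
      by (auto simp: K_def)
    then have "extend (g i) (c i) (u $ i) = 0"
      using * by blast
    then show "h u = 0"
      unfolding h_def by (intro prod_zero) auto
  qed
  moreover have "h x = 1" "\<forall>u. 0 \<le> h u"
    unfolding h_def using * by (auto intro!: prod_nonneg)
  ultimately show ?thesis
    unfolding test_functions_def by blast
qed

lemma test_function_ge_1_on_compact:
  assumes X: "open X" "X \<subseteq> NSigma" and K: "compact K" "K \<subseteq> X"
  shows "\<exists>h\<in>test_functions X. (\<forall>u. 0 \<le> h u) \<and> (\<forall>u\<in>K. 1 \<le> h u)"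
proof -
  have "\<forall>x\<in>K. \<exists>h. h \<in> test_functions X \<and> (\<forall>u. 0 \<le> h u) \<and> h x = 1"
    using test_function_at[OF X] K(2) by blast
  from bchoice[OF this] obtain h where h: "\<And>x. x \<in> K \<Longrightarrow> h x \<in> test_functions X"
    "\<And>x u. x \<in> K \<Longrightarrow> 0 \<le> h x u" "\<And>x. x \<in> K \<Longrightarrow> h x x = 1"
    by blast
  define W where "W x = {u \<in> NSigma. 1 / 2 < h x u}" for x
  have "open (W x)" if "x \<in> K" for x
    unfolding W_def using h(1)[OF that] by (intro open_tame_greater test_functions_tame)
  moreover have "x \<in> W x" if "x \<in> K" for x
    using K X h(3)[OF that] that unfolding W_def by auto
  then have "K \<subseteq> (\<Union>x\<in>K. W x)"
    by blast
  ultimately obtain D where D: "D \<subseteq> K" "finite D" "K \<subseteq> (\<Union>x\<in>D. W x)"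
    using compactE_image[OF K(1)] by metis
  define H where "H u = 2 * (\<Sum>x\<in>D. h x u)" for u
  have "H \<in> test_functions X"
    unfolding H_def using D h(1) by (intro test_functions_scale test_functions_sum) auto
  moreover have "0 \<le> H u" for u
    unfolding H_def using D h(2) by (auto intro!: sum_nonneg)
  moreover have "1 \<le> H u" if "u \<in> K" for u
  proof -
    obtain x where x: "x \<in> D" "1 / 2 < h x u"
      using D(3) \<open>u \<in> K\<close> unfolding W_def by blast
    then have "h x u \<le> (\<Sum>x\<in>D. h x u)"
      using D h(2) by (intro member_le_sum) auto
    then show ?thesis
      using x by (simp add: H_def)
  qed
  ultimately show ?thesis
    by blast
qed

lemma test_function_dominating:
  assumes X: "open X" "X \<subseteq> NSigma" and K: "compact K" "K \<subseteq> X" "supported_in K f"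
    and f: "continuous_on K f"
  shows "\<exists>h\<in>test_functions X. \<forall>u. \<bar>f u\<bar> \<le> h u"
proof -
  obtain h where h: "h \<in> test_functions X" "\<And>u. 0 \<le> h u" "\<And>u. u \<in> K \<Longrightarrow> 1 \<le> h u"
    using test_function_ge_1_on_compact[OF X K(1,2)] by blast
  have "bounded (f ` K)"
    using K(1) f by (intro compact_imp_bounded compact_continuous_image)
  then obtain B where B: "\<And>u. u \<in> K \<Longrightarrow> \<bar>f u\<bar> \<le> B"
    by (auto simp: bounded_iff)
  have "\<bar>f u\<bar> \<le> \<bar>B\<bar> * h u" for u
  proof (cases "u \<in> K")
    case True
    have "\<bar>f u\<bar> \<le> \<bar>B\<bar> * 1"
      using B[OF True] by simp
    also have "\<dots> \<le> \<bar>B\<bar> * h u"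
      using h(3)[OF True] by (intro mult_left_mono) auto
    finally show ?thesis .
  next
    case False
    then show ?thesis
      using K(3) h(2) by (simp add: supported_in_def)
  qed
  then show ?thesis
    using test_functions_scale[OF h(1), of "\<bar>B\<bar>"] by (intro bexI[of _ "\<lambda>u. \<bar>B\<bar> * h u"]) auto
qed

lemma test_function_bounded:
  assumes f: "f \<in> test_functions X" and X: "X \<subseteq> NSigma"
  shows "\<exists>B>0. \<forall>u. \<bar>f u\<bar> \<le> B"
proof -
  obtain K where K: "compact K" "K \<subseteq> X" "supported_in K f"
    using f by (auto simp: test_functions_def)
  then have "bounded (f ` K)"
    using f X by (intro compact_imp_bounded compact_continuous_image tame_continuous_on
      test_functions_tame) auto
  then obtain B where "B > 0" "\<And>u. u \<in> K \<Longrightarrow> \<bar>f u\<bar> \<le> B"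
    unfolding bounded_pos by auto
  then have "\<bar>f u\<bar> \<le> B" for u
    using K(3) by (cases "u \<in> K") (auto simp: supported_in_def)
  then show ?thesis
    using \<open>B > 0\<close> by blast
qed

lemma test_functions_imp_Cc:
  assumes "f \<in> test_functions X" "X \<subseteq> NSigma"
  shows "f \<in> Cc X"
  using assms tame_continuous_on[of f X] by (auto simp: test_functions_def Cc_def)

text \<open>The error is dominated by a multiple of one fixed test function \<open>h\<close>, not only by a constant. This is
  the form of density that a functional dominated by a positive one can use, and it keeps the
  supports of all approximants inside one compact set.\<close>

lemma test_functions_dense:
  assumes X: "open X" "X \<subseteq> NSigma" and f: "f \<in> Cc X"
  shows "\<exists>h\<in>test_functions X. (\<forall>u. 0 \<le> h u) \<and>
    (\<forall>\<epsilon>>0. \<exists>g\<in>test_functions X. \<forall>u. \<bar>f u - g u\<bar> \<le> \<epsilon> * h u)"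
proof -
  obtain K where K: "compact K" "K \<subseteq> X" "supported_in K f"
    using f by (auto simp: Cc_def)
  obtain h where h: "h \<in> test_functions X" "\<And>u. 0 \<le> h u" "\<And>u. u \<in> K \<Longrightarrow> 1 \<le> h u"
    using test_function_ge_1_on_compact[OF X K(1,2)] by blast
  obtain K' where K': "compact K'" "K' \<subseteq> X" "supported_in K' h"
    using h(1) by (auto simp: test_functions_def)
  define F where "F u = f u / max 1 (h u)" for u
  \<comment> \<open>on the support of \<open>f\<close> one has \<open>1 \<le> h\<close>, so the denominator of \<open>F\<close> is \<open>h\<close> there\<close>
  have fF: "f u = F u * h u" for u
    using K(3) h(3)[of u] by (cases "u \<in> K") (auto simp: F_def supported_in_def max_def)
  have "continuous_on K' f" "continuous_on K' h"
    using f K'(2) h(1) X(2) by (auto simp: Cc_def intro: continuous_on_subset tame_continuous_on test_functions_tame)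
  then have F: "continuous_on K' F"
    unfolding F_def by (intro continuous_intros) (auto simp: max_def)
  have "\<exists>g\<in>test_functions X. \<forall>u. \<bar>f u - g u\<bar> \<le> \<epsilon> * h u" if \<epsilon>: "\<epsilon> > 0" for \<epsilon>
  proof -
    have "\<exists>g. tame g \<and> (\<forall>x\<in>K'. \<bar>F x - g x\<bar> < \<epsilon>)"
    proof (rule Stone_Weierstrass_HOL[where P = tame])
      show "\<exists>g. tame g \<and> g x \<noteq> g y" if xy: "x \<in> K' \<and> y \<in> K' \<and> x \<noteq> y" for x y
      proof -
        have "open (X - {y})" "X - {y} \<subseteq> NSigma" "x \<in> X - {y}"
          using X K'(2) xy by (auto intro: open_Diff)
        then obtain g where g: "g \<in> test_functions (X - {y})" "g x = 1"
          using test_function_at by metis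
        then have "g y = 0"
          unfolding test_functions_def supported_in_def by blast
        then have "g x \<noteq> g y"
          using g(2) by simp
        then show ?thesis
          using g(1) test_functions_tame by blast
      qed
    qed (use K' X F \<epsilon> in \<open>auto intro: tame_const tame_add tame_mult tame_continuous_on\<close>)
    then obtain g where g: "tame g" "\<And>x. x \<in> K' \<Longrightarrow> \<bar>F x - g x\<bar> < \<epsilon>"
      by blast
    have "\<bar>f u - g u * h u\<bar> \<le> \<epsilon> * h u" for u
    proof (cases "u \<in> K'")
      case True
      have "\<bar>f u - g u * h u\<bar> = \<bar>F u - g u\<bar> * h u"
        using h(2)[of u] by (simp add: fF left_diff_distrib[symmetric] abs_mult)
      then show ?thesis
        using g(2)[OF True] h(2)[of u] by (simp add: mult_right_mono)
    next
      case False
      then have "h u = 0"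
        using K'(3) by (simp add: supported_in_def)
      then show ?thesis
        by (simp add: fF)
    qed
    then show ?thesis
      using test_functions_mult[OF g(1) h(1)] by (intro bexI[of _ "\<lambda>u. g u * h u"]) auto
  qed
  then show ?thesis
    using h by blast
qed

section \<open>Continuity in direct limits\<close>

lemma linear_on_combination:
  assumes "linear_on E T" "\<And>f c. f \<in> E \<Longrightarrow> (\<lambda>u. c *\<^sub>R f u) \<in> E" "f \<in> E" "g \<in> E"
  shows "T (\<lambda>u. s *\<^sub>R f u + t *\<^sub>R g u) = s * T f + t * T g"
  using assms unfolding linear_on_def by simp

lemma linear_on_sum:
  assumes "linear_on E T" "(\<lambda>u. 0) \<in> E" "\<And>f g. f \<in> E \<Longrightarrow> g \<in> E \<Longrightarrow> (\<lambda>u. f u + g u) \<in> E"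
    and "\<And>i. i \<in> I \<Longrightarrow> f i \<in> E"
  shows "T (\<lambda>u. \<Sum>i\<in>I. f i u) = (\<Sum>i\<in>I. T (f i)) \<and> (\<lambda>u. \<Sum>i\<in>I. f i u) \<in> E"
  using assms(4)
proof (induction I rule: infinite_finite_induct)
  have "T (\<lambda>u. 0 + 0) = T (\<lambda>u. 0) + T (\<lambda>u. 0)"
    using assms(1)[unfolded linear_on_def, THEN conjunct1, rule_format, OF assms(2,2)] .
  then have "T (\<lambda>u. 0) = 0"
    by simp
  then show "T (\<lambda>u. \<Sum>i\<in>{}. f i u) = (\<Sum>i\<in>{}. T (f i)) \<and> (\<lambda>u. \<Sum>i\<in>{}. f i u) \<in> E"
    "infinite A \<Longrightarrow> T (\<lambda>u. \<Sum>i\<in>A. f i u) = (\<Sum>i\<in>A. T (f i)) \<and> (\<lambda>u. \<Sum>i\<in>A. f i u) \<in> E" for A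
    using assms(2) by auto
  show "T (\<lambda>u. \<Sum>i\<in>insert x A. f i u) = (\<Sum>i\<in>insert x A. T (f i)) \<and> (\<lambda>u. \<Sum>i\<in>insert x A. f i u) \<in> E"
    if "finite A" "x \<notin> A"
      "(\<And>i. i \<in> A \<Longrightarrow> f i \<in> E) \<Longrightarrow> T (\<lambda>u. \<Sum>i\<in>A. f i u) = (\<Sum>i\<in>A. T (f i)) \<and> (\<lambda>u. \<Sum>i\<in>A. f i u) \<in> E"
      "\<And>i. i \<in> insert x A \<Longrightarrow> f i \<in> E" for x A
    using that assms(1,3) unfolding linear_on_def by simp
qed

locale direct_limit =
  fixes E :: "('a \<Rightarrow> 'b::real_vector) set"
    and F :: "(('a \<Rightarrow> 'b) set \<times> (nat \<Rightarrow> ('a \<Rightarrow> 'b) \<Rightarrow> real)) set"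
  assumes zero: "(\<lambda>u. 0) \<in> E"
    and add: "f \<in> E \<Longrightarrow> g \<in> E \<Longrightarrow> (\<lambda>u. f u + g u) \<in> E"
    and scale: "f \<in> E \<Longrightarrow> (\<lambda>u. c *\<^sub>R f u) \<in> E"
    and sub: "(S, \<nu>) \<in> F \<Longrightarrow> S \<subseteq> E"
begin

text \<open>The topology is defined by its open sets, so its underlying set has to be identified: \<open>E\<close> itself is
  a neighborhood of zero.\<close>

lemma topspace_direct_limit: "topspace (direct_limit_topology E F) = E"
proof -
  have "direct_limit_nhd E F E"
    unfolding direct_limit_nhd_def absolutely_convex_def
  proof (intro conjI)
    show "E \<noteq> {}"
      using zero by auto
    show "\<forall>(S, \<nu>)\<in>F. \<exists>m. \<exists>\<epsilon>>0. {f \<in> S. \<forall>j\<le>m. \<nu> j f < \<epsilon>} \<subseteq> E"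
    proof (intro ballI, clarify)
      fix S \<nu> assume "(S, \<nu>) \<in> F"
      then show "\<exists>m. \<exists>\<epsilon>>0. {f \<in> S. \<forall>j\<le>m. \<nu> j f < \<epsilon>} \<subseteq> E"
        using sub zero_less_one by blast
    qed
  qed (auto intro: add scale)
  then have "openin (direct_limit_topology E F) E"
    unfolding openin_direct_limit_topology using add by blast
  moreover have "topspace (direct_limit_topology E F) \<subseteq> E"
    using openin_topspace[of "direct_limit_topology E F"]
    unfolding openin_direct_limit_topology by blast
  ultimately show ?thesis
    using openin_subset by blast
qed

text \<open>An estimate by the norm of index \<open>0\<close> on each member is enough, since all functionals considered
  here are of order zero.\<close>

lemma continuous_mapI:
  assumes T: "linear_on E T"
    and bound: "\<And>S \<nu>. (S, \<nu>) \<in> F \<Longrightarrow> \<exists>C\<ge>0. \<forall>f\<in>S. \<bar>T f\<bar> \<le> C * \<nu> 0 f"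
  shows "continuous_map (direct_limit_topology E F) euclideanreal T"
proof -
  have T0: "T (\<lambda>u. 0) = 0"
    using linear_on_combination[OF T scale zero zero, of 0 0] by simp
  have nhd: "direct_limit_nhd E F {g \<in> E. \<bar>T g\<bar> < \<delta>}" if \<delta>: "\<delta> > 0" for \<delta>
    unfolding direct_limit_nhd_def absolutely_convex_def
  proof (intro conjI)
    show "{g \<in> E. \<bar>T g\<bar> < \<delta>} \<noteq> {}"
      using zero T0 \<delta> by auto
    show "\<forall>f\<in>{g \<in> E. \<bar>T g\<bar> < \<delta>}. \<forall>g\<in>{g \<in> E. \<bar>T g\<bar> < \<delta>}. \<forall>s t. \<bar>s\<bar> + \<bar>t\<bar> \<le> 1 \<longrightarrow>
        (\<lambda>u. s *\<^sub>R f u + t *\<^sub>R g u) \<in> {g \<in> E. \<bar>T g\<bar> < \<delta>}"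
    proof (intro ballI allI impI)
      fix f g and s t :: real
      assume fg: "f \<in> {g \<in> E. \<bar>T g\<bar> < \<delta>}" "g \<in> {g \<in> E. \<bar>T g\<bar> < \<delta>}" and st: "\<bar>s\<bar> + \<bar>t\<bar> \<le> 1"
      define M where "M = max \<bar>T f\<bar> \<bar>T g\<bar>"
      have "\<bar>T (\<lambda>u. s *\<^sub>R f u + t *\<^sub>R g u)\<bar> = \<bar>s * T f + t * T g\<bar>"
        using linear_on_combination[OF T scale] fg by simp
      also have "\<dots> \<le> \<bar>s\<bar> * \<bar>T f\<bar> + \<bar>t\<bar> * \<bar>T g\<bar>"
        by (metis abs_mult abs_triangle_ineq)
      also have "\<dots> \<le> \<bar>s\<bar> * M + \<bar>t\<bar> * M"
        by (intro add_mono mult_left_mono) (auto simp: M_def)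
      also have "\<dots> \<le> 1 * M"
        using st by (simp only: distrib_right[symmetric]) (intro mult_right_mono, auto simp: M_def)
      also have "\<dots> < \<delta>"
        using fg by (simp add: M_def)
      finally show "(\<lambda>u. s *\<^sub>R f u + t *\<^sub>R g u) \<in> {g \<in> E. \<bar>T g\<bar> < \<delta>}"
        using fg by (simp add: add scale)
    qed
    have "\<exists>m. \<exists>\<epsilon>>0. {f \<in> S. \<forall>j\<le>m. \<nu> j f < \<epsilon>} \<subseteq> {g \<in> E. \<bar>T g\<bar> < \<delta>}" if S: "(S, \<nu>) \<in> F" for S \<nu>
    proof -
      obtain C where C: "C \<ge> 0" "\<And>f. f \<in> S \<Longrightarrow> \<bar>T f\<bar> \<le> C * \<nu> 0 f"
        using bound[OF S] by blast
      have "\<bar>T f\<bar> < \<delta>" if f: "f \<in> S" "\<nu> 0 f < \<delta> / (C + 1)" for f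
      proof -
        have "\<bar>T f\<bar> \<le> C * (\<delta> / (C + 1))"
          using C(2)[OF f(1)] mult_left_mono[OF less_imp_le[OF f(2)] C(1)] by linarith
        also have "\<dots> < \<delta>"
          using C(1) \<delta> by (simp add: field_simps)
        finally show ?thesis .
      qed
      moreover have "\<delta> / (C + 1) > 0"
        using C(1) \<delta> by simp
      ultimately show ?thesis
        using sub[OF S] by (intro exI[of _ 0] exI[of _ "\<delta> / (C + 1)"]) auto
    qed
    then show "\<forall>(S, \<nu>)\<in>F. \<exists>m. \<exists>\<epsilon>>0. {f \<in> S. \<forall>j\<le>m. \<nu> j f < \<epsilon>} \<subseteq> {g \<in> E. \<bar>T g\<bar> < \<delta>}"
      by blast
  qed auto
  have "openin (direct_limit_topology E F) {f \<in> E. T f \<in> V}" if V: "open V" for V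
    unfolding openin_direct_limit_topology
  proof (intro conjI ballI)
    fix f assume f: "f \<in> {f \<in> E. T f \<in> V}"
    then obtain \<delta> where \<delta>: "\<delta> > 0" "ball (T f) \<delta> \<subseteq> V"
      using V open_contains_ball by blast
    have "(\<lambda>u. f u + g u) \<in> {f \<in> E. T f \<in> V}" if g: "g \<in> {g \<in> E. \<bar>T g\<bar> < \<delta>}" for g
    proof -
      have "T (\<lambda>u. f u + g u) = T f + T g"
        using T f g by (auto simp: linear_on_def)
      then have "T (\<lambda>u. f u + g u) \<in> ball (T f) \<delta>"
        using g by (simp add: dist_real_def)
      then show ?thesis
        using \<delta>(2) f g by (auto intro: add)
    qed
    then show "\<exists>B. direct_limit_nhd E F B \<and> (\<forall>g\<in>B. (\<lambda>u. f u + g u) \<in> {f \<in> E. T f \<in> V})"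
      using nhd[OF \<delta>(1)] by blast
  qed auto
  then show ?thesis
    by (auto simp: continuous_map_def topspace_direct_limit)
qed

lemma continuous_mapD:
  assumes T: "linear_on E T" and cont: "continuous_map (direct_limit_topology E F) euclideanreal T"
    and S: "(S, \<nu>) \<in> F"
  shows "\<exists>m. \<exists>\<epsilon>>0. \<forall>f\<in>S. (\<forall>j\<le>m. \<nu> j f < \<epsilon>) \<longrightarrow> \<bar>T f\<bar> < 1"
proof -
  have T0: "T (\<lambda>u. 0) = 0"
    using linear_on_combination[OF T scale zero zero, of 0 0] by simp
  have "openin (direct_limit_topology E F) {f \<in> E. T f \<in> {-1<..<1}}"
    using cont openin_continuous_map_preimage[of "direct_limit_topology E F" euclideanreal T "{-1<..<1}"]
    by (simp add: topspace_direct_limit)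
  moreover have "(\<lambda>u. 0) \<in> {f \<in> E. T f \<in> {-1<..<1}}"
    using zero T0 by simp
  ultimately obtain B where B: "direct_limit_nhd E F B"
    "\<forall>g\<in>B. (\<lambda>u. 0 + g u) \<in> {f \<in> E. T f \<in> {-1<..<1}}"
    unfolding openin_direct_limit_topology by blast
  obtain m \<epsilon> where "\<epsilon> > 0" "{f \<in> S. \<forall>j\<le>m. \<nu> j f < \<epsilon>} \<subseteq> B"
    using B(1) S unfolding direct_limit_nhd_def by blast
  then have "\<bar>T f\<bar> < 1" if "f \<in> S" "\<forall>j\<le>m. \<nu> j f < \<epsilon>" for f
    using B(2) that by fastforce
  then show ?thesis
    using \<open>\<epsilon> > 0\<close> by blast
qed

end

section \<open>Continuous functions with compact support\<close>

lemma sup_on_upper: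
  assumes "compact K" "continuous_on K f" "u \<in> K"
  shows "\<bar>f u\<bar> \<le> sup_on K f"
proof -
  have "bdd_above ((\<lambda>u. \<bar>f u\<bar>) ` K)"
    using assms by (intro bounded_imp_bdd_above compact_imp_bounded compact_continuous_image continuous_intros)
  then show ?thesis
    using assms(3) by (auto simp: sup_on_def intro: cSUP_upper)
qed

lemma sup_on_nonneg:
  assumes "compact K" "continuous_on K f"
  shows "0 \<le> sup_on K f"
proof (cases "K = {}")
  case False
  then obtain u where "u \<in> K" by auto
  then show ?thesis
    using sup_on_upper[OF assms, of u] by linarith
qed (simp add: sup_on_def)

lemma Cc_0: "(\<lambda>u. 0) \<in> Cc X"
  by (auto simp: Cc_def supported_in_def intro!: exI[of _ "{}"])

lemma Cc_add:
  assumes "f \<in> Cc X" "g \<in> Cc X"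
  shows "(\<lambda>u. f u + g u) \<in> Cc X"
proof -
  obtain K K' where "compact K" "K \<subseteq> X" "supported_in K f" "compact K'" "K' \<subseteq> X" "supported_in K' g"
    using assms by (auto simp: Cc_def)
  then have "compact (K \<union> K')" "K \<union> K' \<subseteq> X" "supported_in (K \<union> K') (\<lambda>u. f u + g u)"
    by (auto simp: supported_in_def)
  moreover have "continuous_on X (\<lambda>u. f u + g u)"
    using assms by (auto simp: Cc_def intro: continuous_on_add)
  ultimately show ?thesis
    unfolding Cc_def by blast
qed

lemma Cc_scale: "f \<in> Cc X \<Longrightarrow> (\<lambda>u. c * f u) \<in> Cc X"
  by (auto simp: Cc_def supported_in_def intro!: continuous_intros)

lemma Cc_mono:
  fixes V X :: "'a::t2_space set"
  assumes "open V" "V \<subseteq> X" "f \<in> Cc V"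
  shows "f \<in> Cc X"
proof -
  obtain K where K: "compact K" "K \<subseteq> V" "supported_in K f"
    using assms(3) by (auto simp: Cc_def)
  have "continuous_on (- K) f"
    using K(3) by (subst continuous_on_cong[OF refl, of _ _ "\<lambda>_. 0"]) (auto simp: supported_in_def)
  moreover have "open (- K)"
    using K(1) by (simp add: compact_imp_closed open_Compl)
  moreover have "continuous_on V f"
    using assms(3) by (simp add: Cc_def)
  ultimately have "continuous_on (V \<union> - K) f"
    using assms(1) by (intro continuous_on_open_Un)
  then have "continuous_on X f"
    by (rule continuous_on_subset) (use K(2) in auto)
  then show ?thesis
    using K assms(2) by (auto simp: Cc_def)
qed

lemma direct_limit_Cc:
  "direct_limit (Cc X) {({f \<in> Cc X. supported_in K f}, \<lambda>_. sup_on K) | K. compact K \<and> K \<subseteq> X}"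
  by unfold_locales (auto simp: Cc_0 Cc_add Cc_scale)

lemma real_radon_measureI:
  assumes "linear_on (Cc X) \<mu>"
    and "\<And>K. compact K \<Longrightarrow> K \<subseteq> X \<Longrightarrow>
      \<exists>C\<ge>0. \<forall>f\<in>Cc X. supported_in K f \<longrightarrow> \<bar>\<mu> f\<bar> \<le> C * sup_on K f"
  shows "real_radon_measure X \<mu>"
  unfolding real_radon_measure_def Cc_topology_def
proof (intro conjI direct_limit.continuous_mapI[OF direct_limit_Cc] assms(1))
  fix S and \<nu> :: "nat \<Rightarrow> ('a \<Rightarrow> real) \<Rightarrow> real"
  assume "(S, \<nu>) \<in> {({f \<in> Cc X. supported_in K f}, \<lambda>_. sup_on K) | K. compact K \<and> K \<subseteq> X}"
  then show "\<exists>C\<ge>0. \<forall>f\<in>S. \<bar>\<mu> f\<bar> \<le> C * \<nu> 0 f"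
    using assms(2) by fastforce
qed

lemma real_radon_measure_bound:
  assumes \<mu>: "real_radon_measure X \<mu>" and K: "compact K" "K \<subseteq> X"
  shows "\<exists>C\<ge>0. \<forall>a>0. \<forall>f\<in>Cc X. supported_in K f \<longrightarrow> (\<forall>u. \<bar>f u\<bar> \<le> a) \<longrightarrow> \<bar>\<mu> f\<bar> \<le> C * a"
proof -
  have lin: "linear_on (Cc X) \<mu>"
    using \<mu> by (simp add: real_radon_measure_def)
  have "continuous_map (direct_limit_topology (Cc X)
      {({f \<in> Cc X. supported_in K f}, \<lambda>_. sup_on K) | K. compact K \<and> K \<subseteq> X}) euclideanreal \<mu>"
    using \<mu> by (simp add: real_radon_measure_def Cc_topology_def)
  from direct_limit.continuous_mapD[OF direct_limit_Cc lin this,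
      of "{f \<in> Cc X. supported_in K f}" "\<lambda>_. sup_on K"]
  obtain \<epsilon> where \<epsilon>: "\<epsilon> > 0"
    "\<And>f. f \<in> Cc X \<Longrightarrow> supported_in K f \<Longrightarrow> sup_on K f < \<epsilon> \<Longrightarrow> \<bar>\<mu> f\<bar> < 1"
    using K by auto
  have "\<bar>\<mu> f\<bar> \<le> 2 / \<epsilon> * a" if f: "a > 0" "f \<in> Cc X" "supported_in K f" "\<forall>u. \<bar>f u\<bar> \<le> a" for f a
  proof -
    define c where "c = \<epsilon> / (2 * a)"
    have c: "c > 0"
      using \<epsilon>(1) f(1) by (simp add: c_def)
    have "\<bar>c * f u\<bar> \<le> \<epsilon> / 2" for u
      using mult_left_mono[OF f(4)[rule_format, of u] less_imp_le[OF c]] c f(1) \<epsilon>(1)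
      by (simp add: abs_mult c_def)
    then have "sup_on K (\<lambda>u. c * f u) \<le> \<epsilon> / 2"
      using \<epsilon>(1) cSUP_least[of K "\<lambda>u. \<bar>c * f u\<bar>" "\<epsilon> / 2"] by (auto simp: sup_on_def)
    then have "\<bar>\<mu> (\<lambda>u. c * f u)\<bar> < 1"
      using f \<epsilon>(1) by (intro \<epsilon>(2) Cc_scale) (auto simp: supported_in_def)
    moreover have "\<mu> (\<lambda>u. c * f u) = c * \<mu> f"
      using lin f(2) by (simp add: linear_on_def)
    ultimately have "\<bar>\<mu> f\<bar> < 1 / c"
      using c by (simp add: abs_mult field_simps)
    then show ?thesis
      by (simp add: c_def field_simps)
  qed
  then show ?thesis
    using \<epsilon>(1) by (intro exI[of _ "2 / \<epsilon>"]) auto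
qed

section \<open>Smooth partitions of unity shrinking to the strata\<close>

text \<open>The argument \<open>1 * t + - real k\<close> has the form \<open>a * t + b\<close> of \<open>smooth_real_step\<close>. As \<open>k\<close> grows,
  these functions decrease to the indicator function of \<open>u $ i = \<infinity>\<close>.\<close>

definition near_infty :: "nat \<Rightarrow> 'n \<Rightarrow> 'n::finite point \<Rightarrow> real" where
  "near_infty k i u = extend (\<lambda>t. step (1 * t + - real k)) 1 (u $ i)"

lemma tame_near_infty: "tame (near_infty k i)"
  unfolding near_infty_def by (rule tame_extend[OF smooth_real_step, of "real k + 1"]) (simp add: step_eq_1)

lemma near_infty_bounds: "0 \<le> near_infty k i u" "near_infty k i u \<le> 1"
  by (cases "u $ i"; simp add: near_infty_def step_bounds)+

lemma near_infty_eq_0: "u $ i \<le> ereal (real k) \<Longrightarrow> near_infty k i u = 0"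
  by (cases "u $ i") (auto simp: near_infty_def step_eq_0)

lemma near_infty_eq_1: "ereal (real k + 1) \<le> u $ i \<Longrightarrow> near_infty k i u = 1"
  by (cases "u $ i") (auto simp: near_infty_def step_eq_1)

text \<open>The supports shrink so fast that the next function lives where the previous one equals \<open>1\<close>.
  Monotonicity in \<open>k\<close> and the identity behind \<open>restrict_boundary_small\<close> follow
  from this.\<close>

lemma near_infty_cascade: "k < m \<Longrightarrow> near_infty m i u \<noteq> 0 \<Longrightarrow> near_infty k i u = 1"
proof -
  assume *: "k < m" "near_infty m i u \<noteq> 0"
  then have "ereal (real m) < u $ i"
    using near_infty_eq_0[of u i m] by force
  moreover have "ereal (real k + 1) \<le> ereal (real m)"
    using * by simp
  ultimately show "near_infty k i u = 1"
    by (intro near_infty_eq_1) (meson less_imp_le order_trans)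
qed

lemma near_infty_antimono: "k \<le> m \<Longrightarrow> near_infty m i u \<le> near_infty k i u"
  using near_infty_cascade[of k m i u] near_infty_bounds[of m i u] near_infty_bounds[of k i u]
  by (cases "k = m"; cases "near_infty m i u = 0") auto

text \<open>As \<open>k\<close> grows, \<open>near_infty_all k A\<close> decreases to the indicator function of the points with
  \<open>u $ i = \<infinity>\<close> for all \<open>i \<in> A\<close>, and \<open>near_infty_any k A\<close> to that of the points with \<open>u $ i = \<infinity>\<close> for
  some \<open>i \<in> A\<close>. So \<open>cutoff k L\<close> is a difference of two decreasing sequences and
  converges to the indicator function of the stratum of \<open>L\<close>.\<close>

definition near_infty_all :: "nat \<Rightarrow> 'n set \<Rightarrow> 'n::finite point \<Rightarrow> real" where
  "near_infty_all k A u = (\<Prod>i\<in>A. near_infty k i u)"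

definition near_infty_any :: "nat \<Rightarrow> 'n set \<Rightarrow> 'n::finite point \<Rightarrow> real" where
  "near_infty_any k A u = 1 - (\<Prod>i\<in>A. 1 - near_infty k i u)"

definition cutoff :: "nat \<Rightarrow> 'n set \<Rightarrow> 'n::finite point \<Rightarrow> real" where
  "cutoff k L u = near_infty_all k L u * (1 - near_infty_any k (- L) u)"

lemma tame_near_infty_all: "tame (near_infty_all k A)"
  unfolding near_infty_all_def by (intro tame_prod tame_near_infty)

lemma tame_near_infty_any: "tame (near_infty_any k A)"
  unfolding near_infty_any_def by (intro tame_diff tame_const tame_prod tame_near_infty)

lemma tame_cutoff: "tame (cutoff k L)"
  unfolding cutoff_def by (intro tame_mult tame_diff tame_const tame_near_infty_all tame_near_infty_any)

lemma near_infty_all_bounds: "0 \<le> near_infty_all k A u" "near_infty_all k A u \<le> 1"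
  by (auto simp: near_infty_all_def near_infty_bounds intro: prod_nonneg prod_le_1)

lemma near_infty_any_bounds: "0 \<le> near_infty_any k A u" "near_infty_any k A u \<le> 1"
  by (auto simp: near_infty_any_def near_infty_bounds intro: prod_nonneg prod_le_1)

lemma cutoff_bounds: "0 \<le> cutoff k L u" "cutoff k L u \<le> 1"
  by (auto simp: cutoff_def near_infty_all_bounds near_infty_any_bounds intro!: mult_le_one)

lemma near_infty_all_antimono: "k \<le> m \<Longrightarrow> near_infty_all m A u \<le> near_infty_all k A u"
  unfolding near_infty_all_def by (intro prod_mono conjI near_infty_bounds near_infty_antimono)

lemma near_infty_any_antimono: "k \<le> m \<Longrightarrow> near_infty_any m A u \<le> near_infty_any k A u"
  unfolding near_infty_any_def by (intro diff_left_mono prod_mono conjI) (auto simp: near_infty_bounds near_infty_antimono)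

lemma near_infty_any_eq_1:
  assumes "i \<in> A" "near_infty k i u = 1"
  shows "near_infty_any k A u = 1"
proof -
  have "(\<Prod>i\<in>A. 1 - near_infty k i u) = 0"
    using assms by (intro prod_zero) auto
  then show ?thesis
    by (simp add: near_infty_any_def)
qed

lemma near_infty_any_cascade:
  assumes "k < m" "near_infty_any m A u \<noteq> 0"
  shows "near_infty_any k A u = 1"
proof -
  have "\<exists>i\<in>A. near_infty m i u \<noteq> 0"
  proof (rule ccontr)
    assume "\<not> (\<exists>i\<in>A. near_infty m i u \<noteq> 0)"
    then have "(\<Prod>i\<in>A. 1 - near_infty m i u) = 1"
      by (intro prod.neutral) auto
    then show False
      using assms(2) by (simp add: near_infty_any_def)
  qed
  then show ?thesis
    using near_infty_any_eq_1 near_infty_cascade[OF assms(1)] by metis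
qed

lemma cutoff_eq_0_if_finite:
  assumes "i \<in> L" "u $ i \<le> ereal (real k)"
  shows "cutoff k L u = 0"
proof -
  have "(\<Prod>i\<in>L. near_infty k i u) = 0"
    using assms near_infty_eq_0 by (intro prod_zero bexI[of _ i]) auto
  then show ?thesis
    by (simp add: cutoff_def near_infty_all_def)
qed

lemma cutoff_eq_0_if_large: "i \<notin> L \<Longrightarrow> ereal (real k + 1) \<le> u $ i \<Longrightarrow> cutoff k L u = 0"
  unfolding cutoff_def using near_infty_any_eq_1[of i "- L" k u] near_infty_eq_1[of k u i] by auto

text \<open>Expand the product of the factors \<open>near_infty k i u + (1 - near_infty k i u) = 1\<close>.\<close>

lemma sum_cutoff: "(\<Sum>L\<in>UNIV. cutoff k L u) = 1"
proof -
  have "(\<Prod>i\<in>UNIV. near_infty k i u + (1 - near_infty k i u)) =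
      (\<Sum>L\<in>Pow UNIV. (\<Prod>i\<in>L. near_infty k i u) * (\<Prod>i\<in>UNIV - L. 1 - near_infty k i u))"
    by (rule prod_add) simp
  then show ?thesis
    by (simp add: cutoff_def near_infty_all_def near_infty_any_def Compl_eq_Diff_UNIV)
qed

text \<open>The sets \<open>{u. \<exists>i\<in>L. u $ i < k}\<close> form an increasing open cover of \<open>K\<close>.\<close>

lemma bounded_coordinate_on_compact:
  assumes K: "compact K" "\<And>u. u \<in> K \<Longrightarrow> \<exists>i\<in>L. u $ i \<noteq> \<infinity>"
  shows "\<exists>k::nat. \<forall>u\<in>K. \<exists>i\<in>L. u $ i < ereal (real k)"
proof -
  define W where "W k = (\<Union>i\<in>L. (\<lambda>u :: ereal ^ 'a. u $ i) -` {..<ereal (real k)})" for k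
  have "K \<subseteq> (\<Union>k\<in>UNIV. W k)"
  proof
    fix u assume "u \<in> K"
    then obtain i where i: "i \<in> L" "u $ i \<noteq> \<infinity>"
      using K(2) by blast
    then obtain k where "u $ i < ereal (real k)"
      using less_PInf_Ex_of_nat[of "u $ i"] by auto
    then show "u \<in> (\<Union>k\<in>UNIV. W k)"
      using i by (auto simp: W_def)
  qed
  moreover have "open (W k)" for k
    unfolding W_def by (intro open_UN ballI open_vimage_vec_nth) auto
  ultimately obtain D where D: "finite D" "K \<subseteq> (\<Union>k\<in>D. W k)"
    using compactE_image[OF K(1), of UNIV W] by metis
  have "\<exists>i\<in>L. u $ i < ereal (real (\<Sum>D))" if u: "u \<in> K" for u
  proof -
    obtain m i where m: "m \<in> D" "i \<in> L" "u $ i < ereal (real m)"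
      using D(2) u by (auto simp: W_def)
    then have "m \<le> \<Sum>D"
      using member_le_sum[of m D "\<lambda>x. x"] D(1) by simp
    then have "u $ i < ereal (real (\<Sum>D))"
      using m(3) by (meson ereal_less_eq(3) less_le_trans of_nat_mono)
    then show ?thesis
      using m(2) by blast
  qed
  then show ?thesis
    by blast
qed

lemma eventually_cutoff_eq_0:
  assumes K: "compact K" "\<And>u. u \<in> K \<Longrightarrow> \<exists>i\<in>L. u $ i \<noteq> \<infinity>"
  shows "\<exists>k0. \<forall>k\<ge>k0. \<forall>u\<in>K. cutoff k L u = 0"
proof -
  obtain k0 :: nat where k0: "\<And>u. u \<in> K \<Longrightarrow> \<exists>i\<in>L. u $ i < ereal (real k0)"
    using bounded_coordinate_on_compact[OF K] by blast
  have "cutoff k L u = 0" if k: "k \<ge> k0" and u: "u \<in> K" for k u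
  proof -
    obtain i where i: "i \<in> L" "u $ i < ereal (real k0)"
      using k0[OF u] by blast
    have "u $ i \<le> ereal (real k)"
      using i(2) k by (meson ereal_less_eq(3) less_imp_le of_nat_mono order_trans)
    then show ?thesis
      by (rule cutoff_eq_0_if_finite[OF i(1)])
  qed
  then show ?thesis
    by blast
qed

section \<open>Functionals dominated by a positive functional\<close>

lemma eq_0_if_arbitrarily_small:
  fixes x c :: real
  assumes "\<And>\<epsilon>. \<epsilon> > 0 \<Longrightarrow> \<bar>x\<bar> \<le> \<epsilon> * c"
  shows "x = 0"
proof (rule ccontr)
  assume x: "x \<noteq> 0"
  have "\<bar>x\<bar> \<le> c"
    using assms[of 1] by simp
  then have c: "c > 0"
    using x by linarith
  have "\<bar>x\<bar> \<le> \<bar>x\<bar> / (2 * c) * c"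
    using x c by (intro assms) simp
  then show False
    using x c by simp
qed

text \<open>The functional \<open>bnd\<close> is positive; \<open>\<nu>\<close> plays the role of a real measure and \<open>bnd\<close> that of a positive
  measure bounding its total variation.\<close>

locale dominated_functional =
  fixes X :: "'n::finite point set" and \<nu> bnd :: "('n point \<Rightarrow> real) \<Rightarrow> real"
  assumes X: "open X" "X \<subseteq> NSigma"
    and \<nu>_add: "f \<in> test_functions X \<Longrightarrow> g \<in> test_functions X \<Longrightarrow> \<nu> (\<lambda>u. f u + g u) = \<nu> f + \<nu> g"
    and \<nu>_scale: "f \<in> test_functions X \<Longrightarrow> \<nu> (\<lambda>u. c * f u) = c * \<nu> f"
    and bnd_add: "f \<in> test_functions X \<Longrightarrow> g \<in> test_functions X \<Longrightarrow> bnd (\<lambda>u. f u + g u) = bnd f + bnd g"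
    and bnd_scale: "f \<in> test_functions X \<Longrightarrow> bnd (\<lambda>u. c * f u) = c * bnd f"
    and dom: "f \<in> test_functions X \<Longrightarrow> h \<in> test_functions X \<Longrightarrow> (\<And>u. \<bar>f u\<bar> \<le> h u) \<Longrightarrow> \<bar>\<nu> f\<bar> \<le> bnd h"
begin

lemma \<nu>_diff: "f \<in> test_functions X \<Longrightarrow> g \<in> test_functions X \<Longrightarrow> \<nu> (\<lambda>u. f u - g u) = \<nu> f - \<nu> g"
  using \<nu>_add[of f "\<lambda>u. (-1) * g u"] \<nu>_scale[of g "-1"] test_functions_scale[of g X "-1"] by simp

lemma bnd_diff: "f \<in> test_functions X \<Longrightarrow> g \<in> test_functions X \<Longrightarrow> bnd (\<lambda>u. f u - g u) = bnd f - bnd g"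
  using bnd_add[of f "\<lambda>u. (-1) * g u"] bnd_scale[of g "-1"] test_functions_scale[of g X "-1"] by simp

lemma \<nu>_0: "\<nu> (\<lambda>u. 0) = 0"
  using \<nu>_scale[OF test_functions_0, of 0] by simp

lemma bnd_0: "bnd (\<lambda>u. 0) = 0"
  using bnd_scale[OF test_functions_0, of 0] by simp

lemma bnd_nonneg: "h \<in> test_functions X \<Longrightarrow> (\<And>u. 0 \<le> h u) \<Longrightarrow> 0 \<le> bnd h"
  using dom[OF test_functions_0, of h] \<nu>_0 by simp

lemma bnd_mono:
  "f \<in> test_functions X \<Longrightarrow> g \<in> test_functions X \<Longrightarrow> (\<And>u. f u \<le> g u) \<Longrightarrow> bnd f \<le> bnd g"
  using bnd_nonneg[OF test_functions_diff, of g f] bnd_diff[of g f] by simp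

lemma bnd_sum:
  "(\<And>j. j \<in> J \<Longrightarrow> f j \<in> test_functions X) \<Longrightarrow> bnd (\<lambda>u. \<Sum>j\<in>J. f j u) = (\<Sum>j\<in>J. bnd (f j))"
  by (induction J rule: infinite_finite_induct)
    (auto simp: bnd_0 bnd_add test_functions_sum)

lemma \<nu>_sum:
  "(\<And>j. j \<in> J \<Longrightarrow> f j \<in> test_functions X) \<Longrightarrow> \<nu> (\<lambda>u. \<Sum>j\<in>J. f j u) = (\<Sum>j\<in>J. \<nu> (f j))"
  by (induction J rule: infinite_finite_induct)
    (auto simp: \<nu>_0 \<nu>_add test_functions_sum)

lemma dominating_function: "f \<in> test_functions X \<Longrightarrow> \<exists>h\<in>test_functions X. \<forall>u. \<bar>f u\<bar> \<le> h u"
proof -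
  assume f: "f \<in> test_functions X"
  then obtain K where K: "compact K" "K \<subseteq> X" "supported_in K f"
    by (auto simp: test_functions_def)
  have "continuous_on K f"
    using f K(2) X(2) by (intro tame_continuous_on test_functions_tame) auto
  then show ?thesis
    using test_function_dominating[OF X K] by blast
qed

text \<open>If \<open>\<bar>f\<bar> \<le> h\<close>, the values \<open>bnd (\<psi>\<^sub>k h)\<close> decrease and are nonnegative, hence form a Cauchy sequence; and
  \<open>\<bar>\<nu> ((\<psi>\<^sub>k - \<psi>\<^sub>m) f)\<bar> \<le> bnd ((\<psi>\<^sub>k - \<psi>\<^sub>m) h)\<close>. This takes the place of dominated convergence.\<close>

lemma convergent_decreasing:
  assumes \<psi>: "\<And>k. tame (\<psi> k)" "\<And>k u. 0 \<le> \<psi> k u" "\<And>k m u. k \<le> m \<Longrightarrow> \<psi> m u \<le> \<psi> k u"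
    and f: "f \<in> test_functions X"
  shows "convergent (\<lambda>k::nat. \<nu> (\<lambda>u. \<psi> k u * f u))"
proof -
  obtain h where h: "h \<in> test_functions X" "\<And>u. \<bar>f u\<bar> \<le> h u"
    using dominating_function[OF f] by blast
  have h0: "0 \<le> h u" for u
    using h(2)[of u] by linarith
  note \<psi>f = test_functions_mult[OF \<psi>(1) f] and \<psi>h = test_functions_mult[OF \<psi>(1) h(1)]
  define b where "b k = bnd (\<lambda>u. \<psi> k u * h u)" for k
  have b_anti: "b m \<le> b k" if "k \<le> m" for k m
    unfolding b_def using \<psi>(3)[OF that] h0 by (intro bnd_mono \<psi>h mult_right_mono)
  have "0 \<le> b k" for k
    unfolding b_def using \<psi>(2) h0 by (intro bnd_nonneg \<psi>h mult_nonneg_nonneg)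
  then have "convergent b"
    using b_anti by (metis decseq_def decseq_convergent convergent_def)
  then have Cb: "Cauchy b"
    by (rule convergent_Cauchy)
  have est: "\<bar>\<nu> (\<lambda>u. \<psi> k u * f u) - \<nu> (\<lambda>u. \<psi> m u * f u)\<bar> \<le> \<bar>b k - b m\<bar>" if km: "k \<le> m" for k m
  proof -
    have "\<bar>\<nu> (\<lambda>u. \<psi> k u * f u - \<psi> m u * f u)\<bar> \<le> bnd (\<lambda>u. \<psi> k u * h u - \<psi> m u * h u)"
    proof (intro dom test_functions_diff \<psi>f \<psi>h)
      fix u
      have "\<bar>\<psi> k u * f u - \<psi> m u * f u\<bar> = (\<psi> k u - \<psi> m u) * \<bar>f u\<bar>"
        using \<psi>(3)[OF km, of u] by (simp add: left_diff_distrib[symmetric] abs_mult)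
      also have "\<dots> \<le> (\<psi> k u - \<psi> m u) * h u"
        using \<psi>(3)[OF km, of u] h(2)[of u] by (intro mult_left_mono) auto
      finally show "\<bar>\<psi> k u * f u - \<psi> m u * f u\<bar> \<le> \<psi> k u * h u - \<psi> m u * h u"
        by (simp add: left_diff_distrib)
    qed
    then show ?thesis
      using b_anti[OF km] by (simp add: \<nu>_diff bnd_diff \<psi>f \<psi>h b_def)
  qed
  have "Cauchy (\<lambda>k. \<nu> (\<lambda>u. \<psi> k u * f u))"
  proof (rule metric_CauchyI)
    fix e :: real assume "e > 0"
    then obtain M where M: "\<And>m n. m \<ge> M \<Longrightarrow> n \<ge> M \<Longrightarrow> dist (b m) (b n) < e"
      using metric_CauchyD[OF Cb] by blast
    have "\<bar>\<nu> (\<lambda>u. \<psi> m u * f u) - \<nu> (\<lambda>u. \<psi> n u * f u)\<bar> < e" if "m \<ge> M" "n \<ge> M" for m n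
    proof (cases "m \<le> n")
      case True
      then show ?thesis
        using est[OF True] M[OF that] by (simp add: dist_real_def)
    next
      case False
      then show ?thesis
        using est[of n m] M[OF that(2,1)] by (simp add: dist_real_def abs_minus_commute)
    qed
    then show "\<exists>M. \<forall>m\<ge>M. \<forall>n\<ge>M. dist (\<nu> (\<lambda>u. \<psi> m u * f u)) (\<nu> (\<lambda>u. \<psi> n u * f u)) < e"
      by (auto simp: dist_real_def)
  qed
  then show ?thesis
    by (rule Cauchy_convergent)
qed

text \<open>The integral over the stratum of \<open>L\<close>.\<close>

definition restrict :: "'n set \<Rightarrow> ('n point \<Rightarrow> real) \<Rightarrow> real" where
  "restrict L f = lim (\<lambda>k. \<nu> (\<lambda>u. cutoff k L u * f u))"

lemma cutoff_times: "f \<in> test_functions X \<Longrightarrow> (\<lambda>u. cutoff k L u * f u) \<in> test_functions X"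
  by (rule test_functions_mult[OF tame_cutoff])

lemma restrict_LIMSEQ:
  assumes f: "f \<in> test_functions X"
  shows "(\<lambda>k. \<nu> (\<lambda>u. cutoff k L u * f u)) \<longlonglongrightarrow> restrict L f"
proof -
  have "convergent (\<lambda>k. \<nu> (\<lambda>u. near_infty_all k L u * f u))"
    using f by (intro convergent_decreasing tame_near_infty_all near_infty_all_bounds near_infty_all_antimono)
  moreover have "convergent (\<lambda>k. \<nu> (\<lambda>u. near_infty_all k L u * near_infty_any k (- L) u * f u))"
    using f by (intro convergent_decreasing tame_mult tame_near_infty_all tame_near_infty_any mult_nonneg_nonneg
      mult_mono near_infty_all_bounds near_infty_any_bounds near_infty_all_antimono near_infty_any_antimono)
  ultimately have "convergent (\<lambda>k. \<nu> (\<lambda>u. near_infty_all k L u * f u)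
      - \<nu> (\<lambda>u. near_infty_all k L u * near_infty_any k (- L) u * f u))"
    by (rule convergent_diff)
  moreover have "\<nu> (\<lambda>u. cutoff k L u * f u) = \<nu> (\<lambda>u. near_infty_all k L u * f u)
      - \<nu> (\<lambda>u. near_infty_all k L u * near_infty_any k (- L) u * f u)" for k
  proof -
    have "(\<lambda>u. cutoff k L u * f u) = (\<lambda>u. near_infty_all k L u * f u - near_infty_all k L u * near_infty_any k (- L) u * f u)"
      by (simp add: cutoff_def algebra_simps)
    then show ?thesis
      using f test_functions_mult[OF tame_near_infty_all f]
        test_functions_mult[OF tame_mult[OF tame_near_infty_all tame_near_infty_any] f]
      by (simp add: \<nu>_diff)
  qed
  ultimately show ?thesis
    unfolding restrict_def by (simp add: convergent_LIMSEQ_iff)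
qed

lemma restrict_le:
  assumes "f \<in> test_functions X" "h \<in> test_functions X" "\<And>u. \<bar>f u\<bar> \<le> h u"
  shows "\<bar>restrict L f\<bar> \<le> bnd h"
proof (rule LIMSEQ_le_const2[OF tendsto_rabs[OF restrict_LIMSEQ[OF assms(1)]]])
  have "\<bar>\<nu> (\<lambda>u. cutoff k L u * f u)\<bar> \<le> bnd h" for k
  proof (intro dom cutoff_times assms)
    fix u
    have "\<bar>cutoff k L u * f u\<bar> \<le> 1 * h u"
      unfolding abs_mult using cutoff_bounds[of k L u] assms(3)[of u] by (intro mult_mono) auto
    then show "\<bar>cutoff k L u * f u\<bar> \<le> h u"
      by simp
  qed
  then show "\<exists>N. \<forall>k\<ge>N. \<bar>\<nu> (\<lambda>u. cutoff k L u * f u)\<bar> \<le> bnd h"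
    by blast
qed

lemma dominated_restrict: "dominated_functional X (restrict L) bnd"
proof
  fix f g assume fg: "f \<in> test_functions X" "g \<in> test_functions X"
  have "(\<lambda>k. \<nu> (\<lambda>u. cutoff k L u * f u) + \<nu> (\<lambda>u. cutoff k L u * g u)) \<longlonglongrightarrow> restrict L f + restrict L g"
    using fg by (intro tendsto_add restrict_LIMSEQ)
  then have "(\<lambda>k. \<nu> (\<lambda>u. cutoff k L u * (f u + g u))) \<longlonglongrightarrow> restrict L f + restrict L g"
    using fg by (simp add: \<nu>_add[symmetric] cutoff_times distrib_left)
  then show "restrict L (\<lambda>u. f u + g u) = restrict L f + restrict L g"
    unfolding restrict_def by (rule limI)
next
  fix f c assume f: "f \<in> test_functions X"
  have "(\<lambda>k. c * \<nu> (\<lambda>u. cutoff k L u * f u)) \<longlonglongrightarrow> c * restrict L f"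
    using f by (intro tendsto_mult_left restrict_LIMSEQ)
  then have "(\<lambda>k. \<nu> (\<lambda>u. cutoff k L u * (c * f u))) \<longlonglongrightarrow> c * restrict L f"
    using f by (simp add: \<nu>_scale[symmetric] cutoff_times mult.left_commute)
  then show "restrict L (\<lambda>u. c * f u) = c * restrict L f"
    unfolding restrict_def by (rule limI)
qed (use X bnd_add bnd_scale restrict_le in auto)

text \<open>Since \<open>bnd\<close> dominates itself, the results on \<open>\<nu>\<close> apply to \<open>bnd\<close> as well.\<close>

lemma dominated_bnd: "dominated_functional X bnd bnd"
proof
  fix f h assume *: "f \<in> test_functions X" "h \<in> test_functions X" "\<And>u. \<bar>f u\<bar> \<le> h u"
  have "bnd f \<le> bnd h"
    using * by (intro bnd_mono) (auto intro: order_trans[OF abs_ge_self])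
  moreover have "bnd (\<lambda>u. (-1) * f u) \<le> bnd h"
    using * by (intro bnd_mono test_functions_scale) (auto intro: order_trans[OF abs_ge_minus_self])
  ultimately show "\<bar>bnd f\<bar> \<le> bnd h"
    using bnd_scale[OF *(1), of "-1"] by simp
qed (use X bnd_add bnd_scale in auto)

lemma sum_restrict:
  assumes "f \<in> test_functions X"
  shows "(\<Sum>L\<in>UNIV. restrict L f) = \<nu> f"
proof -
  have "(\<lambda>k. \<Sum>L\<in>UNIV. \<nu> (\<lambda>u. cutoff k L u * f u)) \<longlonglongrightarrow> (\<Sum>L\<in>UNIV. restrict L f)"
    using assms by (intro tendsto_sum restrict_LIMSEQ)
  moreover have "(\<Sum>L\<in>UNIV. \<nu> (\<lambda>u. cutoff k L u * f u)) = \<nu> f" for k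
    using assms \<nu>_sum[of UNIV "\<lambda>L u. cutoff k L u * f u"]
    by (simp add: cutoff_times sum_distrib_right[symmetric] sum_cutoff)
  ultimately show ?thesis
    by (simp add: LIMSEQ_const_iff)
qed

section \<open>Extension to continuous functions\<close>

text \<open>The value \<open>r\<close> of an extension of \<open>\<nu>\<close> at \<open>f\<close> has to satisfy all these inequalities. They ask \<open>r\<close> to lie
  in a family of compact intervals, and by density of the test functions they determine \<open>r\<close>.\<close>

definition compatible :: "('n point \<Rightarrow> real) \<Rightarrow> real \<Rightarrow> bool" where
  "compatible f r \<longleftrightarrow> (\<forall>g\<in>test_functions X. \<forall>h\<in>test_functions X.
     (\<forall>u. \<bar>f u - g u\<bar> \<le> h u) \<longrightarrow> \<bar>r - \<nu> g\<bar> \<le> bnd h)"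

lemma compatibleD:
  "compatible f r \<Longrightarrow> g \<in> test_functions X \<Longrightarrow> h \<in> test_functions X \<Longrightarrow>
    (\<And>u. \<bar>f u - g u\<bar> \<le> h u) \<Longrightarrow> \<bar>r - \<nu> g\<bar> \<le> bnd h"
  by (simp add: compatible_def)

text \<open>Any two of the intervals \<open>[\<nu> g - bnd h, \<nu> g + bnd h]\<close> meet, because \<open>\<bar>g - g'\<bar> \<le> h + h'\<close> and \<open>\<nu>\<close> is
  dominated; so the supremum of the left endpoints lies in all of them.\<close>

lemma compatible_exists:
  assumes f: "f \<in> Cc X"
  shows "\<exists>r. compatible f r"
proof -
  define P where "P g h \<longleftrightarrow> g \<in> test_functions X \<and> h \<in> test_functions X \<and> (\<forall>u. \<bar>f u - g u\<bar> \<le> h u)" for g h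
  define S where "S = {\<nu> g - bnd h | g h. P g h}"
  have le: "\<nu> g - bnd h \<le> \<nu> g' + bnd h'" if P: "P g h" "P g' h'" for g h g' h'
  proof -
    have "\<bar>\<nu> (\<lambda>u. g u - g' u)\<bar> \<le> bnd (\<lambda>u. h u + h' u)"
    proof (rule dom)
      fix u
      have "\<bar>f u - g u\<bar> \<le> h u" "\<bar>f u - g' u\<bar> \<le> h' u"
        using P by (auto simp: P_def)
      then show "\<bar>g u - g' u\<bar> \<le> h u + h' u"
        by linarith
    qed (use P in \<open>auto simp: P_def intro: test_functions_diff test_functions_add\<close>)
    then show ?thesis
      using P by (simp add: P_def \<nu>_diff bnd_add)
  qed
  obtain h0 where "h0 \<in> test_functions X"
    "\<forall>\<epsilon>>0. \<exists>g\<in>test_functions X. \<forall>u. \<bar>f u - g u\<bar> \<le> \<epsilon> * h0 u"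
    using test_functions_dense[OF X f] by blast
  then obtain g0 where P0: "P g0 h0"
    unfolding P_def by (metis mult_1 zero_less_one)
  then have ne: "S \<noteq> {}"
    unfolding S_def by blast
  have bdd: "bdd_above S"
    unfolding S_def using le[OF _ P0] by (auto intro!: bdd_aboveI)
  have "compatible f (Sup S)"
    unfolding compatible_def
  proof (intro ballI impI)
    fix g h assume "g \<in> test_functions X" "h \<in> test_functions X" "\<forall>u. \<bar>f u - g u\<bar> \<le> h u"
    then have P: "P g h"
      by (simp add: P_def)
    then have "\<nu> g - bnd h \<le> Sup S"
      by (intro cSup_upper bdd) (auto simp: S_def)
    moreover have "Sup S \<le> \<nu> g + bnd h"
      using le[OF _ P] by (intro cSup_least ne) (auto simp: S_def)
    ultimately show "\<bar>Sup S - \<nu> g\<bar> \<le> bnd h"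
      by linarith
  qed
  then show ?thesis
    by blast
qed

definition extension :: "('n point \<Rightarrow> real) \<Rightarrow> real" where
  "extension f = (SOME r. compatible f r)"

lemma extension_compatible: "f \<in> Cc X \<Longrightarrow> compatible f (extension f)"
  unfolding extension_def by (rule someI_ex[OF compatible_exists])

lemma extension_approx:
  assumes f: "f \<in> Cc X"
  shows "\<exists>h\<in>test_functions X. (\<forall>u. 0 \<le> h u) \<and> (\<forall>\<epsilon>>0. \<exists>g\<in>test_functions X.
    (\<forall>u. \<bar>f u - g u\<bar> \<le> \<epsilon> * h u) \<and> \<bar>extension f - \<nu> g\<bar> \<le> \<epsilon> * bnd h)"
proof -
  obtain h where h: "h \<in> test_functions X" "\<forall>u. 0 \<le> h u"
    "\<forall>\<epsilon>>0. \<exists>g\<in>test_functions X. \<forall>u. \<bar>f u - g u\<bar> \<le> \<epsilon> * h u"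
    using test_functions_dense[OF X f] by blast
  have "\<bar>extension f - \<nu> g\<bar> \<le> \<epsilon> * bnd h"
    if "g \<in> test_functions X" "\<forall>u. \<bar>f u - g u\<bar> \<le> \<epsilon> * h u" for g \<epsilon>
    using extension_compatible[OF f] that h(1) test_functions_scale[OF h(1), of \<epsilon>]
    unfolding compatible_def by (metis bnd_scale)
  then show ?thesis
    using h by meson
qed

lemma extension_eq: "f \<in> test_functions X \<Longrightarrow> extension f = \<nu> f"
  using extension_compatible[OF test_functions_imp_Cc[OF _ X(2)], of f] test_functions_0 bnd_0
  unfolding compatible_def by force

lemma extension_le:
  assumes "f \<in> Cc X" "h \<in> test_functions X" "\<And>u. \<bar>f u\<bar> \<le> h u"
  shows "\<bar>extension f\<bar> \<le> bnd h"
  using extension_compatible[OF assms(1)] assms(2,3) test_functions_0 \<nu>_0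
  unfolding compatible_def by fastforce

text \<open>Both sides are approximated by values of \<open>\<nu>\<close>, which is linear, with an error of arbitrarily small
  \<open>bnd\<close>.\<close>

lemma linear_extension: "linear_on (Cc X) extension"
  unfolding linear_on_def
proof (intro conjI ballI allI)
  fix f f' assume ff: "f \<in> Cc X" "f' \<in> Cc X"
  obtain h where h: "h \<in> test_functions X" "\<forall>\<epsilon>>0. \<exists>g\<in>test_functions X.
    (\<forall>u. \<bar>f u - g u\<bar> \<le> \<epsilon> * h u) \<and> \<bar>extension f - \<nu> g\<bar> \<le> \<epsilon> * bnd h"
    using extension_approx[OF ff(1)] by blast
  obtain h' where h': "h' \<in> test_functions X" "\<forall>\<epsilon>>0. \<exists>g\<in>test_functions X.
    (\<forall>u. \<bar>f' u - g u\<bar> \<le> \<epsilon> * h' u) \<and> \<bar>extension f' - \<nu> g\<bar> \<le> \<epsilon> * bnd h'"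
    using extension_approx[OF ff(2)] by blast
  have "extension (\<lambda>u. f u + f' u) - extension f - extension f' = 0"
  proof (rule eq_0_if_arbitrarily_small)
    fix \<epsilon> :: real assume \<epsilon>: "\<epsilon> > 0"
    obtain g where g: "g \<in> test_functions X" "\<And>u. \<bar>f u - g u\<bar> \<le> \<epsilon> * h u"
      "\<bar>extension f - \<nu> g\<bar> \<le> \<epsilon> * bnd h"
      using h(2) \<epsilon> by blast
    obtain g' where g': "g' \<in> test_functions X" "\<And>u. \<bar>f' u - g' u\<bar> \<le> \<epsilon> * h' u"
      "\<bar>extension f' - \<nu> g'\<bar> \<le> \<epsilon> * bnd h'"
      using h'(2) \<epsilon> by blast
    have "\<bar>(f u + f' u) - (g u + g' u)\<bar> \<le> \<epsilon> * h u + \<epsilon> * h' u" for u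
      using g(2)[of u] g'(2)[of u] by linarith
    then have "\<bar>extension (\<lambda>u. f u + f' u) - \<nu> (\<lambda>u. g u + g' u)\<bar> \<le> bnd (\<lambda>u. \<epsilon> * h u + \<epsilon> * h' u)"
      using ff g(1) g'(1) h(1) h'(1)
      by (intro compatibleD[OF extension_compatible] Cc_add test_functions_add test_functions_scale)
    then have "\<bar>extension (\<lambda>u. f u + f' u) - (\<nu> g + \<nu> g')\<bar> \<le> \<epsilon> * bnd h + \<epsilon> * bnd h'"
      using g g' h h' by (simp add: \<nu>_add bnd_add bnd_scale test_functions_scale)
    then have "\<bar>extension (\<lambda>u. f u + f' u) - extension f - extension f'\<bar>
        \<le> 2 * (\<epsilon> * bnd h) + 2 * (\<epsilon> * bnd h')"
      using g(3) g'(3) by linarith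
    then show "\<bar>extension (\<lambda>u. f u + f' u) - extension f - extension f'\<bar>
        \<le> \<epsilon> * (2 * bnd h + 2 * bnd h')"
      by (simp add: algebra_simps)
  qed
  then show "extension (\<lambda>u. f u + f' u) = extension f + extension f'"
    by simp
next
  fix c and f assume f: "f \<in> Cc X"
  obtain h where h: "h \<in> test_functions X" "\<forall>\<epsilon>>0. \<exists>g\<in>test_functions X.
    (\<forall>u. \<bar>f u - g u\<bar> \<le> \<epsilon> * h u) \<and> \<bar>extension f - \<nu> g\<bar> \<le> \<epsilon> * bnd h"
    using extension_approx[OF f] by blast
  have "extension (\<lambda>u. c * f u) - c * extension f = 0"
  proof (rule eq_0_if_arbitrarily_small)
    fix \<epsilon> :: real assume \<epsilon>: "\<epsilon> > 0"
    obtain g where g: "g \<in> test_functions X" "\<And>u. \<bar>f u - g u\<bar> \<le> \<epsilon> * h u"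
      "\<bar>extension f - \<nu> g\<bar> \<le> \<epsilon> * bnd h"
      using h(2) \<epsilon> by blast
    have "\<bar>c * f u - c * g u\<bar> \<le> (\<bar>c\<bar> * \<epsilon>) * h u" for u
      using mult_left_mono[OF g(2)[of u] abs_ge_zero[of c]]
      by (simp add: abs_mult right_diff_distrib[symmetric] mult.assoc)
    then have "\<bar>extension (\<lambda>u. c * f u) - \<nu> (\<lambda>u. c * g u)\<bar> \<le> bnd (\<lambda>u. (\<bar>c\<bar> * \<epsilon>) * h u)"
      using f g(1) h(1)
      by (intro compatibleD[OF extension_compatible] Cc_scale test_functions_scale)
    then have "\<bar>extension (\<lambda>u. c * f u) - c * \<nu> g\<bar> \<le> \<bar>c\<bar> * \<epsilon> * bnd h"
      using g h by (simp add: \<nu>_scale bnd_scale)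
    moreover have "\<bar>c * extension f - c * \<nu> g\<bar> \<le> \<bar>c\<bar> * \<epsilon> * bnd h"
      using mult_left_mono[OF g(3) abs_ge_zero[of c]]
      by (simp add: abs_mult right_diff_distrib[symmetric] mult.assoc)
    ultimately have "\<bar>extension (\<lambda>u. c * f u) - c * extension f\<bar> \<le> 2 * (\<bar>c\<bar> * \<epsilon> * bnd h)"
      by linarith
    then show "\<bar>extension (\<lambda>u. c * f u) - c * extension f\<bar> \<le> \<epsilon> * (2 * \<bar>c\<bar> * bnd h)"
      by (simp add: mult_ac)
  qed
  then show "extension (\<lambda>u. c *\<^sub>R f u) = c * extension f"
    by simp
qed

lemma real_radon_measure_extension: "real_radon_measure X extension"
proof (rule real_radon_measureI[OF linear_extension])
  fix K assume K: "compact K" "K \<subseteq> X"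
  obtain h where h: "h \<in> test_functions X" "\<And>u. 0 \<le> h u" "\<And>u. u \<in> K \<Longrightarrow> 1 \<le> h u"
    using test_function_ge_1_on_compact[OF X K] by blast
  have "\<bar>extension f\<bar> \<le> bnd h * sup_on K f" if f: "f \<in> Cc X" "supported_in K f" for f
  proof -
    have c: "continuous_on K f"
      using f(1) K(2) by (auto simp: Cc_def intro: continuous_on_subset)
    have "\<bar>f u\<bar> \<le> sup_on K f * h u" for u
    proof (cases "u \<in> K")
      case True
      have "\<bar>f u\<bar> \<le> sup_on K f * 1"
        using sup_on_upper[OF K(1) c True] by simp
      also have "\<dots> \<le> sup_on K f * h u"
        using sup_on_nonneg[OF K(1) c] h(3)[OF True] by (intro mult_left_mono)
      finally show ?thesis .
    next
      case False
      then show ?thesis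
        using f(2) sup_on_nonneg[OF K(1) c] h(2) by (simp add: supported_in_def)
    qed
    then have "\<bar>extension f\<bar> \<le> bnd (\<lambda>u. sup_on K f * h u)"
      by (intro extension_le f test_functions_scale h)
    then show ?thesis
      unfolding bnd_scale[OF h(1)] by (simp only: mult.commute)
  qed
  then show "\<exists>C\<ge>0. \<forall>f\<in>Cc X. supported_in K f \<longrightarrow> \<bar>extension f\<bar> \<le> C * sup_on K f"
    using bnd_nonneg[OF h(1,2)] by blast
qed

end

section \<open>Measures concentrated on a stratum\<close>

text \<open>A countable family whose superlevel sets cover \<open>X\<close> replaces an exhaustion by compact sets: the
  measures considered may be infinite on \<open>X\<close>, so an error \<open>\<epsilon>\<close> has to be distributed over countably
  many pieces.\<close>

lemma countable_test_functions:
  fixes X :: "'n::finite point set"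
  assumes X: "open X" "X \<subseteq> NSigma"
  shows "\<exists>H :: nat \<Rightarrow> 'n point \<Rightarrow> real. (\<forall>j. H j \<in> test_functions X \<and> (\<forall>u. 0 \<le> H j u)) \<and>
    (\<forall>x\<in>X. \<exists>j. 1 < H j x)"
proof (cases "X = {}")
  case True
  then show ?thesis
    by (intro exI[of _ "\<lambda>j u. 0"]) (simp add: test_functions_0)
next
  case False
  have "\<forall>x\<in>X. \<exists>h. h \<in> test_functions X \<and> (\<forall>u. 0 \<le> h u) \<and> h x = 1"
    using test_function_at[OF X] by blast
  from bchoice[OF this] obtain h where h: "\<And>x. x \<in> X \<Longrightarrow> h x \<in> test_functions X"
    "\<And>x u. x \<in> X \<Longrightarrow> 0 \<le> h x u" "\<And>x. x \<in> X \<Longrightarrow> h x x = 1"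
    by blast
  define W where "W x = {u \<in> NSigma. 1 / 2 < h x u}" for x
  have "open (W x) \<and> x \<in> W x" if "x \<in> X" for x
  proof
    show "open (W x)"
      unfolding W_def using h(1)[OF that] by (intro open_tame_greater test_functions_tame)
    show "x \<in> W x"
      using X(2) h(3)[OF that] that by (auto simp: W_def)
  qed
  then obtain D where D: "D \<subseteq> X" "countable D" "X \<subseteq> (\<Union>x\<in>D. W x)"
    using vec_Lindelof[of X W] by blast
  have "D \<noteq> {}"
    using D(3) False by auto
  then have range: "range (from_nat_into D) = D"
    using D(2) by (rule range_from_nat_into)
  have in_X: "from_nat_into D j \<in> X" for j
    using range D(1) by blast
  define H where "H j u = 2 * h (from_nat_into D j) u" for j u
  have "H j \<in> test_functions X" for j
    unfolding H_def by (intro test_functions_scale h(1) in_X)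
  moreover have "0 \<le> H j u" for j u
    unfolding H_def using h(2)[OF in_X] by simp
  moreover have "\<exists>j. 1 < H j x" if "x \<in> X" for x
  proof -
    obtain d where "d \<in> D" "x \<in> W d"
      using D(3) \<open>x \<in> X\<close> by blast
    moreover then obtain j where "d = from_nat_into D j"
      using range by blast
    ultimately show ?thesis
      by (auto simp: W_def H_def intro!: exI[of _ j])
  qed
  ultimately show ?thesis
    by blast
qed

context dominated_functional
begin

text \<open>The restriction to the stratum of \<open>L\<close> gives little mass to the neighborhood of the closed set
  \<open>{u. \<exists>i\<in>- L. u $ i = \<infinity>}\<close> on which \<open>near_infty_any m (- L)\<close> is nonzero. For \<open>m < k\<close> the mass is a
  difference of the values \<open>bnd (near_infty_all k L \<cdot> near_infty_any j (- L) \<cdot> h)\<close> at \<open>j = m\<close> and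
  \<open>j = k\<close>, and it is bounded by a difference of two terms of a convergent sequence.\<close>

lemma restrict_boundary_small:
  assumes h: "h \<in> test_functions X" "\<And>u. 0 \<le> h u" and \<delta>: "\<delta> > 0"
  shows "\<exists>m. \<forall>k>m. bnd (\<lambda>u. cutoff k L u * (near_infty_any m (- L) u * h u)) \<le> \<delta>"
proof -
  define b where "b k = bnd (\<lambda>u. near_infty_all k L u * near_infty_any k (- L) u * h u)" for k
  have "convergent b"
    unfolding b_def
    by (intro dominated_functional.convergent_decreasing[OF dominated_bnd] h tame_mult tame_near_infty_all
      tame_near_infty_any mult_nonneg_nonneg mult_mono near_infty_all_bounds near_infty_any_bounds near_infty_all_antimono near_infty_any_antimono)
  then obtain m where m: "\<And>k. k \<ge> m \<Longrightarrow> dist (b m) (b k) < \<delta>"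
    using metric_CauchyD[OF convergent_Cauchy \<delta>] by blast
  have t: "(\<lambda>u. near_infty_all k L u * near_infty_any m (- L) u * h u) \<in> test_functions X" for k m
    by (intro test_functions_mult tame_mult tame_near_infty_all tame_near_infty_any h)
  have "bnd (\<lambda>u. cutoff k L u * (near_infty_any m (- L) u * h u)) \<le> \<delta>" if k: "k > m" for k
  proof -
    \<comment> \<open>where \<open>near_infty_any k\<close> does not vanish, \<open>near_infty_any m\<close> equals \<open>1\<close>\<close>
    have "(1 - near_infty_any k (- L) u) * near_infty_any m (- L) u = near_infty_any m (- L) u - near_infty_any k (- L) u" for u
      using near_infty_any_cascade[OF k, of "- L" u] by (cases "near_infty_any k (- L) u = 0") auto
    then have "(\<lambda>u. cutoff k L u * (near_infty_any m (- L) u * h u)) =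
        (\<lambda>u. near_infty_all k L u * near_infty_any m (- L) u * h u - near_infty_all k L u * near_infty_any k (- L) u * h u)"
      unfolding cutoff_def fun_eq_iff
      by (metis (no_types, opaque_lifting) left_diff_distrib mult.assoc right_diff_distrib)
    then have "bnd (\<lambda>u. cutoff k L u * (near_infty_any m (- L) u * h u)) =
        bnd (\<lambda>u. near_infty_all k L u * near_infty_any m (- L) u * h u) - b k"
      by (simp add: bnd_diff t b_def)
    also have "bnd (\<lambda>u. near_infty_all k L u * near_infty_any m (- L) u * h u) \<le> b m"
      unfolding b_def using k h(2)
      by (intro bnd_mono t mult_right_mono near_infty_all_antimono near_infty_any_bounds) auto
    finally show ?thesis
      using m[of k] k by (simp add: dist_real_def)
  qed
  then show ?thesis
    by blast
qed

text \<open>The complement of the stratum consists of the points with \<open>u $ i \<noteq> \<infinity>\<close> for some \<open>i \<in> L\<close>, which form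
  an open set \<open>V0\<close> on which the restriction vanishes, and of the points with \<open>u $ i = \<infinity>\<close> for some
  \<open>i \<notin> L\<close>. The latter are covered by the sets \<open>V1 j\<close>, thin enough for \<open>restrict_boundary_small\<close> to make
  their mass at most a geometrically small multiple of \<open>\<epsilon>\<close>. Domination makes a partition of unity
  unnecessary: a bounded test function supported in \<open>V0 \<union> (\<Union>j. V1 j)\<close> is, after multiplication with
  \<open>cutoff k L\<close> for large \<open>k\<close>, bounded by a multiple of the sum of the functions that
  \<open>restrict_boundary_small\<close> provides for finitely many \<open>j\<close>.\<close>

lemma null_set_restrict:
  assumes \<mu>: "real_radon_measure X \<mu>" and ext: "\<And>f. f \<in> test_functions X \<Longrightarrow> \<mu> f = restrict L f"
  shows "radon_null_set X \<mu> (X - stratum L)"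
proof -
  obtain H :: "nat \<Rightarrow> 'n point \<Rightarrow> real" where H: "\<And>j. H j \<in> test_functions X" "\<And>j u. 0 \<le> H j u"
    "\<And>x. x \<in> X \<Longrightarrow> \<exists>j. 1 < H j x"
    using countable_test_functions[OF X] by blast
  have small: "\<exists>V. openin (top_of_set X) V \<and> X - stratum L \<subseteq> V \<and>
      (\<forall>f\<in>Cc V. (\<forall>u. \<bar>f u\<bar> \<le> 1) \<longrightarrow> \<bar>\<mu> f\<bar> \<le> 3 * \<epsilon>)" if \<epsilon>: "\<epsilon> > 0" for \<epsilon>
  proof -
    have "\<forall>j. \<exists>m. \<forall>k>m. bnd (\<lambda>u. cutoff k L u * (near_infty_any m (- L) u * H j u)) \<le> \<epsilon> * (1 / 2) ^ Suc j"
      using \<epsilon> by (intro allI restrict_boundary_small H) simp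
    from choice[OF this] obtain m where
      m: "\<And>j k. k > m j \<Longrightarrow> bnd (\<lambda>u. cutoff k L u * (near_infty_any (m j) (- L) u * H j u)) \<le> \<epsilon> * (1 / 2) ^ Suc j"
      by blast
    define V0 where "V0 = X \<inter> (\<Union>i\<in>L. (\<lambda>u. u $ i) -` {..<\<infinity>})"
    define V1 where "V1 j = X \<inter> ({u \<in> NSigma. 1 < H j u} \<inter>
      (\<Union>i\<in>- L. (\<lambda>u. u $ i) -` {ereal (real (m j) + 1)<..}))" for j
    define V where "V = V0 \<union> (\<Union>j. V1 j)"
    have o0: "open V0" and o1: "open (V1 j)" for j
      unfolding V0_def V1_def
      by (intro open_Int X open_UN ballI open_vimage_vec_nth open_lessThan open_greaterThan
        open_tame_greater test_functions_tame[OF H(1)])+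
    have "open V"
      unfolding V_def using o0 o1 by (intro open_Un open_UN) auto
    moreover have "V \<subseteq> X"
      by (auto simp: V_def V0_def V1_def)
    ultimately have V: "open V" "V \<subseteq> X" "V \<subseteq> NSigma"
      using X(2) by auto
    have cover: "X - stratum L \<subseteq> V"
    proof
      fix u assume u: "u \<in> X - stratum L"
      show "u \<in> V"
      proof (cases "\<exists>i\<in>L. u $ i \<noteq> \<infinity>")
        case True
        then have "u \<in> V0"
          using u by (auto simp: V0_def less_top[symmetric] top_ereal_def)
        then show ?thesis
          by (simp add: V_def)
      next
        case False
        then obtain i where i: "i \<notin> L" "u $ i = \<infinity>"
          using u X(2) by (auto simp: stratum_def)
        obtain j where "1 < H j u"
          using H(3) u by blast
        then have "u \<in> V1 j"
          using u i X(2) by (auto simp: V1_def intro!: bexI[of _ i])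
        then show ?thesis
          by (auto simp: V_def)
      qed
    qed
    have smooth: "\<bar>\<mu> g\<bar> \<le> 2 * \<epsilon>" if g: "g \<in> test_functions V" "\<And>u. \<bar>g u\<bar> \<le> 2" for g
    proof -
      have gX: "g \<in> test_functions X"
        using g(1) V(2) test_functions_mono by blast
      obtain K where K: "compact K" "K \<subseteq> V" "supported_in K g"
        using g(1) by (auto simp: test_functions_def)
      have "K \<subseteq> (\<Union>j\<in>UNIV. V0 \<union> V1 j)"
        using K(2) by (auto simp: V_def)
      moreover have "open (V0 \<union> V1 j)" for j
        using o0 o1 by auto
      ultimately obtain D where D: "finite D" "K \<subseteq> (\<Union>j\<in>D. V0 \<union> V1 j)"
        using compactE_image[OF K(1), of UNIV "\<lambda>j. V0 \<union> V1 j"] by metis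
      \<comment> \<open>the rest of the support lies in \<open>V0\<close>, where the cutoff vanishes for large \<open>k\<close>\<close>
      define K0 where "K0 = K - (\<Union>j\<in>D. V1 j)"
      have "compact K0"
        unfolding K0_def using o1 by (intro compact_diff K(1)) auto
      moreover have "\<exists>i\<in>L. u $ i \<noteq> \<infinity>" if "u \<in> K0" for u
      proof -
        have "u \<in> V0"
          using \<open>u \<in> K0\<close> D(2) unfolding K0_def by blast
        then show ?thesis
          by (auto simp: V0_def)
      qed
      ultimately obtain k0 where k0: "\<And>k u. k \<ge> k0 \<Longrightarrow> u \<in> K0 \<Longrightarrow> cutoff k L u = 0"
        using eventually_cutoff_eq_0 by metis
      define N where "N = k0 + (\<Sum>j\<in>D. Suc (m j))"
      have "\<bar>\<nu> (\<lambda>u. cutoff k L u * g u)\<bar> \<le> 2 * \<epsilon>" if k: "k \<ge> N" for k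
      proof -
        have km: "k > m j" if "j \<in> D" for j
          using member_le_sum[of j D "\<lambda>j. Suc (m j)"] D(1) that k by (simp add: N_def)
        define f where "f j u = cutoff k L u * (near_infty_any (m j) (- L) u * H j u)" for j u
        have f: "f j \<in> test_functions X" "0 \<le> f j u" for j u
          unfolding f_def using H
          by (auto intro!: cutoff_times test_functions_mult tame_near_infty_any mult_nonneg_nonneg cutoff_bounds near_infty_any_bounds)
        have "\<bar>\<nu> (\<lambda>u. cutoff k L u * g u)\<bar> \<le> bnd (\<lambda>u. 2 * (\<Sum>j\<in>D. f j u))"
        proof (intro dom cutoff_times gX test_functions_scale test_functions_sum f)
          fix u
          have nn: "0 \<le> 2 * (\<Sum>j\<in>D. f j u)"
            using f(2) by (simp add: sum_nonneg)
          consider "u \<notin> K" | "u \<in> K0" | j where "j \<in> D" "u \<in> V1 j"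
            by (auto simp: K0_def)
          then show "\<bar>cutoff k L u * g u\<bar> \<le> 2 * (\<Sum>j\<in>D. f j u)"
          proof cases
            case 1
            then show ?thesis
              using K(3) nn by (simp add: supported_in_def)
          next
            case 2
            then show ?thesis
              using k0[of k u] k nn by (simp add: N_def)
          next
            case 3
            then obtain i where i: "i \<notin> L" "ereal (real (m j) + 1) < u $ i" and h: "1 < H j u"
              by (auto simp: V1_def)
            have "near_infty_any (m j) (- L) u = 1"
              using i by (intro near_infty_any_eq_1[of i] near_infty_eq_1) auto
            then have "cutoff k L u * 1 \<le> f j u"
              unfolding f_def using h cutoff_bounds[of k L u] by (intro mult_left_mono) auto
            also have "f j u \<le> (\<Sum>j\<in>D. f j u)"
              using 3(1) D(1) f(2) by (intro member_le_sum) auto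
            finally have "cutoff k L u \<le> (\<Sum>j\<in>D. f j u)"
              by simp
            moreover have "\<bar>cutoff k L u * g u\<bar> \<le> cutoff k L u * 2"
              unfolding abs_mult using cutoff_bounds[of k L u] g(2)[of u] by (intro mult_mono) auto
            ultimately show ?thesis
              by linarith
          qed
        qed
        also have "\<dots> = 2 * (\<Sum>j\<in>D. bnd (f j))"
          using f(1) by (simp add: bnd_scale bnd_sum test_functions_sum)
        also have "(\<Sum>j\<in>D. bnd (f j)) \<le> (\<Sum>j\<in>D. \<epsilon> * (1 / 2) ^ Suc j)"
          unfolding f_def using m km by (intro sum_mono) auto
        also have "\<dots> = \<epsilon> * (\<Sum>j\<in>D. (1 / 2) ^ Suc j)"
          by (simp only: sum_distrib_left)
        also have "\<dots> \<le> \<epsilon> * 1"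
        proof (rule mult_left_mono)
          have "(\<Sum>j\<in>D. (1 / 2) ^ Suc j) \<le> (\<Sum>j. (1 / 2 :: real) ^ Suc j)"
            using D(1) sums_summable[OF power_half_series] by (intro sum_le_suminf) auto
          then show "(\<Sum>j\<in>D. (1 / 2) ^ Suc j) \<le> (1 :: real)"
            using sums_unique[OF power_half_series] by simp
        qed (use \<epsilon> in simp)
        finally show ?thesis
          by simp
      qed
      then have "\<bar>restrict L g\<bar> \<le> 2 * \<epsilon>"
        by (intro LIMSEQ_le_const2[OF tendsto_rabs[OF restrict_LIMSEQ[OF gX]]]) blast
      then show ?thesis
        by (simp add: ext gX)
    qed
    \<comment> \<open>the bound \<open>2\<close> above leaves room for replacing \<open>f\<close> by a test function on \<open>V\<close>\<close>
    have "\<bar>\<mu> f\<bar> \<le> 3 * \<epsilon>" if f: "f \<in> Cc V" "\<forall>u. \<bar>f u\<bar> \<le> 1" for f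
    proof -
      obtain h where h: "h \<in> test_functions V" "\<And>u. 0 \<le> h u"
        "\<And>\<eta>. \<eta> > 0 \<Longrightarrow> \<exists>g\<in>test_functions V. \<forall>u. \<bar>f u - g u\<bar> \<le> \<eta> * h u"
        using test_functions_dense[OF V(1,3) f(1)] by blast
      obtain K where K: "compact K" "K \<subseteq> V" "supported_in K h"
        using h(1) by (auto simp: test_functions_def)
      obtain C where C: "C \<ge> 0" "\<And>a f. a > 0 \<Longrightarrow> f \<in> Cc X \<Longrightarrow> supported_in K f \<Longrightarrow>
          (\<forall>u. \<bar>f u\<bar> \<le> a) \<Longrightarrow> \<bar>\<mu> f\<bar> \<le> C * a"
        using real_radon_measure_bound[OF \<mu> K(1)] K(2) V(2) by blast
      obtain B where B: "B > 0" "\<And>u. \<bar>h u\<bar> \<le> B"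
        using test_function_bounded[OF h(1) V(3)] by blast
      define a where "a = min 1 (\<epsilon> / (C + 1))"
      have a: "a > 0" "a \<le> 1"
        using \<epsilon> C(1) by (auto simp: a_def)
      obtain g where g: "g \<in> test_functions V" "\<And>u. \<bar>f u - g u\<bar> \<le> a / B * h u"
        using h(3)[of "a / B"] a B by auto
      have fg: "\<bar>f u - g u\<bar> \<le> a \<and> (u \<notin> K \<longrightarrow> f u - g u = 0)" for u
      proof (cases "u \<in> K")
        case True
        have "a / B * h u \<le> a / B * B"
          using B(2)[of u] a B(1) by (intro mult_left_mono) auto
        then show ?thesis
          using g(2)[of u] B(1) True by simp
      next
        case False
        then show ?thesis
          using g(2)[of u] K(3) a by (simp add: supported_in_def)
      qed
      have "\<bar>g u\<bar> \<le> 2" for u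
        using fg[of u] f(2)[rule_format, of u] a(2) by linarith
      then have "\<bar>\<mu> g\<bar> \<le> 2 * \<epsilon>"
        using g(1) by (intro smooth)
      moreover have "f \<in> Cc X" "g \<in> Cc X"
        using Cc_mono[OF V(1,2)] f(1) test_functions_imp_Cc[OF g(1) V(3)] by auto
      then have "(\<lambda>u. f u - g u) \<in> Cc X" "\<mu> (\<lambda>u. f u - g u) = \<mu> f - \<mu> g"
        using linear_on_combination[of "Cc X" \<mu> f g 1 "-1"] \<mu> Cc_scale[of g X "-1"]
          Cc_add[of f X "\<lambda>u. (-1) * g u"]
        by (simp_all add: real_radon_measure_def Cc_scale)
      moreover from this(1) have "\<bar>\<mu> (\<lambda>u. f u - g u)\<bar> \<le> C * a"
        using fg by (intro C(2) a(1)) (auto simp: supported_in_def)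
      moreover have "C * a \<le> \<epsilon>"
      proof -
        have "C * a \<le> C * (\<epsilon> / (C + 1))"
          using C(1) by (intro mult_left_mono) (auto simp: a_def)
        also have "\<dots> \<le> \<epsilon>"
          using C(1) \<epsilon> by (simp add: field_simps)
        finally show ?thesis .
      qed
      ultimately show ?thesis
        by linarith
    qed
    then show ?thesis
      using V cover by (intro exI[of _ V]) (auto simp: openin_open_eq X)
  qed
  have "total_variation X \<mu> (X - stratum L) \<le> 0"
  proof (rule ennreal_le_epsilon)
    fix e :: real assume e: "e > 0"
    obtain V where V: "openin (top_of_set X) V" "X - stratum L \<subseteq> V"
      "\<And>f. f \<in> Cc V \<Longrightarrow> (\<forall>u. \<bar>f u\<bar> \<le> 1) \<Longrightarrow> \<bar>\<mu> f\<bar> \<le> 3 * (e / 3)"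
      using small[of "e / 3"] e by auto
    have "(SUP f\<in>{f \<in> Cc V. \<forall>u. \<bar>f u\<bar> \<le> 1}. ennreal \<bar>\<mu> f\<bar>) \<le> ennreal e"
      using V(3) by (intro SUP_least ennreal_leI) auto
    then show "total_variation X \<mu> (X - stratum L) \<le> 0 + ennreal e"
      unfolding total_variation_def using V(1,2) by (intro INF_lower2[of V]) auto
  qed
  then show ?thesis
    by (simp add: radon_null_set_def)
qed

end

lemma radon_null_setD:
  assumes "radon_null_set X \<mu> A" "\<epsilon> > 0"
  shows "\<exists>V. openin (top_of_set X) V \<and> A \<subseteq> V \<and> (\<forall>f\<in>Cc V. (\<forall>u. \<bar>f u\<bar> \<le> 1) \<longrightarrow> \<bar>\<mu> f\<bar> \<le> \<epsilon>)"
proof -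
  have "total_variation X \<mu> A < ennreal \<epsilon>"
    using assms by (simp add: radon_null_set_def)
  then obtain V where V: "openin (top_of_set X) V" "A \<subseteq> V"
    "(SUP f\<in>{f \<in> Cc V. \<forall>u. \<bar>f u\<bar> \<le> 1}. ennreal \<bar>\<mu> f\<bar>) < ennreal \<epsilon>"
    unfolding total_variation_def INF_less_iff by blast
  have "\<bar>\<mu> f\<bar> \<le> \<epsilon>" if "f \<in> Cc V" "\<forall>u. \<bar>f u\<bar> \<le> 1" for f
  proof -
    have "ennreal \<bar>\<mu> f\<bar> \<le> (SUP f\<in>{f \<in> Cc V. \<forall>u. \<bar>f u\<bar> \<le> 1}. ennreal \<bar>\<mu> f\<bar>)"
      using that by (intro SUP_upper) auto
    then have "ennreal \<bar>\<mu> f\<bar> \<le> ennreal \<epsilon>"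
      using V(3) by simp
    then show ?thesis
      using assms(2) by (simp add: ennreal_le_iff)
  qed
  then show ?thesis
    using V by blast
qed

text \<open>The complement of the stratum of \<open>L\<close> has a neighborhood \<open>V\<close> of small mass, and for large \<open>k\<close> the function
  \<open>cutoff k L' \<cdot> f\<close> is supported in \<open>V\<close>. There are two cases. If some \<open>i \<in> L\<close> is
  not in \<open>L'\<close>, the cutoff bounds \<open>u $ i\<close> on the support, which thereby misses the stratum. If some
  \<open>i \<in> L'\<close> is not in \<open>L\<close>, the cutoff forces \<open>u $ i\<close> to be large, and the part of the support of
  \<open>f\<close> outside \<open>V\<close>, being compact and finite in the coordinate \<open>i\<close>, is avoided eventually.\<close>

lemma cutoff_limit_other_stratum:
  fixes X :: "'n::finite point set"
  assumes X: "open X" "X \<subseteq> NSigma" and lin: "linear_on (Cc X) \<mu>"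
    and null: "radon_null_set X \<mu> (X - stratum L)" and f: "f \<in> test_functions X" and L': "L' \<noteq> L"
  shows "(\<lambda>k. \<mu> (\<lambda>u. cutoff k L' u * f u)) \<longlonglongrightarrow> 0"
proof (rule LIMSEQ_I)
  fix r :: real assume r: "r > 0"
  obtain K where K: "compact K" "K \<subseteq> X" "supported_in K f"
    using f by (auto simp: test_functions_def)
  obtain B where B: "B > 0" "\<And>u. \<bar>f u\<bar> \<le> B"
    using test_function_bounded[OF f X(2)] by blast
  obtain V where V: "openin (top_of_set X) V" "X - stratum L \<subseteq> V"
    "\<And>f. f \<in> Cc V \<Longrightarrow> (\<forall>u. \<bar>f u\<bar> \<le> 1) \<Longrightarrow> \<bar>\<mu> f\<bar> \<le> r / (2 * B)"
    using radon_null_setD[OF null, of "r / (2 * B)"] r B(1) by auto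
  have oV: "open V" "V \<subseteq> X"
    using V(1) X(1) by (auto simp: openin_open_eq)
  \<comment> \<open>for large \<open>k\<close> the support of \<open>cutoff k L' * f\<close> is a compact subset of \<open>V\<close>\<close>
  have "\<exists>k0. \<forall>k\<ge>k0. \<exists>K'. compact K' \<and> K' \<subseteq> V \<and> supported_in K' (\<lambda>u. cutoff k L' u * f u)"
  proof (cases "L' \<subseteq> L")
    case True
    then obtain i where i: "i \<in> L" "i \<notin> L'"
      using L' by blast
    have "\<exists>K'. compact K' \<and> K' \<subseteq> V \<and> supported_in K' (\<lambda>u. cutoff k L' u * f u)" for k
    proof (intro exI conjI)
      define G where "G = (\<lambda>u :: 'n point. u $ i) -` {ereal (real k + 1)<..}"
      have "open G"
        unfolding G_def by (intro open_vimage_vec_nth) auto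
      then show "compact (K - G)"
        by (rule compact_diff[OF K(1)])
      show "K - G \<subseteq> V"
      proof
        fix u assume u: "u \<in> K - G"
        then have "u $ i \<noteq> \<infinity>"
          by (auto simp: G_def)
        then have "u \<notin> stratum L"
          using i(1) stratum_nth(1) by blast
        then show "u \<in> V"
          using u K(2) V(2) by blast
      qed
      show "supported_in (K - G) (\<lambda>u. cutoff k L' u * f u)"
        unfolding supported_in_def
      proof (intro allI impI)
        fix u assume "u \<notin> K - G"
        then consider "u \<notin> K" | "u \<in> G"
          by blast
        then show "cutoff k L' u * f u = 0"
        proof cases
          case 1
          then show ?thesis
            using K(3) by (simp add: supported_in_def)
        next
          case 2
          then have "cutoff k L' u = 0"
            using i(2) by (intro cutoff_eq_0_if_large[of i]) (auto simp: G_def)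
          then show ?thesis
            by simp
        qed
      qed
    qed
    then show ?thesis
      by blast
  next
    case False
    then obtain i where i: "i \<in> L'" "i \<notin> L"
      by blast
    have "\<exists>j\<in>{i}. u $ j \<noteq> \<infinity>" if "u \<in> K - V" for u
      using that i(2) K(2) V(2) stratum_nth(1)[of u L] by (auto simp: stratum_def subset_iff)
    then obtain k0 :: nat where k0: "\<And>u. u \<in> K - V \<Longrightarrow> u $ i < ereal (real k0)"
      using bounded_coordinate_on_compact[OF compact_diff[OF K(1) oV(1)], of "{i}"] by auto
    have "\<exists>K'. compact K' \<and> K' \<subseteq> V \<and> supported_in K' (\<lambda>u. cutoff k L' u * f u)" if k: "k \<ge> k0" for k
    proof (intro exI conjI)
      define G where "G = (\<lambda>u :: 'n point. u $ i) -` {..<ereal (real k0)}"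
      have "open G"
        unfolding G_def by (intro open_vimage_vec_nth) auto
      then show "compact (K - G)"
        by (rule compact_diff[OF K(1)])
      show "K - G \<subseteq> V"
        using k0 by (auto simp: G_def)
      show "supported_in (K - G) (\<lambda>u. cutoff k L' u * f u)"
        unfolding supported_in_def
      proof (intro allI impI)
        fix u assume "u \<notin> K - G"
        then consider "u \<notin> K" | "u \<in> G"
          by blast
        then show "cutoff k L' u * f u = 0"
        proof cases
          case 1
          then show ?thesis
            using K(3) by (simp add: supported_in_def)
        next
          case 2
          then have "u $ i < ereal (real k0)"
            by (simp add: G_def)
          also have "\<dots> \<le> ereal (real k)"
            using k by simp
          finally have "cutoff k L' u = 0"
            using i(1) by (intro cutoff_eq_0_if_finite[of i]) auto
          then show ?thesis
            by simp
        qed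
      qed
    qed
    then show ?thesis
      by blast
  qed
  then obtain k0 where k0: "\<And>k. k \<ge> k0 \<Longrightarrow>
      \<exists>K'. compact K' \<and> K' \<subseteq> V \<and> supported_in K' (\<lambda>u. cutoff k L' u * f u)"
    by blast
  have "\<bar>\<mu> (\<lambda>u. cutoff k L' u * f u)\<bar> < r" if k: "k \<ge> k0" for k
  proof -
    define g where "g u = 1 / B * (cutoff k L' u * f u)" for u
    have fX: "(\<lambda>u. cutoff k L' u * f u) \<in> Cc X"
      using f by (intro test_functions_imp_Cc test_functions_mult tame_cutoff X)
    have "tame g"
      unfolding g_def using f by (intro tame_mult tame_const tame_cutoff test_functions_tame)
    moreover obtain K' where "compact K'" "K' \<subseteq> V" "supported_in K' (\<lambda>u. cutoff k L' u * f u)"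
      using k0[OF k] by blast
    ultimately have "g \<in> test_functions V"
      by (auto simp: test_functions_def supported_in_def g_def)
    then have "g \<in> Cc V"
      using oV(2) X(2) by (intro test_functions_imp_Cc) auto
    moreover have "\<bar>g u\<bar> \<le> 1" for u
    proof -
      have "\<bar>cutoff k L' u * f u\<bar> \<le> 1 * B"
        unfolding abs_mult using cutoff_bounds[of k L' u] B(2)[of u] by (intro mult_mono) auto
      then show ?thesis
        using B(1) by (simp add: g_def field_simps)
    qed
    ultimately have "\<bar>\<mu> g\<bar> \<le> r / (2 * B)"
      using V(3) by blast
    moreover have "\<mu> (\<lambda>u. (1 / B) *\<^sub>R (cutoff k L' u * f u)) = 1 / B * \<mu> (\<lambda>u. cutoff k L' u * f u)"
      using lin[unfolded linear_on_def, THEN conjunct2, rule_format, OF fX, of "1 / B"] .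
    then have "\<mu> g = 1 / B * \<mu> (\<lambda>u. cutoff k L' u * f u)"
      by (simp add: g_def[abs_def])
    ultimately have "\<bar>\<mu> (\<lambda>u. cutoff k L' u * f u)\<bar> \<le> r / 2"
      using B(1) by (simp add: abs_mult field_simps)
    then show ?thesis
      using r by linarith
  qed
  then show "\<exists>no. \<forall>n\<ge>no. norm (\<mu> (\<lambda>u. cutoff n L' u * f u) - 0) < r"
    by auto
qed

text \<open>The cutoffs sum up to \<open>1\<close>, and all the others contribute \<open>0\<close> in the limit.\<close>

lemma cutoff_limit_own_stratum:
  fixes X :: "'n::finite point set"
  assumes X: "open X" "X \<subseteq> NSigma" and lin: "linear_on (Cc X) \<mu>"
    and null: "radon_null_set X \<mu> (X - stratum L)" and f: "f \<in> test_functions X"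
  shows "(\<lambda>k. \<mu> (\<lambda>u. cutoff k L u * f u)) \<longlonglongrightarrow> \<mu> f"
proof -
  have "\<mu> (\<lambda>u. cutoff k L u * f u) = \<mu> f - (\<Sum>L'\<in>- {L}. \<mu> (\<lambda>u. cutoff k L' u * f u))" for k
  proof -
    have "\<mu> (\<lambda>u. \<Sum>L'\<in>UNIV. cutoff k L' u * f u) = (\<Sum>L'\<in>UNIV. \<mu> (\<lambda>u. cutoff k L' u * f u))"
      using linear_on_sum[OF lin Cc_0 Cc_add, of UNIV "\<lambda>L' u. cutoff k L' u * f u"]
        test_functions_imp_Cc[OF test_functions_mult[OF tame_cutoff f] X(2)] by blast
    moreover have "(\<lambda>u. \<Sum>L'\<in>UNIV. cutoff k L' u * f u) = f"
      by (simp add: sum_distrib_right[symmetric] sum_cutoff)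
    moreover have "(\<Sum>L'\<in>UNIV. \<mu> (\<lambda>u. cutoff k L' u * f u)) =
        \<mu> (\<lambda>u. cutoff k L u * f u) + (\<Sum>L'\<in>- {L}. \<mu> (\<lambda>u. cutoff k L' u * f u))"
      by (simp add: sum.remove[of UNIV L] Compl_eq_Diff_UNIV)
    ultimately show ?thesis
      by simp
  qed
  moreover have "(\<lambda>k. \<mu> f - (\<Sum>L'\<in>- {L}. \<mu> (\<lambda>u. cutoff k L' u * f u))) \<longlonglongrightarrow> \<mu> f - (\<Sum>L'\<in>- {L}. 0)"
    using X lin null f by (intro tendsto_diff tendsto_const tendsto_sum cutoff_limit_other_stratum) auto
  ultimately show ?thesis
    by simp
qed

section \<open>Forms and their coefficients\<close>

lemma openin_NSigma_iff: "openin (top_of_set NSigma) U \<longleftrightarrow> open U \<and> U \<subseteq> NSigma"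
  by (simp add: openin_open_eq open_NSigma)

lemma open_minus_E_infty:
  assumes "open U" "U \<subseteq> NSigma"
  shows "open (U - E_infty A)"
proof -
  have "U - E_infty A = U \<inter> (\<Inter>i\<in>A. (\<lambda>u. u $ i) -` {..<\<infinity>})"
    using assms(2) by (auto simp: E_infty_def)
  then show ?thesis
    using assms(1) by (auto intro!: open_Int open_INT open_vimage_vec_nth)
qed

lemma stratum_E_infty: "u \<in> stratum L \<Longrightarrow> u \<in> E_infty A \<longleftrightarrow> A \<inter> L \<noteq> {}"
  by (auto simp: E_infty_def stratum_def)

lemma eventually_pullback:
  assumes "open V" "x \<in> V" "x \<in> stratum L" "pullback_on V L \<omega>"
  shows "\<forall>\<^sub>F u in nhds x. \<omega> u = \<omega> (proj L u) \<and> proj L u \<in> V \<inter> stratum L"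
proof -
  have "\<forall>\<^sub>F u in nhds x. u \<in> V"
    using assms(1,2) by (rule eventually_nhds_in_open)
  moreover have "\<forall>\<^sub>F u in nhds x. proj L u \<in> V"
    using topological_tendstoD[OF tendsto_proj[of L x] assms(1)] assms(2) proj_eq_self[OF assms(3)] by simp
  moreover note eventually_stratum[OF assms(3)]
  ultimately show ?thesis
  proof eventually_elim
    case (elim u)
    then show ?case
      using assms(4) unfolding pullback_on_def by blast
  qed
qed

lemma form_coeff_E_infty:
  assumes "\<omega> \<in> forms a b U" "u \<in> stratum L" "(I \<union> J) \<inter> L \<noteq> {}"
  shows "\<omega> u $ (I, J) = 0"
proof (cases "u \<in> U")
  case True
  then have "\<omega> u \<in> ext_type (- L) a b"
    using assms(1,2) by (auto simp: forms_def)
  then show ?thesis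
    using assms(3) by (auto simp: ext_type_def)
qed (use assms(1) in \<open>simp add: forms_def\<close>)

text \<open>The stratum is covered by its relatively open parts inside \<open>U\<close>, where the form is smooth, and
  outside \<open>K\<close>, where it vanishes.\<close>

lemma form_coeff_smooth:
  assumes U: "open U" and \<omega>: "\<omega> \<in> forms a b U" and K: "compact K" "K \<subseteq> U" "supported_in K \<omega>"
  shows "smooth_on_stratum (stratum L) (\<lambda>u. \<omega> u $ (I, J))"
proof -
  let ?f = "\<lambda>u. \<omega> u $ (I, J)"
  have oK: "open (- K)"
    using K(1) by (simp add: compact_imp_closed open_Compl)
  have 1: "smooth_on_stratum (U \<inter> stratum L) ?f"
    using \<omega> by (simp add: forms_def)
  have "Ck n (- K \<inter> stratum L) ?f" for n
    using K(3) by (intro Ck_cong[OF shift_open_Int_stratum[OF oK] Ck_const[of _ _ 0]])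
      (auto simp: supported_in_def)
  then have 2: "smooth_on_stratum (- K \<inter> stratum L) ?f"
    by (simp add: smooth_on_stratum_iff_Ck shift_open_Int_stratum oK)
  have un: "stratum L = (- K \<inter> stratum L) \<union> (U \<inter> stratum L)"
    using K(2) by auto
  show ?thesis
    unfolding smooth_on_stratum_def
  proof (intro allI conjI ballI)
    fix "is"
    have "openin (top_of_set (stratum L)) (- K \<inter> stratum L)" "openin (top_of_set (stratum L)) (U \<inter> stratum L)"
      using oK U by (auto simp: Int_commute[of _ "stratum L"] intro: openin_open_Int)
    then show "continuous_on (stratum L) (foldr pdiff is ?f)"
      using 1 2 un continuous_on_Un_local_open[of "- K \<inter> stratum L" "U \<inter> stratum L" "foldr pdiff is ?f"]
      by (simp add: smooth_on_stratum_def)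
    show "(\<lambda>t. foldr pdiff is ?f (shift i t u)) differentiable (at 0)" if "u \<in> stratum L" for i u
      using 1 2 un that unfolding smooth_on_stratum_def by blast
  qed
qed

text \<open>The support of the coefficient is the closed part of \<open>K\<close> where it is not locally zero. This misses
  \<open>E_infty (I \<union> J)\<close>, since near a point at infinity the form is pulled back from the stratum of that point,
  on which \<open>d'u\<^sub>i\<close> and \<open>d''u\<^sub>i\<close> vanish.\<close>

lemma form_coeff_test_function:
  assumes U: "open U" "U \<subseteq> NSigma" and \<omega>: "\<omega> \<in> forms_c a b U"
  shows "(\<lambda>u. \<omega> u $ (I, J)) \<in> test_functions (U - E_infty (I \<union> J))"
proof -
  obtain K where K: "compact K" "K \<subseteq> U" "supported_in K \<omega>" and \<omega>': "\<omega> \<in> forms a b U"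
    using \<omega> by (auto simp: forms_c_def)
  have oK: "open (- K)"
    using K(1) by (simp add: compact_imp_closed open_Compl)
  have ev: "\<forall>\<^sub>F u in nhds x. \<omega> u = \<omega> (proj L u) \<and> proj L u \<in> stratum L" if x: "x \<in> stratum L" for x L
  proof (cases "x \<in> U")
    case True
    then obtain V where V: "openin (top_of_set U) V" "x \<in> V" "pullback_on V L \<omega>"
      using \<omega>' x unfolding forms_def by blast
    then have "open V"
      using U(1) by (simp add: openin_open_eq)
    from eventually_pullback[OF this V(2) x V(3)] show ?thesis
      by eventually_elim auto
  next
    case False
    then have "x \<in> - K"
      using K(2) by auto
    then have "\<forall>\<^sub>F u in nhds x. u \<in> - K" "\<forall>\<^sub>F u in nhds x. proj L u \<in> - K"
      using eventually_nhds_in_open[OF oK] topological_tendstoD[OF tendsto_proj[of L x] oK]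
        proj_eq_self[OF x] by simp_all
    then show ?thesis
      using eventually_stratum[OF x]
      by eventually_elim (use K(3) in \<open>auto simp: supported_in_def\<close>)
  qed
  have "tame (\<lambda>u. \<omega> u $ (I, J))"
    unfolding tame_def
  proof (intro conjI allI ballI)
    show "Ck n (stratum L) (\<lambda>u. \<omega> u $ (I, J))" for n L
      using form_coeff_smooth[OF U(1) \<omega>' K] by (simp add: smooth_on_stratum_iff_Ck shift_open_stratum)
    show "\<forall>\<^sub>F u in nhds x. \<omega> u $ (I, J) = \<omega> (proj L u) $ (I, J)" if "x \<in> stratum L" for x L
      using ev[OF that] by eventually_elim auto
  qed
  moreover define G where "G = \<Union>{W. open W \<and> (\<forall>u\<in>W. \<omega> u $ (I, J) = 0)}"
  have "open G"
    unfolding G_def by auto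
  then have "compact (K - G)"
    by (rule compact_diff[OF K(1)])
  moreover have "K - G \<subseteq> U - E_infty (I \<union> J)"
  proof
    fix x assume x: "x \<in> K - G"
    then obtain L where L: "x \<in> stratum L"
      using K(2) U(2) stratum_cover by blast
    have "x \<notin> E_infty (I \<union> J)"
    proof
      assume "x \<in> E_infty (I \<union> J)"
      then have ne: "(I \<union> J) \<inter> L \<noteq> {}"
        using stratum_E_infty[OF L] by blast
      have "\<forall>\<^sub>F u in nhds x. \<omega> u $ (I, J) = 0"
        using ev[OF L]
      proof eventually_elim
        case (elim u)
        then show ?case
          using form_coeff_E_infty[OF \<omega>' _ ne, of "proj L u"] by simp
      qed
      then have "x \<in> G"
        by (auto simp: eventually_nhds G_def)
      then show False
        using x by simp
    qed
    then show "x \<in> U - E_infty (I \<union> J)"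
      using x K(2) by auto
  qed
  moreover have "supported_in (K - G) (\<lambda>u. \<omega> u $ (I, J))"
    using K(3) by (auto simp: supported_in_def G_def)
  ultimately show ?thesis
    unfolding test_functions_def by blast
qed

text \<open>Compactly supported forms are families of test functions on different open sets. All closure
  properties of forms are inherited from test functions through this description.\<close>

lemma forms_c_iff:
  assumes U: "open U" "U \<subseteq> NSigma"
  shows "\<omega> \<in> forms_c a b U \<longleftrightarrow>
    (\<forall>I J. (\<lambda>u. \<omega> u $ (I, J)) \<in> test_functions (U - E_infty (I \<union> J))) \<and>
    (\<forall>I J u. \<omega> u $ (I, J) \<noteq> 0 \<longrightarrow> card I = a \<and> card J = b)"
  (is "_ \<longleftrightarrow> ?coeff \<and> ?type")
proof (intro iffI conjI)
  assume \<omega>: "\<omega> \<in> forms_c a b U"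
  then show ?coeff
    using form_coeff_test_function[OF U] by blast
  show ?type
  proof (intro allI impI)
    fix I J u assume ne: "\<omega> u $ (I, J) \<noteq> 0"
    then have "u \<in> U"
      using \<omega> by (auto simp: forms_c_def forms_def)
    moreover from this have "u \<in> stratum {i. u $ i = \<infinity>}"
      using U(2) stratum_cover by blast
    ultimately have "\<omega> u \<in> ext_type (- {i. u $ i = \<infinity>}) a b"
      using \<omega> unfolding forms_c_def forms_def by blast
    then show "card I = a \<and> card J = b"
      using ne by (auto simp: ext_type_def)
  qed
next
  assume *: "?coeff \<and> ?type"
  then have "\<forall>I J. \<exists>K. compact K \<and> K \<subseteq> U - E_infty (I \<union> J) \<and> supported_in K (\<lambda>u. \<omega> u $ (I, J))"
    and tame: "\<And>I J. tame (\<lambda>u. \<omega> u $ (I, J))"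
    by (auto simp: test_functions_def)
  then obtain K where K: "\<And>I J. compact (K I J)" "\<And>I J. K I J \<subseteq> U - E_infty (I \<union> J)"
    "\<And>I J. supported_in (K I J) (\<lambda>u. \<omega> u $ (I, J))"
    by metis
  define K0 where "K0 = (\<Union>(I, J)\<in>UNIV. K I J)"
  have K0: "compact K0"
    unfolding K0_def using K(1) by (intro compact_UN) auto
  have K0U: "K0 \<subseteq> U"
    unfolding K0_def using K(2) by blast
  have supp: "supported_in K0 \<omega>"
    using K(3) unfolding supported_in_def K0_def vec_eq_iff by force
  have type: "\<omega> u \<in> ext_type (- L) a b" if "u \<in> U \<inter> stratum L" for u L
    unfolding ext_type_def
  proof (intro CollectI allI impI)
    fix I J assume ne: "\<omega> u $ (I, J) \<noteq> 0"
    then have "u \<in> K I J"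
      using K(3) unfolding supported_in_def by blast
    then have "u \<notin> E_infty (I \<union> J)"
      using K(2) by blast
    then have "(I \<union> J) \<inter> L = {}"
      using stratum_E_infty[of u L "I \<union> J"] that by blast
    then show "card I = a \<and> card J = b \<and> I \<subseteq> - L \<and> J \<subseteq> - L"
      using * ne by blast
  qed
  have smooth: "smooth_on_stratum (U \<inter> stratum L) (\<lambda>u. \<omega> u $ (I, J))" for I J L
    using tame_imp_smooth[OF tame] unfolding smooth_on_stratum_def
    by (meson continuous_on_subset inf_le2 subsetD)
  have pullback: "\<exists>V. openin (top_of_set U) V \<and> x \<in> V \<and> pullback_on V L \<omega>" if x: "x \<in> U \<inter> stratum L" for x L
  proof -
    have "\<forall>\<^sub>F u in nhds x. \<forall>IJ. \<omega> u $ IJ = \<omega> (proj L u) $ IJ"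
      using tame x by (intro eventually_all_finite) (auto simp: tame_def)
    then obtain V where V: "open V" "x \<in> V" "\<And>u. u \<in> V \<Longrightarrow> \<omega> u = \<omega> (proj L u)"
      by (auto simp: eventually_nhds vec_eq_iff)
    then show ?thesis
      using x by (intro exI[of _ "U \<inter> V"]) (auto simp: pullback_on_def)
  qed
  have "\<omega> u = 0" if "u \<notin> U" for u
    using that supp K0U by (auto simp: supported_in_def)
  then have "\<omega> \<in> forms a b U"
    unfolding forms_def using type smooth pullback by simp
  then show "\<omega> \<in> forms_c a b U"
    using K0 K0U supp by (auto simp: forms_c_def)
qed

lemma forms_c_0: "open U \<Longrightarrow> U \<subseteq> NSigma \<Longrightarrow> (\<lambda>u. 0) \<in> forms_c a b U"
  by (subst forms_c_iff) (simp_all add: test_functions_0)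

lemma forms_c_add:
  assumes U: "open U" "U \<subseteq> NSigma" and "\<omega> \<in> forms_c a b U" "\<eta> \<in> forms_c a b U"
  shows "(\<lambda>u. \<omega> u + \<eta> u) \<in> forms_c a b U"
proof -
  have "card I = a \<and> card J = b" if "\<omega> u $ (I, J) + \<eta> u $ (I, J) \<noteq> 0" for I J u
    using that assms(3,4) unfolding forms_c_iff[OF U] by (metis add.right_neutral)
  moreover have "(\<lambda>u. \<omega> u $ (I, J) + \<eta> u $ (I, J)) \<in> test_functions (U - E_infty (I \<union> J))" for I J
    using assms(3,4) unfolding forms_c_iff[OF U] by (intro test_functions_add) blast+
  ultimately show ?thesis
    unfolding forms_c_iff[OF U] vector_add_component by blast
qed

lemma forms_c_scale:
  assumes U: "open U" "U \<subseteq> NSigma" and "\<omega> \<in> forms_c a b U"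
  shows "(\<lambda>u. c *\<^sub>R \<omega> u) \<in> forms_c a b U"
proof -
  have "card I = a \<and> card J = b" if "c * \<omega> u $ (I, J) \<noteq> 0" for I J u
    using that assms(3) unfolding forms_c_iff[OF U] by (metis mult_zero_right)
  moreover have "(\<lambda>u. c * \<omega> u $ (I, J)) \<in> test_functions (U - E_infty (I \<union> J))" for I J
    using assms(3) unfolding forms_c_iff[OF U] by (intro test_functions_scale) blast
  ultimately show ?thesis
    unfolding forms_c_iff[OF U] vector_scaleR_component real_scaleR_def by blast
qed

definition monomial :: "('n point \<Rightarrow> real) \<Rightarrow> 'n set \<Rightarrow> 'n set \<Rightarrow> 'n::{finite,linorder} form" where
  "monomial f I J = (\<lambda>u. f u *\<^sub>R du I J)"

lemma monomial_nth: "monomial f I J u $ (P, Q) = (if P = I \<and> Q = J then f u else 0)"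
  by (simp add: monomial_def du_nth)

lemma monomial_forms_c:
  assumes U: "open U" "U \<subseteq> NSigma" and f: "f \<in> test_functions (U - E_infty (I \<union> J))"
    and "card I = a" "card J = b"
  shows "monomial f I J \<in> forms_c a b U"
proof -
  have "(\<lambda>u. monomial f I J u $ (P, Q)) \<in> test_functions (U - E_infty (P \<union> Q))" for P Q
  proof (cases "P = I \<and> Q = J")
    case True
    then show ?thesis
      using f by (simp add: monomial_nth)
  next
    case False
    then have "(\<lambda>u. monomial f I J u $ (P, Q)) = (\<lambda>u. 0)"
      by (simp only: monomial_nth if_False)
    then show ?thesis
      by (simp only: test_functions_0)
  qed
  then show ?thesis
    using assms(4,5) unfolding forms_c_iff[OF U] by (auto simp: monomial_nth)
qed

lemma forms_c_expand:
  assumes U: "open U" "U \<subseteq> NSigma" and \<omega>: "\<omega> \<in> forms_c a b U"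
  shows "\<omega> = (\<lambda>u. \<Sum>(I, J)\<in>{I. card I = a} \<times> {J. card J = b}. monomial (\<lambda>u. \<omega> u $ (I, J)) I J u)"
proof -
  have "\<omega> u $ (P, Q) = (\<Sum>(I, J)\<in>{I. card I = a} \<times> {J. card J = b}. monomial (\<lambda>u. \<omega> u $ (I, J)) I J u) $ (P, Q)"
    for u P Q
  proof -
    have "(\<Sum>(I, J)\<in>{I. card I = a} \<times> {J. card J = b}. monomial (\<lambda>u. \<omega> u $ (I, J)) I J u) $ (P, Q)
      = (\<Sum>IJ\<in>{I. card I = a} \<times> {J. card J = b}. if IJ = (P, Q) then \<omega> u $ (P, Q) else 0)"
      unfolding sum_component
    proof (rule sum.cong[OF refl])
      fix IJ :: "'a set \<times> 'a set"
      show "(case IJ of (I, J) \<Rightarrow> monomial (\<lambda>u. \<omega> u $ (I, J)) I J u) $ (P, Q) =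
          (if IJ = (P, Q) then \<omega> u $ (P, Q) else 0)"
        by (cases IJ) (simp only: prod.case monomial_nth prod.inject eq_commute[of P] eq_commute[of Q]
          cong: if_cong)
    qed
    also have "\<dots> = (if card P = a \<and> card Q = b then \<omega> u $ (P, Q) else 0)"
      by simp
    also have "\<dots> = \<omega> u $ (P, Q)"
      using \<omega> unfolding forms_c_iff[OF U] by metis
    finally show ?thesis
      by simp
  qed
  then have eq: "\<omega> u $ (fst PQ, snd PQ) = (\<Sum>(I, J)\<in>{I. card I = a} \<times> {J. card J = b}.
      monomial (\<lambda>u. \<omega> u $ (I, J)) I J u) $ (fst PQ, snd PQ)" for u PQ
    by blast
  show ?thesis
    by (rule ext, unfold vec_eq_iff, rule allI, rule eq[unfolded prod.collapse])
qed

text \<open>A version of \<open>form_coeff_test_function\<close> that is uniform on \<open>forms_K\<close>. It is the reason for the coverings in the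
  definition of the topology on forms: a functional bounded on functions supported in a compact
  subset of \<open>U - E_infty (I \<union> J)\<close> can only be applied to the coefficients if these are supported in one
  such subset.\<close>

lemma forms_K_coeff_support:
  assumes U: "open U" "U \<subseteq> NSigma" and K: "compact K" "K \<subseteq> U" and \<V>: "finite_open_cover U K \<V>"
  shows "\<exists>K'. compact K' \<and> K' \<subseteq> K \<and> K' \<subseteq> U - E_infty (I \<union> J) \<and>
    (\<forall>\<omega>\<in>forms_K a b U K \<V>. supported_in K' (\<lambda>u. \<omega> u $ (I, J)))"
proof -
  define G where "G = \<Union>{W. open W \<and> (\<forall>\<omega>\<in>forms_K a b U K \<V>. \<forall>u\<in>W. \<omega> u $ (I, J) = 0)}"
  have "open G"
    unfolding G_def by auto
  then have "compact (K - G)"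
    by (rule compact_diff[OF K(1)])
  moreover have "K - G \<subseteq> U - E_infty (I \<union> J)"
  proof
    fix x assume x: "x \<in> K - G"
    then obtain L where L: "x \<in> stratum L"
      using K(2) U(2) stratum_cover by blast
    obtain V where V: "V \<in> \<V>" "x \<in> V" "openin (top_of_set U) V"
      using x \<V> by (auto simp: finite_open_cover_def)
    then have "open V"
      using U(1) by (simp add: openin_open_eq)
    have "x \<notin> E_infty (I \<union> J)"
    proof
      assume "x \<in> E_infty (I \<union> J)"
      then have ne: "(I \<union> J) \<inter> L \<noteq> {}"
        using stratum_E_infty[OF L] by blast
      \<comment> \<open>the neighbourhood of \<open>x\<close> on which the coefficient vanishes depends only on \<open>V\<close>\<close>
      define W where "W = {u. u \<in> V \<and> proj L u \<in> V \<and> (\<exists>L'\<subseteq>L. u \<in> stratum L') \<and> proj L u \<in> stratum L}"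
      have "\<forall>\<^sub>F u in nhds x. proj L u \<in> V"
        using topological_tendstoD[OF tendsto_proj[of L x] \<open>open V\<close>] V(2) proj_eq_self[OF L] by simp
      then have "\<forall>\<^sub>F u in nhds x. u \<in> W"
        using eventually_nhds_in_open[OF \<open>open V\<close> V(2)] eventually_stratum[OF L]
        unfolding W_def by eventually_elim blast
      then obtain W' where W': "open W'" "x \<in> W'" "W' \<subseteq> W"
        by (auto simp: eventually_nhds)
      have "\<omega> u $ (I, J) = 0" if \<omega>: "\<omega> \<in> forms_K a b U K \<V>" and u: "u \<in> W'" for \<omega> u
      proof -
        have u: "u \<in> W"
          using u W'(3) by blast
        have "pullback_on V L \<omega>"
          using \<omega> V(1,2) L unfolding forms_K_def by blast
        then have "\<omega> u = \<omega> (proj L u)"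
          using u unfolding pullback_on_def W_def by blast
        moreover have "\<omega> (proj L u) $ (I, J) = 0"
          using \<omega> u ne by (intro form_coeff_E_infty[of _ a b U]) (auto simp: forms_K_def forms_c_def W_def)
        ultimately show ?thesis
          by simp
      qed
      then have "x \<in> G"
        using W'(1,2) unfolding G_def by blast
      then show False
        using x by simp
    qed
    then show "x \<in> U - E_infty (I \<union> J)"
      using x K(2) by auto
  qed
  moreover have "supported_in (K - G) (\<lambda>u. \<omega> u $ (I, J))" if "\<omega> \<in> forms_K a b U K \<V>" for \<omega>
    unfolding supported_in_def
  proof (intro allI impI)
    fix u assume "u \<notin> K - G"
    then consider "u \<notin> K" | "u \<in> G"
      by blast
    then show "\<omega> u $ (I, J) = 0"
    proof cases
      case 1
      then show ?thesis
        using that by (simp add: forms_K_def supported_in_def)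
    next
      case 2
      then show ?thesis
        using that by (auto simp: G_def)
    qed
  qed
  ultimately show ?thesis
    by (intro exI[of _ "K - G"]) auto
qed

lemma sup_on_le_form_norm:
  assumes "compact K" "\<And>I J. continuous_on K (\<lambda>u. \<omega> u $ (I, J))"
  shows "sup_on K (\<lambda>u. \<omega> u $ (I, J)) \<le> form_norm K 0 \<omega>"
proof -
  have nn: "0 \<le> sup_on K (\<lambda>u. \<omega> u $ (P, Q))" for P Q
    using assms by (intro sup_on_nonneg)
  have "{\<alpha> :: 'a \<Rightarrow> nat. (\<Sum>i\<in>UNIV. \<alpha> i) \<le> 0} = {\<lambda>_. 0}"
    by (auto simp: fun_eq_iff)
  moreover have "mdiff (\<lambda>_. 0) f = f" for f :: "'a point \<Rightarrow> real"
  proof -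
    have "foldr (\<lambda>i. pdiff i ^^ 0) xs f = f" for xs
      by (induction xs) auto
    then show ?thesis
      by (simp add: mdiff_def)
  qed
  ultimately have eq: "form_norm K 0 \<omega> = (\<Sum>P\<in>UNIV. \<Sum>Q\<in>UNIV. sup_on K (\<lambda>u. \<omega> u $ (P, Q)))"
    by (simp add: form_norm_def)
  have "sup_on K (\<lambda>u. \<omega> u $ (I, J)) \<le> (\<Sum>Q\<in>UNIV. sup_on K (\<lambda>u. \<omega> u $ (I, Q)))"
    using nn by (intro member_le_sum) auto
  also have "\<dots> \<le> form_norm K 0 \<omega>"
    unfolding eq using nn by (intro member_le_sum sum_nonneg) auto
  finally show ?thesis .
qed

lemma direct_limit_forms:
  assumes U: "open U" "U \<subseteq> NSigma"
  shows "direct_limit (forms_c a b U)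
     {(forms_K a b U K \<V>, form_norm K) | K \<V>. compact K \<and> K \<subseteq> U \<and> finite_open_cover U K \<V>}"
  by unfold_locales
    (auto simp: forms_c_0[OF U] forms_c_add[OF U] forms_c_scale[OF U] forms_K_def)

section \<open>Currents and their co-coefficients\<close>

definition sgn_deg :: "nat \<Rightarrow> real" where
  "sgn_deg q = (-1) ^ (q * (q - 1) div 2)"

lemma sgn_deg_square: "sgn_deg q * sgn_deg q = 1" "sgn_deg q * (sgn_deg q * x) = x"
  by (simp_all add: sgn_deg_def mult.assoc[symmetric] power_mult_distrib[symmetric])

text \<open>This is \<^const>\<open>cocoeff\<close> as a functional on functions instead of forms of type \<open>(0,0)\<close>, so that
  the results on functionals on test functions apply to it.\<close>

definition cocoeff_fun ::
  "('n form \<Rightarrow> real) \<Rightarrow> 'n set \<Rightarrow> 'n set \<Rightarrow> ('n::{finite,linorder} point \<Rightarrow> real) \<Rightarrow> real" where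
  "cocoeff_fun T I J f = T (monomial (\<lambda>u. sgn_deg (card I) * f u) I J)"

lemma E_infty_empty [simp]: "E_infty {} = {}"
  by (simp add: E_infty_def)

lemma radon_extension_iff:
  assumes X: "open X" "X \<subseteq> NSigma" "X = U - E_infty (I \<union> J)"
  shows "radon_extension X (cocoeff U T I J) \<mu> \<longleftrightarrow>
    real_radon_measure X \<mu> \<and> (\<forall>f\<in>test_functions X. \<mu> f = cocoeff_fun T I J f)"
proof -
  have cc: "cocoeff U T I J F = cocoeff_fun T I J (\<lambda>u. F u $ ({}, {}))" if "F \<in> forms_c 0 0 X" for F
    using that X(3) by (simp add: cocoeff_def cocoeff_fun_def monomial_def sgn_deg_def)
  have "(\<forall>F\<in>forms_c 0 0 X. \<mu> (\<lambda>u. F u $ ({}, {})) = cocoeff U T I J F) \<longleftrightarrow>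
      (\<forall>f\<in>test_functions X. \<mu> f = cocoeff_fun T I J f)"
  proof (intro iffI ballI)
    fix f assume *: "\<forall>F\<in>forms_c 0 0 X. \<mu> (\<lambda>u. F u $ ({}, {})) = cocoeff U T I J F"
      and f: "f \<in> test_functions X"
    have "monomial f {} {} \<in> forms_c 0 0 X"
      using f by (intro monomial_forms_c X) auto
    then show "\<mu> f = cocoeff_fun T I J f"
      using * cc by (force simp: monomial_nth)
  next
    fix F assume *: "\<forall>f\<in>test_functions X. \<mu> f = cocoeff_fun T I J f" and F: "F \<in> forms_c 0 0 X"
    have "(\<lambda>u. F u $ ({}, {})) \<in> test_functions X"
      using form_coeff_test_function[OF X(1,2) F, of "{}" "{}"] by simp
    then show "\<mu> (\<lambda>u. F u $ ({}, {})) = cocoeff U T I J F"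
      using * cc[OF F] by simp
  qed
  then show ?thesis
    by (simp add: radon_extension_def)
qed

lemma cocoeff_fun_linear:
  assumes U: "open U" "U \<subseteq> NSigma" and T: "linear_on (forms_c q q U) T"
    and IJ: "card I = q" "card J = q" and f: "f \<in> test_functions (U - E_infty (I \<union> J))"
  shows "cocoeff_fun T I J (\<lambda>u. c * f u) = c * cocoeff_fun T I J f"
    and "g \<in> test_functions (U - E_infty (I \<union> J)) \<Longrightarrow>
      cocoeff_fun T I J (\<lambda>u. f u + g u) = cocoeff_fun T I J f + cocoeff_fun T I J g"
proof -
  have m: "monomial (\<lambda>u. sgn_deg (card I) * f u) I J \<in> forms_c q q U"
    if "f \<in> test_functions (U - E_infty (I \<union> J))" for f
    using that IJ by (intro monomial_forms_c U test_functions_scale)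
  have "T (\<lambda>u. c *\<^sub>R monomial (\<lambda>u. sgn_deg (card I) * f u) I J u)
      = c * T (monomial (\<lambda>u. sgn_deg (card I) * f u) I J)"
    using T[unfolded linear_on_def, THEN conjunct2, rule_format, OF m[OF f]] .
  then show "cocoeff_fun T I J (\<lambda>u. c * f u) = c * cocoeff_fun T I J f"
    by (simp add: cocoeff_fun_def monomial_def mult.left_commute)
  assume g: "g \<in> test_functions (U - E_infty (I \<union> J))"
  have "T (\<lambda>u. monomial (\<lambda>u. sgn_deg (card I) * f u) I J u + monomial (\<lambda>u. sgn_deg (card I) * g u) I J u)
      = T (monomial (\<lambda>u. sgn_deg (card I) * f u) I J) + T (monomial (\<lambda>u. sgn_deg (card I) * g u) I J)"
    using T[unfolded linear_on_def, THEN conjunct1, rule_format, OF m[OF f] m[OF g]] .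
  then show "cocoeff_fun T I J (\<lambda>u. f u + g u) = cocoeff_fun T I J f + cocoeff_fun T I J g"
    by (simp add: cocoeff_fun_def monomial_def distrib_left scaleR_add_left)
qed

text \<open>The current with given co-coefficients. The sign cancels the one in the definition of
  co-coefficients.\<close>

definition assemble :: "nat \<Rightarrow> 'n::{finite,linorder} point set \<Rightarrow>
    ('n set \<Rightarrow> 'n set \<Rightarrow> ('n point \<Rightarrow> real) \<Rightarrow> real) \<Rightarrow> 'n form \<Rightarrow> real" where
  "assemble q U \<nu> \<omega> = (if \<omega> \<in> forms_c q q U then
     \<Sum>(I, J)\<in>{I. card I = q} \<times> {J. card J = q}. sgn_deg q * \<nu> I J (\<lambda>u. \<omega> u $ (I, J)) else 0)"

lemma assemble_cocoeff_fun:
  assumes U: "open U" "U \<subseteq> NSigma" and T: "linear_on (forms_c q q U) T"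
    "\<And>\<omega>. \<omega> \<notin> forms_c q q U \<Longrightarrow> T \<omega> = 0"
  shows "T = assemble q U (cocoeff_fun T)"
proof
  fix \<omega>
  show "T \<omega> = assemble q U (cocoeff_fun T) \<omega>"
  proof (cases "\<omega> \<in> forms_c q q U")
    case True
    define c where "c I J = (\<lambda>u. \<omega> u $ (I, J))" for I J
    define P where "P = {I :: 'a set. card I = q} \<times> {J :: 'a set. card J = q}"
    have c: "c I J \<in> test_functions (U - E_infty (I \<union> J))" for I J
      unfolding c_def by (rule form_coeff_test_function[OF U True])
    have "T \<omega> = T (\<lambda>u. \<Sum>IJ\<in>P. monomial (c (fst IJ) (snd IJ)) (fst IJ) (snd IJ) u)"
      using forms_c_expand[OF U True] by (simp add: c_def P_def split_beta)
    also have "\<dots> = (\<Sum>IJ\<in>P. T (monomial (c (fst IJ) (snd IJ)) (fst IJ) (snd IJ)))"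
      using c by (intro linear_on_sum[OF T(1) forms_c_0[OF U] forms_c_add[OF U], THEN conjunct1]
          monomial_forms_c U) (auto simp: P_def)
    also have "\<dots> = (\<Sum>IJ\<in>P. sgn_deg q * cocoeff_fun T (fst IJ) (snd IJ) (c (fst IJ) (snd IJ)))"
    proof (rule sum.cong[OF refl])
      fix IJ assume "IJ \<in> P"
      then obtain I J where IJ: "IJ = (I, J)" "card I = q" "card J = q"
        by (auto simp: P_def)
      have "sgn_deg q * cocoeff_fun T I J (c I J) = cocoeff_fun T I J (\<lambda>u. sgn_deg q * c I J u)"
        using cocoeff_fun_linear(1)[OF U T(1) IJ(2,3) c] by simp
      also have "\<dots> = T (monomial (c I J) I J)"
        using IJ by (simp add: cocoeff_fun_def sgn_deg_square)
      finally show "T (monomial (c (fst IJ) (snd IJ)) (fst IJ) (snd IJ)) =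
          sgn_deg q * cocoeff_fun T (fst IJ) (snd IJ) (c (fst IJ) (snd IJ))"
        using IJ by simp
    qed
    finally show ?thesis
      using True by (simp add: assemble_def P_def c_def split_beta)
  qed (simp add: assemble_def T(2))
qed

lemma currents_iff:
  fixes T :: "'n::{finite,linorder} form \<Rightarrow> real"
  assumes "q = CARD('n) - p"
  shows "T \<in> currents p p U \<longleftrightarrow> (\<forall>\<omega>. \<omega> \<notin> forms_c q q U \<longrightarrow> T \<omega> = 0) \<and>
    linear_on (forms_c q q U) T \<and> continuous_map (forms_topology q q U) euclideanreal T"
  unfolding assms currents_def Let_def by blast

text \<open>Continuity holds since on \<open>forms_K\<close> each coefficient is bounded by a multiple of one test
  function, the multiple being a norm of the form.\<close>

lemma assemble_current:
  fixes U :: "'n::{finite,linorder} point set"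
  assumes U: "open U" "U \<subseteq> NSigma" and q: "q = CARD('n) - p"
    and \<nu>: "\<And>I J. card I = q \<Longrightarrow> card J = q \<Longrightarrow>
      dominated_functional (U - E_infty (I \<union> J)) (\<nu> I J) (bnd I J)"
  shows "assemble q U \<nu> \<in> currents p p U"
    and "\<And>I J f. card I = q \<Longrightarrow> card J = q \<Longrightarrow> f \<in> test_functions (U - E_infty (I \<union> J)) \<Longrightarrow>
      cocoeff_fun (assemble q U \<nu>) I J f = \<nu> I J f"
proof -
  define P where "P = {I :: 'n set. card I = q} \<times> {J :: 'n set. card J = q}"
  let ?A = "assemble q U \<nu>"
  have A: "?A \<omega> = (\<Sum>IJ\<in>P. sgn_deg q * \<nu> (fst IJ) (snd IJ) (\<lambda>u. \<omega> u $ IJ))"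
    if "\<omega> \<in> forms_c q q U" for \<omega>
    using that by (simp add: assemble_def P_def split_beta)
  note c = form_coeff_test_function[OF U]
  have dom: "dominated_functional (U - E_infty (fst IJ \<union> snd IJ)) (\<nu> (fst IJ) (snd IJ)) (bnd (fst IJ) (snd IJ))"
    if "IJ \<in> P" for IJ
    using \<nu> that by (auto simp: P_def)
  have c': "(\<lambda>u. \<omega> u $ IJ) \<in> test_functions (U - E_infty (fst IJ \<union> snd IJ))"
    if "\<omega> \<in> forms_c q q U" for \<omega> IJ
    using c[OF that, of "fst IJ" "snd IJ"] by simp
  have lin: "linear_on (forms_c q q U) ?A"
    unfolding linear_on_def
  proof (intro conjI ballI allI)
    fix \<omega> \<eta> assume *: "\<omega> \<in> forms_c q q U" "\<eta> \<in> forms_c q q U"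
    show "?A (\<lambda>u. \<omega> u + \<eta> u) = ?A \<omega> + ?A \<eta>"
      unfolding A[OF *(1)] A[OF *(2)] A[OF forms_c_add[OF U *]] sum.distrib[symmetric]
      using dominated_functional.\<nu>_add[OF dom c'[OF *(1)] c'[OF *(2)]]
      by (intro sum.cong refl) (simp add: distrib_left)
  next
    fix \<omega> and c :: real assume *: "\<omega> \<in> forms_c q q U"
    show "?A (\<lambda>u. c *\<^sub>R \<omega> u) = c * ?A \<omega>"
      unfolding A[OF *] A[OF forms_c_scale[OF U *]] sum_distrib_left
      using dominated_functional.\<nu>_scale[OF dom c'[OF *]]
      by (intro sum.cong refl) (simp add: mult.left_commute)
  qed
  have bound: "\<exists>C\<ge>0. \<forall>\<omega>\<in>forms_K q q U K \<V>. \<bar>?A \<omega>\<bar> \<le> C * form_norm K 0 \<omega>"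
    if K: "compact K" "K \<subseteq> U" and \<V>: "finite_open_cover U K \<V>" for K \<V>
  proof -
    have "\<exists>C\<ge>0. \<forall>\<omega>\<in>forms_K q q U K \<V>. \<bar>\<nu> (fst IJ) (snd IJ) (\<lambda>u. \<omega> u $ IJ)\<bar> \<le> C * form_norm K 0 \<omega>"
      if IJ: "IJ \<in> P" for IJ
    proof -
      define X where "X = U - E_infty (fst IJ \<union> snd IJ)"
      interpret dominated_functional X "\<nu> (fst IJ) (snd IJ)" "bnd (fst IJ) (snd IJ)"
        unfolding X_def by (rule dom[OF IJ])
      obtain K' where K': "compact K'" "K' \<subseteq> K" "K' \<subseteq> X"
        "\<And>\<omega>. \<omega> \<in> forms_K q q U K \<V> \<Longrightarrow> supported_in K' (\<lambda>u. \<omega> u $ IJ)"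
        using forms_K_coeff_support[OF U K \<V>, of "fst IJ" "snd IJ" q q] unfolding X_def by auto
      obtain h where h: "h \<in> test_functions X" "\<And>u. 0 \<le> h u" "\<And>u. u \<in> K' \<Longrightarrow> 1 \<le> h u"
        using test_function_ge_1_on_compact[OF X K'(1,3)] by blast
      have "\<bar>\<nu> (fst IJ) (snd IJ) (\<lambda>u. \<omega> u $ IJ)\<bar> \<le> bnd (fst IJ) (snd IJ) h * form_norm K 0 \<omega>"
        if \<omega>: "\<omega> \<in> forms_K q q U K \<V>" for \<omega>
      proof -
        have \<omega>': "\<omega> \<in> forms_c q q U"
          using \<omega> by (simp add: forms_K_def)
        have cont: "continuous_on K (\<lambda>u. \<omega> u $ (I, J))" for I J
          using c[OF \<omega>'] K(2) U(2) by (intro tame_continuous_on test_functions_tame) auto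
        have norm: "sup_on K (\<lambda>u. \<omega> u $ IJ) \<le> form_norm K 0 \<omega>"
          using sup_on_le_form_norm[OF K(1) cont, of "fst IJ" "snd IJ"] by simp
        have "0 \<le> sup_on K (\<lambda>u. \<omega> u $ IJ)"
          using sup_on_nonneg[OF K(1) cont, of "fst IJ" "snd IJ"] by simp
        then have norm0: "0 \<le> form_norm K 0 \<omega>"
          using norm by linarith
        have "\<bar>\<omega> u $ IJ\<bar> \<le> form_norm K 0 \<omega> * h u" for u
        proof (cases "u \<in> K'")
          case True
          have "\<bar>\<omega> u $ IJ\<bar> \<le> form_norm K 0 \<omega> * 1"
            using sup_on_upper[OF K(1) cont, of u "fst IJ" "snd IJ"] norm True K'(2) by auto
          also have "\<dots> \<le> form_norm K 0 \<omega> * h u"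
            using h(3)[OF True] norm0 by (intro mult_left_mono)
          finally show ?thesis .
        next
          case False
          then show ?thesis
            using K'(4)[OF \<omega>] norm0 h(2)[of u] by (simp add: supported_in_def)
        qed
        then have "\<bar>\<nu> (fst IJ) (snd IJ) (\<lambda>u. \<omega> u $ IJ)\<bar> \<le> bnd (fst IJ) (snd IJ) (\<lambda>u. form_norm K 0 \<omega> * h u)"
          using c'[OF \<omega>', of IJ] unfolding X_def[symmetric] by (intro dom test_functions_scale h)
        then show ?thesis
          unfolding bnd_scale[OF h(1)] by (simp only: mult.commute)
      qed
      then show ?thesis
        using bnd_nonneg[OF h(1,2)] by blast
    qed
    then have "\<forall>IJ\<in>P. \<exists>C. C \<ge> 0 \<and> (\<forall>\<omega>\<in>forms_K q q U K \<V>.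
        \<bar>\<nu> (fst IJ) (snd IJ) (\<lambda>u. \<omega> u $ IJ)\<bar> \<le> C * form_norm K 0 \<omega>)"
      by blast
    from bchoice[OF this] obtain C where C: "\<And>IJ. IJ \<in> P \<Longrightarrow> C IJ \<ge> 0"
      "\<And>IJ \<omega>. IJ \<in> P \<Longrightarrow> \<omega> \<in> forms_K q q U K \<V> \<Longrightarrow>
        \<bar>\<nu> (fst IJ) (snd IJ) (\<lambda>u. \<omega> u $ IJ)\<bar> \<le> C IJ * form_norm K 0 \<omega>"
      by blast
    have "\<bar>?A \<omega>\<bar> \<le> sum C P * form_norm K 0 \<omega>" if \<omega>: "\<omega> \<in> forms_K q q U K \<V>" for \<omega>
    proof -
      have "\<omega> \<in> forms_c q q U"
        using \<omega> by (simp add: forms_K_def)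
      then have "\<bar>?A \<omega>\<bar> \<le> (\<Sum>IJ\<in>P. \<bar>sgn_deg q * \<nu> (fst IJ) (snd IJ) (\<lambda>u. \<omega> u $ IJ)\<bar>)"
        by (simp only: A) (rule sum_abs)
      also have "\<dots> \<le> (\<Sum>IJ\<in>P. C IJ * form_norm K 0 \<omega>)"
        using C(2)[OF _ \<omega>] by (intro sum_mono) (simp add: abs_mult sgn_deg_def power_abs)
      finally show ?thesis
        by (simp add: sum_distrib_right)
    qed
    then show ?thesis
      using C(1) by (intro exI[of _ "sum C P"]) (auto intro: sum_nonneg)
  qed
  have "continuous_map (forms_topology q q U) euclideanreal ?A"
    unfolding forms_topology_def
    by (rule direct_limit.continuous_mapI[OF direct_limit_forms[OF U] lin]) (use bound in fastforce)
  then show "?A \<in> currents p p U"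
    using lin by (simp add: currents_iff[OF q] assemble_def)
  fix I J f
  assume IJ: "card I = q" "card J = q" and f: "f \<in> test_functions (U - E_infty (I \<union> J))"
  define \<omega> where "\<omega> = monomial (\<lambda>u. sgn_deg q * f u) I J"
  have \<omega>: "\<omega> \<in> forms_c q q U"
    unfolding \<omega>_def using f IJ by (intro monomial_forms_c U test_functions_scale)
  have "?A \<omega> = (\<Sum>IJ'\<in>P. if IJ' = (I, J) then sgn_deg q * \<nu> I J (\<lambda>u. sgn_deg q * f u) else 0)"
    unfolding A[OF \<omega>]
  proof (rule sum.cong[OF refl])
    fix IJ' assume IJ': "IJ' \<in> P"
    have "(\<lambda>u. \<omega> u $ IJ') = (if IJ' = (I, J) then (\<lambda>u. sgn_deg q * f u) else (\<lambda>u. 0))"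
      by (cases IJ') (auto simp: \<omega>_def monomial_nth fun_eq_iff)
    then show "sgn_deg q * \<nu> (fst IJ') (snd IJ') (\<lambda>u. \<omega> u $ IJ') =
        (if IJ' = (I, J) then sgn_deg q * \<nu> I J (\<lambda>u. sgn_deg q * f u) else 0)"
      using dominated_functional.\<nu>_0[OF dom[OF IJ']] by auto
  qed
  also have "\<dots> = sgn_deg q * \<nu> I J (\<lambda>u. sgn_deg q * f u)"
    using IJ by (simp add: P_def)
  also have "\<dots> = \<nu> I J f"
    using dominated_functional.\<nu>_scale[OF \<nu>[OF IJ] f] by (simp add: sgn_deg_square)
  finally show "cocoeff_fun ?A I J f = \<nu> I J f"
    using IJ by (simp add: cocoeff_fun_def \<omega>_def)
qed

section \<open>Positive currents\<close>

lemma neg_one_power_square: "(-1 :: real) ^ (q * q) = (-1) ^ q"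
  by (simp add: minus_one_power_iff)

text \<open>For \<open>\<beta> = \<surd>f (a d'u\<^sub>I + b d'u\<^sub>J)\<close> the form \<open>\<beta> \<and> J \<beta>\<close> has the coefficients
  \<open>a\<^sup>2 f\<close>, \<open>ab f\<close>, \<open>ba f\<close>, \<open>b\<^sup>2 f\<close>, and it is positive up to the sign. Taking \<open>a = 1\<close>, \<open>b = \<plusminus>1\<close> and using the symmetry
  \<open>T\<^bsup>IJ\<^esup> = T\<^bsup>JI\<^esup>\<close> bounds \<open>T\<^bsup>IJ\<^esup>(f)\<close> for \<open>f \<ge> 0\<close>. A general \<open>f\<close> with \<open>\<bar>f\<bar> \<le> h\<close> is half the difference of
  the nonnegative test functions \<open>h + f\<close> and \<open>h - f\<close>.\<close>

lemma positive_current_dominated: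
  fixes U :: "'n::{finite,linorder} point set"
  assumes U: "open U" "U \<subseteq> NSigma" and q: "q = CARD('n) - p"
    and T: "T \<in> currents p p U" "positive_current p U T" and IJ: "card I = q" "card J = q"
  shows "dominated_functional (U - E_infty (I \<union> J)) (cocoeff_fun T I J)
    (\<lambda>h. (cocoeff_fun T I I h + cocoeff_fun T J J h) / 2)"
proof -
  let ?X = "U - E_infty (I \<union> J)"
  have lin: "linear_on (forms_c q q U) T"
    using T(1) by (simp add: currents_iff[OF q])
  have sub: "test_functions ?X \<subseteq> test_functions (U - E_infty (P \<union> Q))"
    if "P \<in> {I, J}" "Q \<in> {I, J}" for P Q
    using that by (intro test_functions_mono) (auto simp: E_infty_def)
  have scale: "cocoeff_fun T P Q (\<lambda>u. c * f u) = c * cocoeff_fun T P Q f"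
    and add: "cocoeff_fun T P Q (\<lambda>u. f u + g u) = cocoeff_fun T P Q f + cocoeff_fun T P Q g"
    if "P \<in> {I, J}" "Q \<in> {I, J}" "f \<in> test_functions ?X" "g \<in> test_functions ?X" for P Q f g c
    using cocoeff_fun_linear[OF U lin, of P Q f] sub[OF that(1,2)] that IJ by auto
  have sym: "cocoeff_fun T J I f = cocoeff_fun T I J f" if f: "f \<in> test_functions ?X" for f
  proof -
    define \<omega> where "\<omega> = monomial (\<lambda>u. sgn_deg (card I) * f u) I J"
    have \<omega>: "\<omega> \<in> forms_c q q U"
      unfolding \<omega>_def using f IJ by (intro monomial_forms_c U test_functions_scale)
    have "(\<lambda>u. Jinv (\<omega> u)) = monomial (\<lambda>u. sgn_deg (card J) * ((-1) ^ q * f u)) J I"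
      using IJ by (auto simp: fun_eq_iff vec_eq_iff Jinv_nth \<omega>_def monomial_nth neg_one_power_square)
    then have "cocoeff_fun T J I (\<lambda>u. (-1) ^ q * f u) = T (\<lambda>u. Jinv (\<omega> u))"
      by (simp add: cocoeff_fun_def)
    also have "\<dots> = (-1) ^ q * cocoeff_fun T I J f"
      using T(2) \<omega> q by (simp add: positive_current_def Let_def cocoeff_fun_def \<omega>_def)
    finally show ?thesis
      using scale[of J I f f "(-1) ^ q"] f by simp
  qed
  have pos: "0 \<le> a * a * cocoeff_fun T I I f + a * b * cocoeff_fun T I J f
      + b * a * cocoeff_fun T J I f + b * b * cocoeff_fun T J J f"
    if f: "f \<in> test_functions ?X" "\<And>u. 0 \<le> f u" for f a b
  proof -
    define m where "m c P Q = monomial (\<lambda>u. sgn_deg q * (c * f u)) P Q" for c P Q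
    have m: "m c P Q \<in> forms_c q q U" and Tm: "T (m c P Q) = c * cocoeff_fun T P Q f"
      if "P \<in> {I, J}" "Q \<in> {I, J}" for c P Q
    proof -
      have "card P = q" "card Q = q"
        using that IJ by auto
      then show "m c P Q \<in> forms_c q q U"
        unfolding m_def using subsetD[OF sub[OF that] f(1)]
        by (intro monomial_forms_c U test_functions_scale)
      show "T (m c P Q) = c * cocoeff_fun T P Q f"
        using scale[OF that f(1) f(1), of c] \<open>card P = q\<close> by (simp add: cocoeff_fun_def m_def)
    qed
    define \<alpha> where "\<alpha> u = m (a * a) I I u + m (a * b) I J u + m (b * a) J I u + m (b * b) J J u" for u
    have ms: "m (a * a) I I \<in> forms_c q q U" "m (a * b) I J \<in> forms_c q q U"
      "m (b * a) J I \<in> forms_c q q U" "m (b * b) J J \<in> forms_c q q U"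
      using m by auto
    note add_T = lin[unfolded linear_on_def, THEN conjunct1, rule_format]
    have \<alpha>: "\<alpha> \<in> forms_c q q U"
      unfolding \<alpha>_def[abs_def] by (intro forms_c_add U ms)
    have "T \<alpha> = T (m (a * a) I I) + T (m (a * b) I J) + T (m (b * a) J I) + T (m (b * b) J J)"
      unfolding \<alpha>_def[abs_def]
      by (simp only: add_T forms_c_add[OF U] ms)
    moreover have "positive_form q U \<alpha>"
      unfolding positive_form_def
    proof (intro conjI allI ballI)
      show "\<alpha> \<in> forms q q U"
        using \<alpha> by (simp add: forms_c_def)
      fix L u assume u: "u \<in> U \<inter> stratum L"
      define \<beta> where "\<beta> = sqrt (f u) *\<^sub>R (a *\<^sub>R du I {} + b *\<^sub>R du J {})"
      have \<beta>: "\<beta> \<in> ext_type (- L) q 0"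
        unfolding ext_type_def
      proof (intro CollectI allI impI)
        fix P Q assume "\<beta> $ (P, Q) \<noteq> 0"
        then have *: "f u \<noteq> 0" "P = I \<or> P = J" "Q = {}"
          by (auto simp: \<beta>_def du_nth split: if_splits)
        then have "u \<in> ?X"
          using f(1) by (auto simp: test_functions_def supported_in_def)
        then have "(I \<union> J) \<inter> L = {}"
          using u stratum_E_infty[of u L "I \<union> J"] by blast
        then show "card P = q \<and> card Q = 0 \<and> P \<subseteq> - L \<and> Q \<subseteq> - L"
          using * IJ by auto
      qed
      have "\<alpha> u $ (P, Q) = (sgn_deg q *\<^sub>R (\<beta> \<and>\<^sub>e Jinv \<beta>)) $ (P, Q)" for P Q
      proof -
        have "\<beta> $ (R, {}) = sqrt (f u) * (a * of_bool (R = I) + b * of_bool (R = J))" for R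
          by (simp add: \<beta>_def du_nth)
        then have "\<beta> $ (P, {}) * \<beta> $ (Q, {}) = (sqrt (f u) * sqrt (f u)) *
            ((a * of_bool (P = I) + b * of_bool (P = J)) * (a * of_bool (Q = I) + b * of_bool (Q = J)))"
          by (simp add: mult_ac)
        then have "(\<beta> \<and>\<^sub>e Jinv \<beta>) $ (P, Q) = f u *
            ((a * of_bool (P = I) + b * of_bool (P = J)) * (a * of_bool (Q = I) + b * of_bool (Q = J)))"
          using f(2) by (simp add: wedge_Jinv_nth[OF \<beta>])
        then show ?thesis
          by (simp add: \<alpha>_def m_def monomial_nth algebra_simps)
      qed
      then have "\<alpha> u = (-1) ^ (q * (q - 1) div 2) *\<^sub>R (\<beta> \<and>\<^sub>e Jinv \<beta>)"
        by (auto simp: vec_eq_iff sgn_deg_def)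
      then show "\<alpha> u \<in> convex_cone hull
          {(-1) ^ (q * (q - 1) div 2) *\<^sub>R (\<alpha> \<and>\<^sub>e Jinv \<alpha>) | \<alpha>. \<alpha> \<in> ext_type (- L) q 0}"
        using \<beta> by (intro hull_inc) blast
    qed
    then have "0 \<le> T \<alpha>"
      using T(2) \<alpha> q by (simp add: positive_current_def Let_def)
    ultimately show ?thesis
      by (simp add: Tm)
  qed
  define B where "B h = (cocoeff_fun T I I h + cocoeff_fun T J J h) / 2" for h
  have B_scale: "B (\<lambda>u. c * f u) = c * B f" if "f \<in> test_functions ?X" for f c
    using scale[of I I f f c] scale[of J J f f c] that by (simp add: B_def algebra_simps)
  have B_add: "B (\<lambda>u. f u + g u) = B f + B g" if "f \<in> test_functions ?X" "g \<in> test_functions ?X" for f g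
    using add[of I I f g] add[of J J f g] that by (simp add: B_def field_simps)
  have nonneg_bound: "\<bar>cocoeff_fun T I J f\<bar> \<le> B f" if f: "f \<in> test_functions ?X" "\<And>u. 0 \<le> f u" for f
    using pos[OF f, of 1 1] pos[OF f, of 1 "-1"] sym[OF f(1)] by (simp add: B_def abs_le_iff)
  have "dominated_functional ?X (cocoeff_fun T I J) B"
  proof
    show "open ?X" "?X \<subseteq> NSigma"
      using U by (auto intro: open_minus_E_infty)
    fix f h assume f: "f \<in> test_functions ?X" and h: "h \<in> test_functions ?X" and fh: "\<And>u. \<bar>f u\<bar> \<le> h u"
    define f1 f2 where "f1 u = h u + f u" and "f2 u = h u + (-1) * f u" for u
    have t: "f1 \<in> test_functions ?X" "f2 \<in> test_functions ?X"
      unfolding f1_def[abs_def] f2_def[abs_def]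
      by (rule test_functions_add[OF h f], rule test_functions_add[OF h test_functions_scale[OF f]])
    have "0 \<le> f1 u" "0 \<le> f2 u" for u
      using fh[of u] by (auto simp: f1_def f2_def)
    then have "\<bar>cocoeff_fun T I J f1\<bar> \<le> B f1" "\<bar>cocoeff_fun T I J f2\<bar> \<le> B f2"
      using nonneg_bound t by auto
    moreover have "cocoeff_fun T I J f1 = cocoeff_fun T I J h + cocoeff_fun T I J f"
      unfolding f1_def[abs_def] using f h by (intro add) auto
    moreover have "cocoeff_fun T I J f2 = cocoeff_fun T I J h + (-1) * cocoeff_fun T I J f"
      unfolding f2_def[abs_def] using f h add[of I J h "\<lambda>u. (-1) * f u"] scale[of I J f f "-1"]
        test_functions_scale[OF f, of "-1"] by simp
    moreover have "B f1 = B h + B f" "B f2 = B h + (-1) * B f"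
      unfolding f1_def[abs_def] f2_def[abs_def] using B_add[OF h f]
        B_add[OF h test_functions_scale[OF f, of "-1"]] B_scale[OF f, of "-1"] by simp_all
    ultimately show "\<bar>cocoeff_fun T I J f\<bar> \<le> B h"
      by linarith
  qed (use scale[of I J] add[of I J] B_scale B_add in auto)
  then show ?thesis
    by (simp add: B_def[abs_def])
qed

section \<open>The decomposition\<close>

text \<open>A formula for the summands of an arbitrary decomposition in terms of \<open>T\<close>: cutting off near the
  stratum of \<open>L0\<close> kills all co-coefficients but that of \<open>S L0\<close> in the limit.\<close>

lemma cocoeff_fun_eq_limit:
  fixes U :: "'n::{finite,linorder} point set" and S :: "'n set \<Rightarrow> 'n form \<Rightarrow> real"
  assumes U: "open U" "U \<subseteq> NSigma" and IJ: "card I = q" "card J = q"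
    and S: "\<And>L. linear_on (forms_c q q U) (S L)"
      "\<And>L. \<exists>\<mu>. radon_extension (U - E_infty (I \<union> J)) (cocoeff U (S L) I J) \<mu>"
      "\<And>L \<mu>. radon_extension (U - E_infty (I \<union> J)) (cocoeff U (S L) I J) \<mu> \<Longrightarrow>
        radon_null_set (U - E_infty (I \<union> J)) \<mu> (U - (E_infty (I \<union> J) \<union> stratum L))"
    and T: "T = (\<lambda>\<omega>. \<Sum>L\<in>UNIV. S L \<omega>)"
    and f: "f \<in> test_functions (U - E_infty (I \<union> J))"
  shows "(\<lambda>k. cocoeff_fun T I J (\<lambda>u. cutoff k L0 u * f u)) \<longlonglongrightarrow> cocoeff_fun (S L0) I J f"
proof -
  define X where "X = U - E_infty (I \<union> J)"
  have X: "open X" "X \<subseteq> NSigma"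
    unfolding X_def using U by (auto intro: open_minus_E_infty)
  obtain \<mu> where \<mu>: "\<And>L. radon_extension X (cocoeff U (S L) I J) (\<mu> L)"
    using S(2) unfolding X_def by metis
  have eq: "\<mu> L g = cocoeff_fun (S L) I J g" if "g \<in> test_functions X" for L g
    using \<mu>[of L] that radon_extension_iff[OF X X_def] by blast
  have lin: "linear_on (Cc X) (\<mu> L)" for L
    using \<mu>[of L] by (simp add: radon_extension_def real_radon_measure_def)
  have null: "radon_null_set X (\<mu> L) (X - stratum L)" for L
    using S(3)[of L "\<mu> L"] \<mu>[of L] by (simp add: X_def Diff_eq Int_assoc)
  have fX: "f \<in> test_functions X"
    using f by (simp add: X_def)
  have cutoff: "(\<lambda>u. cutoff k L0 u * f u) \<in> test_functions X" for k
    using fX by (intro test_functions_mult tame_cutoff)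
  have "(\<lambda>k. \<mu> L (\<lambda>u. cutoff k L0 u * f u)) \<longlonglongrightarrow> (if L = L0 then \<mu> L0 f else 0)" for L
    using cutoff_limit_own_stratum[OF X lin null fX] cutoff_limit_other_stratum[OF X lin null fX, of L0 L]
    by auto
  then have "(\<lambda>k. \<Sum>L\<in>UNIV. \<mu> L (\<lambda>u. cutoff k L0 u * f u)) \<longlonglongrightarrow> (\<Sum>L\<in>UNIV. if L = L0 then \<mu> L0 f else 0)"
    by (intro tendsto_sum)
  moreover have "(\<Sum>L\<in>UNIV. \<mu> L (\<lambda>u. cutoff k L0 u * f u)) = cocoeff_fun T I J (\<lambda>u. cutoff k L0 u * f u)" for k
    by (simp add: eq[OF cutoff]) (simp add: cocoeff_fun_def T)
  ultimately show ?thesis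
    using eq[OF fX, of L0] by simp
qed

theorem theorem3:
  fixes U :: "'n::{finite,linorder} point set" and p :: nat and T :: "'n form \<Rightarrow> real"
  assumes "openin (top_of_set NSigma) U"
    and "p \<le> CARD('n)"
    and "T \<in> currents p p U"
    and "positive_current p U T"
  shows "\<exists>!S :: 'n set \<Rightarrow> 'n form \<Rightarrow> real.
    (\<forall>L. S L \<in> currents p p U \<and> has_radon_cocoeffs p U (S L) \<and>
       (\<forall>I J \<mu>. card I = CARD('n) - p \<longrightarrow> card J = CARD('n) - p \<longrightarrow>
          radon_extension (U - E_infty (I \<union> J)) (cocoeff U (S L) I J) \<mu> \<longrightarrow>
          radon_null_set (U - E_infty (I \<union> J)) \<mu> (U - (E_infty (I \<union> J) \<union> stratum L)))) \<and>
    T = (\<lambda>\<omega>. \<Sum>L\<in>UNIV. S L \<omega>)"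
    (is "\<exists>!S. ?decomposition S")
proof -
  define q where "q = CARD('n) - p"
  have U: "open U" "U \<subseteq> NSigma"
    using assms(1) by (auto simp: openin_NSigma_iff)
  note cur = currents_iff[OF q_def]
  have linT: "linear_on (forms_c q q U) T" and T0: "\<And>\<omega>. \<omega> \<notin> forms_c q q U \<Longrightarrow> T \<omega> = 0"
    using assms(3) by (auto simp: cur)
  define X where "X I J = U - E_infty (I \<union> J)" for I J :: "'n set"
  have X: "open (X I J)" "X I J \<subseteq> NSigma" for I J
    unfolding X_def using U by (auto intro: open_minus_E_infty)
  define \<nu> where "\<nu> = cocoeff_fun T"
  define B where "B I J h = (\<nu> I I h + \<nu> J J h) / 2" for I J h
  have dom: "dominated_functional (X I J) (\<nu> I J) (B I J)" if "card I = q" "card J = q" for I J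
    using positive_current_dominated[OF U q_def assms(3,4) that] by (simp add: X_def B_def[abs_def] \<nu>_def)
  \<comment> \<open>the co-coefficients of the current to be constructed for \<open>L\<close>\<close>
  define R where "R L I J = dominated_functional.restrict (\<nu> I J) L" for L I J
  have domR: "dominated_functional (X I J) (R L I J) (B I J)" if "card I = q" "card J = q" for I J L
    unfolding R_def by (rule dominated_functional.dominated_restrict[OF dom[OF that]])
  define S where "S L = assemble q U (R L)" for L
  have S: "S L \<in> currents p p U" and S_coeff: "\<And>I J f. card I = q \<Longrightarrow> card J = q \<Longrightarrow>
      f \<in> test_functions (X I J) \<Longrightarrow> cocoeff_fun (S L) I J f = R L I J f" for L
    using assemble_current[OF U q_def, of "R L" B] domR unfolding S_def X_def by blast+
  have ext: "radon_extension (X I J) (cocoeff U (S L) I J) \<mu> \<longleftrightarrow>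
      real_radon_measure (X I J) \<mu> \<and> (\<forall>f\<in>test_functions (X I J). \<mu> f = R L I J f)"
    if "card I = q" "card J = q" for I J L \<mu>
    using radon_extension_iff[OF X X_def] S_coeff[OF that] by simp
  have "?decomposition S"
  proof (intro conjI allI impI)
    fix L
    show "S L \<in> currents p p U"
      by (rule S)
    show "has_radon_cocoeffs p U (S L)"
      unfolding has_radon_cocoeffs_def q_def[symmetric] X_def[symmetric]
      using ext dominated_functional.real_radon_measure_extension[OF domR]
        dominated_functional.extension_eq[OF domR] by blast
    fix I J \<mu>
    assume IJ: "card I = CARD('n) - p" "card J = CARD('n) - p"
      and \<mu>: "radon_extension (U - E_infty (I \<union> J)) (cocoeff U (S L) I J) \<mu>"
    have "radon_null_set (X I J) \<mu> (X I J - stratum L)"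
      using dominated_functional.null_set_restrict[OF dom, of I J \<mu> L] ext[of I J L \<mu>] IJ \<mu>
      by (simp add: q_def X_def R_def)
    then show "radon_null_set (U - E_infty (I \<union> J)) \<mu> (U - (E_infty (I \<union> J) \<union> stratum L))"
      by (simp add: X_def Diff_eq Int_assoc)
  next
    show "T = (\<lambda>\<omega>. \<Sum>L\<in>UNIV. S L \<omega>)"
    proof
      fix \<omega>
      show "T \<omega> = (\<Sum>L\<in>UNIV. S L \<omega>)"
      proof (cases "\<omega> \<in> forms_c q q U")
        case True
        let ?P = "{I :: 'n set. card I = q} \<times> {J :: 'n set. card J = q}"
        have "(\<Sum>L\<in>UNIV. S L \<omega>) =
            (\<Sum>IJ\<in>?P. \<Sum>L\<in>UNIV. sgn_deg q * R L (fst IJ) (snd IJ) (\<lambda>u. \<omega> u $ IJ))"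
          using True by (simp add: S_def assemble_def split_beta) (rule sum.swap)
        also have "\<dots> = (\<Sum>IJ\<in>?P. sgn_deg q * \<nu> (fst IJ) (snd IJ) (\<lambda>u. \<omega> u $ IJ))"
        proof (rule sum.cong[OF refl])
          fix IJ assume "IJ \<in> ?P"
          then have IJ: "card (fst IJ) = q" "card (snd IJ) = q"
            by auto
          have "(\<lambda>u. \<omega> u $ IJ) \<in> test_functions (X (fst IJ) (snd IJ))"
            using form_coeff_test_function[OF U True, of "fst IJ" "snd IJ"] by (simp add: X_def)
          from dominated_functional.sum_restrict[OF dom[OF IJ] this]
          show "(\<Sum>L\<in>UNIV. sgn_deg q * R L (fst IJ) (snd IJ) (\<lambda>u. \<omega> u $ IJ)) =
              sgn_deg q * \<nu> (fst IJ) (snd IJ) (\<lambda>u. \<omega> u $ IJ)"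
            by (simp add: R_def sum_distrib_left[symmetric])
        qed
        also have "\<dots> = T \<omega>"
          using True fun_cong[OF assemble_cocoeff_fun[OF U linT T0], of \<omega>]
          by (simp add: \<nu>_def assemble_def split_beta)
        finally show ?thesis
          by simp
      qed (simp add: T0 S_def assemble_def)
    qed
  qed
  moreover have "S1 = S2" if S1: "?decomposition S1" and S2: "?decomposition S2" for S1 S2
  proof
    fix L
    have lin: "linear_on (forms_c q q U) (S' L)" and zero: "\<And>\<omega>. \<omega> \<notin> forms_c q q U \<Longrightarrow> S' L \<omega> = 0"
      and lim: "\<And>I J f. card I = q \<Longrightarrow> card J = q \<Longrightarrow> f \<in> test_functions (X I J) \<Longrightarrow>
        (\<lambda>k. cocoeff_fun T I J (\<lambda>u. cutoff k L u * f u)) \<longlonglongrightarrow> cocoeff_fun (S' L) I J f"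
      if S': "?decomposition S'" for S' L
    proof -
      show lin: "linear_on (forms_c q q U) (S' L)" for L
        using S' cur by blast
      show "S' L \<omega> = 0" if "\<omega> \<notin> forms_c q q U" for \<omega>
        using S' that cur by blast
      fix I J f
      assume IJ: "card I = q" "card J = q" and f: "f \<in> test_functions (X I J)"
      show "(\<lambda>k. cocoeff_fun T I J (\<lambda>u. cutoff k L u * f u)) \<longlonglongrightarrow> cocoeff_fun (S' L) I J f"
      proof (rule cocoeff_fun_eq_limit[OF U IJ lin])
        show "\<exists>\<mu>. radon_extension (U - E_infty (I \<union> J)) (cocoeff U (S' L) I J) \<mu>" for L
          using S' IJ unfolding has_radon_cocoeffs_def q_def by blast
        show "radon_null_set (U - E_infty (I \<union> J)) \<mu> (U - (E_infty (I \<union> J) \<union> stratum L))"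
          if "radon_extension (U - E_infty (I \<union> J)) (cocoeff U (S' L) I J) \<mu>" for L \<mu>
          using S' IJ that unfolding q_def by blast
        show "T = (\<lambda>\<omega>. \<Sum>L\<in>UNIV. S' L \<omega>)"
          using S' by blast
        show "f \<in> test_functions (U - E_infty (I \<union> J))"
          using f by (simp add: X_def)
      qed
    qed
    have "cocoeff_fun (S1 L) I J f = cocoeff_fun (S2 L) I J f"
      if "card I = q" "card J = q" "f \<in> test_functions (X I J)" for I J f
      using lim[OF S1 that] lim[OF S2 that] by (rule LIMSEQ_unique)
    then have "assemble q U (cocoeff_fun (S1 L)) = assemble q U (cocoeff_fun (S2 L))"
      unfolding assemble_def fun_eq_iff X_def
      by (auto intro!: sum.cong simp: form_coeff_test_function[OF U])
    then show "S1 L = S2 L"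
      using assemble_cocoeff_fun[OF U lin[OF S1] zero[OF S1]]
        assemble_cocoeff_fun[OF U lin[OF S2] zero[OF S2]] by metis
  qed
  ultimately show ?thesis
    by blast
qed

end
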